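(* Let $f$ be a non-constant, non-linear entire map in the class $\mathcal{R}$. Let $A\subset\mathbb{C}$ be a completely $f$-invariant measurable set of positive Lebesgue measure and let $\Gamma\subset FD(f)$ be a subset. If $A$ does not admit a (non-zero) invariant Beltrami differential, then $S(\Gamma)$ is $\rho$-left amenable, where $\rho$ is the Ruelle representation of $S(\Gamma)$ on $L_1(A)$.
   Context: An entire map $f$ belongs to the class $\mathcal{R}$ if there is a rectifiable ray $R\subset\mathbb{C}$ containing the singular set of $f$ (the union of the sets of critical and asymptotic values). $A$ is completely invariant if $f^{-1}(A)=A$. An invariant Beltrami differential on $A$ is an element $\mu\in L_\infty(A)$ with $\mu(f)\frac{\overline{f'}}{f'}=\mu$ almost everywhere. Let $U=\mathbb{C}\setminus R$ and $V=f^{-1}(U)=\bigcup_{i\in I}V_i$, where the $V_i$ are the (simply connected) components of $V$, indexed by a countable set $I$ ($I=\mathbb{N}$ when there are infinitely many), so that each $f_i=f|_{V_i}:V_i\to U$ is a holomorphic homeomorphism. For each bijection $b$ of $I$ let $h_b$ be the piecewise conformal automorphism of $V$ given by $h_b(z)=f_{b(i)}^{-1}\circ f_i(z)$ for $z\in V_i$. $FD(f)$ is the group generated by all the $h_b$; its elements $\gamma$ are defined almost everywhere and satisfy $f\circ\gamma=f$ almost everywhere. Each $\gamma\in FD(f)$ acts on $L_1$ by $\gamma_*(\phi)=\phi(\gamma^{-1})[(\gamma^{-1})']^2$. For $\gamma\in\Gamma$ put $f_\gamma=\gamma\circ f\circ\gamma^{-1}=\gamma\circ f$, and let $S(\Gamma)$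 be the semigroup (of almost everywhere defined maps) generated by $f_\gamma$, $\gamma\in\Gamma$. The Ruelle operator of $f$ is $f_*(\phi)(x)=\sum_{y\in f^{-1}(x)}\frac{\phi(y)}{(f'(y))^2}$. The Ruelle representation $\rho:S(\Gamma)\to End(L_1(A))$ is the homomorphism given on generators by $\rho(f_\gamma)(\phi)=\gamma_*\circ f_*(\phi)$. For a semigroup $S$ and a bounded homomorphism $\rho:S\to End(B)$ into the continuous linear endomorphisms of a Banach space $B$, and $(b,b^* )\in B\times B^*$, let $f_{(b,b^* )}\in L_\infty(S)$ (bounded functions on $S$) be $f_{(b,b^* )}(s)=b^*(\rho(s)b)$. Let $Y_\rho$ be the closure of the linear span of all these functions, and $X_\rho$ the space generated by $Y_\rho$ and the constant functions. $S$ is $\rho$-left amenable if there is a mean $M$ on $L_\infty(S)$ (a positive linear functional with $M(1)=1$) whose restriction to $X_\rho$ is invariant under the left action of $S$, i.e. $M(\varphi(s\,\cdot))=M(\varphi)$ for all $s\in S$, $\varphi\in X_\rho$. *)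

theory Defs
  imports "HOL-Analysis.Analysis"
begin

section \<open>Entire maps whose singular set lies on a rectifiable ray\<close>

definition critical_values :: "(complex \<Rightarrow> complex) \<Rightarrow> complex set" where
  "critical_values f = f ` {z. deriv f z = 0}"

definition asymptotic_values :: "(complex \<Rightarrow> complex) \<Rightarrow> complex set" where
  "asymptotic_values f =
    {a. \<exists>r :: real \<Rightarrow> complex. continuous_on {0..} r \<and> filterlim r at_infinity at_top
          \<and> ((\<lambda>t. f (r t)) \<longlongrightarrow> a) at_top}"

definition singular_set :: "(complex \<Rightarrow> complex) \<Rightarrow> complex set" where
  "singular_set f = critical_values f \<union> asymptotic_values f"

definition finite_length_on :: "real \<Rightarrow> real \<Rightarrow> (real \<Rightarrow> complex) \<Rightarrow> bool" where
  "finite_length_on a b r \<longleftrightarrow>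
    (\<exists>L. \<forall>(n::nat) (t::nat \<Rightarrow> real). mono_on {..n} t \<longrightarrow> t ` {..n} \<subseteq> {a..b}
          \<longrightarrow> (\<Sum>i<n. dist (r (t i)) (r (t (Suc i)))) \<le> L)"

text \<open>A ray is a simple arc from a finite point to infinity.  Being unbounded, it has infinite
  length; rectifiable means that its compact subarcs have finite length.\<close>

definition rectifiable_ray :: "complex set \<Rightarrow> bool" where
  "rectifiable_ray R \<longleftrightarrow>
    (\<exists>r :: real \<Rightarrow> complex. continuous_on {0..} r \<and> inj_on r {0..}
        \<and> filterlim r at_infinity at_top
        \<and> (\<forall>T\<ge>0. finite_length_on 0 T r) \<and> R = r ` {0..})"


section \<open>Full deck transformations\<close>

definition deck_domain :: "(complex \<Rightarrow> complex) \<Rightarrow> complex set \<Rightarrow> complex set" where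
  "deck_domain f R = f -` (- R)"

text \<open>The set of components of \<open>V = deck_domain f R\<close> is its own index set, so \<open>b\<close> below is a
  permutation of the components.  On the component \<open>W\<close> of \<open>z\<close> the map is \<open>f\<close> followed by the
  inverse of \<open>f\<close> restricted to \<open>b W\<close>.  Off \<open>V\<close>, which is a null set, all maps are extended by the
  identity: this makes them permutations of the plane, whose group inverse is \<open>inv\<close>.\<close>

definition deck_map ::
  "(complex \<Rightarrow> complex) \<Rightarrow> complex set \<Rightarrow> (complex set \<Rightarrow> complex set) \<Rightarrow> complex \<Rightarrow> complex" where
  "deck_map f R b z =
    (if z \<in> deck_domain f R
     then inv_into (b (connected_component_set (deck_domain f R) z)) f (f z)
     else z)"

inductive_set FD :: "(complex \<Rightarrow> complex) \<Rightarrow> complex set \<Rightarrow> (complex \<Rightarrow> complex) set"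
  for f :: "complex \<Rightarrow> complex" and R :: "complex set" where
  generator: "bij_betw b (components (deck_domain f R)) (components (deck_domain f R))
    \<Longrightarrow> deck_map f R b \<in> FD f R"
| identity: "id \<in> FD f R"
| compose: "g \<in> FD f R \<Longrightarrow> h \<in> FD f R \<Longrightarrow> g \<circ> h \<in> FD f R"
| inverse: "g \<in> FD f R \<Longrightarrow> inv g \<in> FD f R"


section \<open>The semigroup of almost everywhere defined maps\<close>

definition ae_class :: "(complex \<Rightarrow> complex) \<Rightarrow> (complex \<Rightarrow> complex) set" where
  "ae_class g = {h. AE z in lebesgue. h z = g z}"

text \<open>On classes of maps under which preimages of null sets are null, this is the class of
  \<open>g \<circ> h\<close>, for any choice of representatives \<open>g\<close> and \<open>h\<close>.\<close>

definition ae_comp ::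
  "(complex \<Rightarrow> complex) set \<Rightarrow> (complex \<Rightarrow> complex) set \<Rightarrow> (complex \<Rightarrow> complex) set" where
  "ae_comp s t = {k. \<exists>g\<in>s. \<exists>h\<in>t. AE z in lebesgue. k z = g (h z)}"

definition conj_map :: "(complex \<Rightarrow> complex) \<Rightarrow> (complex \<Rightarrow> complex) \<Rightarrow> complex \<Rightarrow> complex" where
  "conj_map f \<gamma> = \<gamma> \<circ> f \<circ> inv \<gamma>"

inductive_set ruelle_semigroup ::
  "(complex \<Rightarrow> complex) \<Rightarrow> (complex \<Rightarrow> complex) set \<Rightarrow> (complex \<Rightarrow> complex) set set"
  for f :: "complex \<Rightarrow> complex" and \<Gamma> :: "(complex \<Rightarrow> complex) set" where
  generator: "\<gamma> \<in> \<Gamma> \<Longrightarrow> ae_class (conj_map f \<gamma>) \<in> ruelle_semigroup f \<Gamma>"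
| compose: "s \<in> ruelle_semigroup f \<Gamma> \<Longrightarrow> t \<in> ruelle_semigroup f \<Gamma>
    \<Longrightarrow> ae_comp s t \<in> ruelle_semigroup f \<Gamma>"


section \<open>Amenability with respect to a representation\<close>

text \<open>A complex Banach space is given by a space \<open>B\<close> of functions with a seminorm \<open>N\<close>; the
  Banach space proper is the quotient of \<open>B\<close> by the functions of seminorm zero.  Hence identities
  in the Banach space are stated up to seminorm zero.  Bounded functionals on \<open>B\<close> vanish on
  functions of seminorm zero, so they are the bounded functionals of the quotient.\<close>

definition bounded_endomorphism ::
  "('x \<Rightarrow> complex) set \<Rightarrow> (('x \<Rightarrow> complex) \<Rightarrow> real)
    \<Rightarrow> (('x \<Rightarrow> complex) \<Rightarrow> 'x \<Rightarrow> complex) \<Rightarrow> bool" where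
  "bounded_endomorphism B N T \<longleftrightarrow>
    (\<forall>\<phi>\<in>B. T \<phi> \<in> B)
    \<and> (\<forall>\<phi>\<in>B. \<forall>\<psi>\<in>B. \<forall>c d.
         N (\<lambda>x. T (\<lambda>y. c * \<phi> y + d * \<psi> y) x - (c * T \<phi> x + d * T \<psi> x)) = 0)
    \<and> (\<exists>C. \<forall>\<phi>\<in>B. N (T \<phi>) \<le> C * N \<phi>)"

definition bounded_functional ::
  "('x \<Rightarrow> complex) set \<Rightarrow> (('x \<Rightarrow> complex) \<Rightarrow> real) \<Rightarrow> (('x \<Rightarrow> complex) \<Rightarrow> complex) \<Rightarrow> bool" where
  "bounded_functional B N l \<longleftrightarrow>
    (\<forall>\<phi>\<in>B. \<forall>\<psi>\<in>B. \<forall>c d. l (\<lambda>y. c * \<phi> y + d * \<psi> y) = c * l \<phi> + d * l \<psi>)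
    \<and> (\<exists>C. \<forall>\<phi>\<in>B. norm (l \<phi>) \<le> C * N \<phi>)"

definition bounded_representation ::
  "'s set \<Rightarrow> ('s \<Rightarrow> 's \<Rightarrow> 's) \<Rightarrow> ('x \<Rightarrow> complex) set \<Rightarrow> (('x \<Rightarrow> complex) \<Rightarrow> real)
    \<Rightarrow> ('s \<Rightarrow> ('x \<Rightarrow> complex) \<Rightarrow> 'x \<Rightarrow> complex) \<Rightarrow> bool" where
  "bounded_representation S prd B N \<rho> \<longleftrightarrow>
    (\<forall>s\<in>S. bounded_endomorphism B N (\<rho> s))
    \<and> (\<forall>s\<in>S. \<forall>t\<in>S. \<forall>\<phi>\<in>B. N (\<lambda>x. \<rho> (prd s t) \<phi> x - \<rho> s (\<rho> t \<phi>) x) = 0)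
    \<and> (\<exists>C. \<forall>s\<in>S. \<forall>\<phi>\<in>B. N (\<rho> s \<phi>) \<le> C * N \<phi>)"

text \<open>Functions on \<open>S\<close> are total functions of which only the values on \<open>S\<close> matter.\<close>

definition bounded_functions :: "'s set \<Rightarrow> ('s \<Rightarrow> complex) set" where
  "bounded_functions S = {F. bounded (F ` S)}"

definition is_mean :: "'s set \<Rightarrow> (('s \<Rightarrow> complex) \<Rightarrow> complex) \<Rightarrow> bool" where
  "is_mean S M \<longleftrightarrow>
    (\<forall>F\<in>bounded_functions S. \<forall>G\<in>bounded_functions S. \<forall>c d.
       M (\<lambda>s. c * F s + d * G s) = c * M F + d * M G)
    \<and> (\<forall>F\<in>bounded_functions S. (\<forall>s\<in>S. F s \<in> \<real>\<^sub>\<ge>\<^sub>0) \<longrightarrow> M F \<in> \<real>\<^sub>\<ge>\<^sub>0)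
    \<and> M (\<lambda>s. 1) = 1"

definition matrix_coefficients ::
  "('x \<Rightarrow> complex) set \<Rightarrow> (('x \<Rightarrow> complex) \<Rightarrow> real)
    \<Rightarrow> ('s \<Rightarrow> ('x \<Rightarrow> complex) \<Rightarrow> 'x \<Rightarrow> complex) \<Rightarrow> ('s \<Rightarrow> complex) set" where
  "matrix_coefficients B N \<rho> =
    {\<lambda>s. l (\<rho> s \<phi>) | \<phi> l. \<phi> \<in> B \<and> bounded_functional B N l}"

definition complex_span :: "('s \<Rightarrow> complex) set \<Rightarrow> ('s \<Rightarrow> complex) set" where
  "complex_span E =
    {\<lambda>s. \<Sum>i<n. c i * F i s | (n::nat) (c :: nat \<Rightarrow> complex) F. \<forall>i<n. F i \<in> E}"

definition uniform_closure :: "'s set \<Rightarrow> ('s \<Rightarrow> complex) set \<Rightarrow> ('s \<Rightarrow> complex) set" where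
  "uniform_closure S E =
    {F \<in> bounded_functions S. \<forall>e>0. \<exists>G\<in>E. \<forall>s\<in>S. norm (F s - G s) \<le> e}"

definition coefficient_space ::
  "'s set \<Rightarrow> ('x \<Rightarrow> complex) set \<Rightarrow> (('x \<Rightarrow> complex) \<Rightarrow> real)
    \<Rightarrow> ('s \<Rightarrow> ('x \<Rightarrow> complex) \<Rightarrow> 'x \<Rightarrow> complex) \<Rightarrow> ('s \<Rightarrow> complex) set" where
  "coefficient_space S B N \<rho> = uniform_closure S (complex_span (matrix_coefficients B N \<rho>))"

definition coefficient_space_with_constants ::
  "'s set \<Rightarrow> ('x \<Rightarrow> complex) set \<Rightarrow> (('x \<Rightarrow> complex) \<Rightarrow> real)
    \<Rightarrow> ('s \<Rightarrow> ('x \<Rightarrow> complex) \<Rightarrow> 'x \<Rightarrow> complex) \<Rightarrow> ('s \<Rightarrow> complex) set" where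
  "coefficient_space_with_constants S B N \<rho> =
    {\<lambda>s. F s + c | F c. F \<in> coefficient_space S B N \<rho>}"

definition left_amenable_wrt ::
  "'s set \<Rightarrow> ('s \<Rightarrow> 's \<Rightarrow> 's) \<Rightarrow> ('x \<Rightarrow> complex) set \<Rightarrow> (('x \<Rightarrow> complex) \<Rightarrow> real)
    \<Rightarrow> ('s \<Rightarrow> ('x \<Rightarrow> complex) \<Rightarrow> 'x \<Rightarrow> complex) \<Rightarrow> bool" where
  "left_amenable_wrt S prd B N \<rho> \<longleftrightarrow>
    (\<exists>M. is_mean S M
       \<and> (\<forall>s\<in>S. \<forall>F\<in>coefficient_space_with_constants S B N \<rho>. M (\<lambda>t. F (prd s t)) = M F))"


section \<open>Beltrami differentials and the Ruelle representation\<close>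

definition invariant_beltrami ::
  "(complex \<Rightarrow> complex) \<Rightarrow> complex set \<Rightarrow> (complex \<Rightarrow> complex) \<Rightarrow> bool" where
  "invariant_beltrami f A \<mu> \<longleftrightarrow>
    \<mu> \<in> borel_measurable (lebesgue_on A)
    \<and> (\<exists>C. AE z in lebesgue_on A. norm (\<mu> z) \<le> C)
    \<and> (AE z in lebesgue_on A. \<mu> (f z) * (cnj (deriv f z) / deriv f z) = \<mu> z)"

definition L1 :: "complex set \<Rightarrow> (complex \<Rightarrow> complex) set" where
  "L1 A = {\<phi>. integrable (lebesgue_on A) \<phi>}"

definition L1_norm :: "complex set \<Rightarrow> (complex \<Rightarrow> complex) \<Rightarrow> real" where
  "L1_norm A \<phi> = (\<integral>z. norm (\<phi> z) \<partial>lebesgue_on A)"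

definition push_forward ::
  "(complex \<Rightarrow> complex) \<Rightarrow> (complex \<Rightarrow> complex) \<Rightarrow> complex \<Rightarrow> complex" where
  "push_forward \<gamma> \<phi> z = \<phi> (inv \<gamma> z) * (deriv (inv \<gamma>) z)\<^sup>2"

definition ruelle_operator ::
  "(complex \<Rightarrow> complex) \<Rightarrow> (complex \<Rightarrow> complex) \<Rightarrow> complex \<Rightarrow> complex" where
  "ruelle_operator f \<phi> x = (\<Sum>\<^sub>\<infinity>y\<in>f -` {x}. \<phi> y / (deriv f y)\<^sup>2)"

definition is_ruelle_representation ::
  "(complex \<Rightarrow> complex) \<Rightarrow> complex set \<Rightarrow> (complex \<Rightarrow> complex) set
    \<Rightarrow> ((complex \<Rightarrow> complex) set \<Rightarrow> (complex \<Rightarrow> complex) \<Rightarrow> complex \<Rightarrow> complex) \<Rightarrow> bool" where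
  "is_ruelle_representation f A \<Gamma> \<rho> \<longleftrightarrow>
    bounded_representation (ruelle_semigroup f \<Gamma>) ae_comp (L1 A) (L1_norm A) \<rho>
    \<and> (\<forall>\<gamma>\<in>\<Gamma>. \<forall>\<phi>\<in>L1 A. AE x in lebesgue_on A.
         \<rho> (ae_class (conj_map f \<gamma>)) \<phi> x = push_forward \<gamma> (ruelle_operator f \<phi>) x)"

text \<open>The values on generators determine the representation on the semigroup up to almost
  everywhere equality on \<open>A\<close>; the choice below only concerns null sets and arguments outside the
  semigroup and \<open>L1 A\<close>.\<close>

definition ruelle_representation ::
  "(complex \<Rightarrow> complex) \<Rightarrow> complex set \<Rightarrow> (complex \<Rightarrow> complex) set
    \<Rightarrow> (complex \<Rightarrow> complex) set \<Rightarrow> (complex \<Rightarrow> complex) \<Rightarrow> complex \<Rightarrow> complex" where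
  "ruelle_representation f A \<Gamma> = (SOME \<rho>. is_ruelle_representation f A \<Gamma> \<rho>)"

end

theory Submission
  imports Defs "HOL-Complex_Analysis.Complex_Analysis"
begin

text \<open>Let \<open>f\<^sub>*\<close> be the Ruelle operator on \<open>L\<^sub>1(A)\<close>.  It is the predual of the operator that pulls Beltrami
differentials back along \<open>f\<close>; this is the change of variables formula, applied to each of the
conformal maps \<open>f\<close> from a component of \<open>V\<close> onto \<open>U\<close> (\<open>conformal_transfer\<close>,
\<open>ruelle_operator_dual\<close>).  Since every functional on \<open>L\<^sub>1(A)\<close> is integration against a function in
\<open>L\<^sub>\<infinity>(A)\<close> (\<open>L1_functional_eq_integral\<close>), an \<open>f\<^sub>*\<close>-invariant functional is an invariant
Beltrami differential.  So under the hypothesis of the theorem there is no non-zero invariant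
functional (\<open>invariant_functional_eq_0\<close>).

Since \<open>f \<circ> \<gamma> = f\<close> for every deck transformation \<open>\<gamma>\<close>, the powers of \<open>f\<^sub>\<gamma>\<close> are \<open>\<gamma> \<circ> f\<^sup>k\<close>,
and they are represented by \<open>\<gamma>\<^sub>* \<circ> f\<^sub>*\<^sup>k\<close>.  Fix \<open>\<gamma>\<close> in \<open>\<Gamma>\<close> and let \<open>M F\<close> be a Banach limit of the
sequence \<open>F (f\<^sub>\<gamma>\<^sup>k)\<close>.  If \<open>F\<close> is the coefficient of a functional \<open>l\<close> and a vector \<open>\<phi>\<close>, then
\<open>M F\<close>, as a function of \<open>\<phi>\<close>, is a bounded functional; it is \<open>f\<^sub>*\<close>-invariant because the Banach limit is
shift invariant.  Hence \<open>M F = 0\<close>.  The left translate of a coefficient by \<open>s\<close> is again a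
coefficient along the powers of \<open>f\<^sub>\<gamma>\<close>, with \<open>l\<close> replaced by \<open>l \<circ> \<rho> s\<close>, so its mean is 0 too.
Linearity and continuity extend this to the closed span, and on constants there is nothing to show.

Two facts carry the setting.  First, \<open>f\<close> maps every component of \<open>V\<close> bijectively onto \<open>U\<close>
(\<open>bij_betw_component\<close>): \<open>U\<close> is simply connected, and inverse branches continue over all of it because
it contains neither critical nor asymptotic values.  The complement of \<open>V\<close> is a null set
because a rectifiable ray is one.  Second, the Ruelle representation exists
(\<open>is_ruelle_representation_exists\<close>): the class of \<open>\<gamma> \<circ> f\<^sup>n\<close> determines \<open>\<gamma>\<close> and \<open>n\<close>, because a
non-linear entire map has no iterate equal to the identity.\<close>

section \<open>Banach limits\<close>

lemma Bseq_linear_combination: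
  fixes x y :: "nat \<Rightarrow> complex"
  assumes "Bseq x" "Bseq y"
  shows "Bseq (\<lambda>n. c * x n + d * y n)"
proof -
  obtain K M where K: "\<And>n. norm (x n) \<le> K" and M: "\<And>n. norm (y n) \<le> M"
    using assms by (auto simp: Bseq_def)
  show ?thesis
  proof (rule BseqI')
    fix n
    show "norm (c * x n + d * y n) \<le> norm c * K + norm d * M"
      using K[of n] M[of n]
      by (intro order_trans[OF norm_triangle_ineq] add_mono) (auto simp: norm_mult intro!: mult_left_mono)
  qed
qed

text \<open>The Cesaro averages of bounded sequences, viewed as functions of the sequence, all lie in one
product of closed discs, which is compact by Tychonoff's theorem.  A cluster point of these
averages inherits linearity, positivity and the norm bound, and it is shift invariant because the
averages of \<open>x (Suc n) - x n\<close> telescope.\<close>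

lemma ex_Banach_limit:
  obtains L :: "(nat \<Rightarrow> complex) \<Rightarrow> complex"
  where "\<And>x y c d. Bseq x \<Longrightarrow> Bseq y \<Longrightarrow> L (\<lambda>n. c * x n + d * y n) = c * L x + d * L y"
    and "\<And>x. (\<And>n. x n \<in> \<real>\<^sub>\<ge>\<^sub>0) \<Longrightarrow> Bseq x \<Longrightarrow> L x \<in> \<real>\<^sub>\<ge>\<^sub>0"
    and "\<And>c. L (\<lambda>n. c) = c"
    and "\<And>x. Bseq x \<Longrightarrow> L (\<lambda>n. x (Suc n)) = L x"
    and "\<And>x C. (\<And>n. norm (x n) \<le> C) \<Longrightarrow> norm (L x) \<le> C"
proof -
  define b :: "(nat \<Rightarrow> complex) \<Rightarrow> real" where "b x = (SUP n. norm (x n))" for x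
  \<comment> \<open>Unbounded sequences are sent to 0, so that all averages lie in the compact product \<open>K\<close>.\<close>
  define A :: "nat \<Rightarrow> (nat \<Rightarrow> complex) \<Rightarrow> complex" where
    "A n x = (if Bseq x then (\<Sum>k<Suc n. x k) / of_nat (Suc n) else 0)" for n x
  define K where "K = PiE UNIV (\<lambda>x. cball (0::complex) (if Bseq x then b x else 0))"
  have A_bound: "norm (A n x) \<le> C" if "\<And>k. norm (x k) \<le> C" for n x C
  proof -
    have C: "0 \<le> C"
      using that[of 0] norm_ge_zero order_trans by blast
    have "norm (\<Sum>k<Suc n. x k) \<le> (\<Sum>k<Suc n. C)"
      by (rule order_trans[OF norm_sum]) (intro sum_mono that)
    then have "norm ((\<Sum>k<Suc n. x k) / of_nat (Suc n)) \<le> C"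
      by (simp add: norm_divide field_simps del: sum.lessThan_Suc of_nat_Suc)
    then show ?thesis using C by (auto simp: A_def simp del: sum.lessThan_Suc of_nat_Suc)
  qed
  have b: "norm (x k) \<le> b x" if "Bseq x" for x k
    unfolding b_def using that
    by (intro cSUP_upper) (auto simp: Bseq_eq_bounded bounded_imp_bdd_above bounded_norm_comp)
  have AK: "A n \<in> K" for n
  proof -
    have "A n x \<in> cball 0 (if Bseq x then b x else 0)" for x
      using A_bound[of x "b x" n] b[of x] by (cases "Bseq x") (auto simp: A_def)
    then show ?thesis by (auto simp: K_def)
  qed
  have "compactin (product_topology (\<lambda>_. euclidean) UNIV) K"
    unfolding K_def by (subst compactin_PiE) auto
  then have "compact K"
    by (simp add: euclidean_product_topology)
  moreover have "filtermap A sequentially \<noteq> bot"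
    by (simp add: filtermap_bot_iff)
  moreover have "eventually (\<lambda>m. m \<in> K) (filtermap A sequentially)"
    using AK by (simp add: eventually_filtermap)
  ultimately obtain L where F: "inf (nhds L) (filtermap A sequentially) \<noteq> bot"
    unfolding compact_filter by blast
  let ?F = "inf (nhds L) (filtermap A sequentially)"
  have ev: "((\<lambda>m. m x) \<longlongrightarrow> L x) ?F" for x
  proof -
    have "((\<lambda>m. m) \<longlongrightarrow> L) ?F"
      unfolding filterlim_def by simp
    from continuous_on_tendsto_compose[OF continuous_on_product_coordinates this, of x]
    show ?thesis by simp
  qed
  have lim: "L x = a" if "(\<lambda>n. A n x) \<longlonglongrightarrow> a" for x a
  proof (rule tendsto_unique[OF F ev])
    have "((\<lambda>m. m x) \<longlongrightarrow> a) (filtermap A sequentially)"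
      using that by (simp add: filterlim_filtermap)
    then show "((\<lambda>m. m x) \<longlongrightarrow> a) ?F" by (rule tendsto_mono[rotated]) simp
  qed
  have all: "eventually P ?F" if "\<And>n. P (A n)" for P
    by (rule filter_leD[OF inf.cobounded2]) (use that in \<open>simp add: eventually_filtermap\<close>)
  have lin: "L (\<lambda>n. c * x n + d * y n) = c * L x + d * L y" if x: "Bseq x" and y: "Bseq y" for x y c d
  proof (rule tendsto_unique[OF F ev])
    have "Bseq (\<lambda>n. c * x n + d * y n)"
      using x y by (rule Bseq_linear_combination)
    then have "A n (\<lambda>n. c * x n + d * y n) = c * A n x + d * A n y" for n
      using x y by (simp add: A_def sum.distrib sum_distrib_left add_divide_distrib
          del: sum.lessThan_Suc of_nat_Suc)
    then have "eventually (\<lambda>m. c * m x + d * m y = m (\<lambda>n. c * x n + d * y n)) ?F"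
      by (intro all) simp
    then show "((\<lambda>m. m (\<lambda>n. c * x n + d * y n)) \<longlongrightarrow> c * L x + d * L y) ?F"
      by (rule Lim_transform_eventually[rotated]) (intro tendsto_intros ev)
  qed
  show thesis
  proof
    show "L (\<lambda>n. c * x n + d * y n) = c * L x + d * L y" if "Bseq x" "Bseq y" for x y c d
      using lin that .
    show "L x \<in> \<real>\<^sub>\<ge>\<^sub>0" if x: "\<And>n. x n \<in> \<real>\<^sub>\<ge>\<^sub>0" for x
    proof (rule Lim_in_closed_set[OF closed_nonneg_Reals_complex _ F ev])
      have "A n x \<in> \<real>\<^sub>\<ge>\<^sub>0" for n
        unfolding A_def using x
        by (auto simp: complex_nonneg_Reals_iff sum_nonneg Re_divide_of_nat Im_divide_of_nat simp del: sum.lessThan_Suc of_nat_Suc)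
      then show "eventually (\<lambda>m. m x \<in> \<real>\<^sub>\<ge>\<^sub>0) ?F" by (rule all)
    qed
    show "L (\<lambda>n. c) = c" for c
      by (rule lim) (simp add: A_def del: sum.lessThan_Suc of_nat_Suc)
    show "norm (L x) \<le> C" if x: "\<And>n. norm (x n) \<le> C" for x C
    proof (rule tendsto_upperbound[OF tendsto_norm[OF ev] _ F])
      show "eventually (\<lambda>m. norm (m x) \<le> C) ?F"
        using A_bound[OF x] by (intro all)
    qed
    show "L (\<lambda>n. x (Suc n)) = L x" if x: "Bseq x" for x
    proof -
      have x': "Bseq (\<lambda>n. x (Suc n))"
        using x by (simp add: Bseq_Suc_iff)
      have diff: "Bseq (\<lambda>n. 1 * x (Suc n) + (-1) * x n)"
        using x' x by (rule Bseq_linear_combination)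
      have "A n (\<lambda>n. 1 * x (Suc n) + (-1) * x n) = (x (Suc n) - x 0) / of_nat (Suc n)" for n
      proof -
        have "(\<Sum>k<Suc n. 1 * x (Suc k) + (-1) * x k) = x (Suc n) - x 0"
          by (simp add: sum_lessThan_telescope del: sum.lessThan_Suc)
        then show ?thesis using diff by (simp add: A_def del: sum.lessThan_Suc of_nat_Suc)
      qed
      moreover have "(\<lambda>n. (x (Suc n) - x 0) / of_nat (Suc n)) \<longlonglongrightarrow> 0"
      proof -
        obtain C where C: "\<And>n. norm (x n) \<le> C" using x by (auto simp: Bseq_def)
        have "(\<lambda>n. 2 * C * (1 / real (Suc n))) \<longlonglongrightarrow> 2 * C * 0"
          by (intro tendsto_intros LIMSEQ_Suc lim_1_over_n)
        then show ?thesis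
        proof (rule Lim_null_comparison[rotated, OF tendsto_eq_rhs], goal_cases)
          case 1 show ?case by simp
        next
          case 2 show ?case
          proof (intro always_eventually allI)
          fix n
          have "norm (x (Suc n) - x 0) \<le> 2 * C"
            using norm_triangle_ineq4[of "x (Suc n)" "x 0"] C[of "Suc n"] C[of 0] by linarith
          then show "norm ((x (Suc n) - x 0) / of_nat (Suc n)) \<le> 2 * C * (1 / real (Suc n))"
            by (simp add: norm_divide divide_right_mono del: of_nat_Suc)
          qed
        qed
      qed
      ultimately have "L (\<lambda>n. 1 * x (Suc n) + (-1) * x n) = 0"
        by (intro lim) simp
      then show ?thesis using lin[OF x' x, of 1 "-1"] by simp
    qed
  qed
qed


section \<open>The dual of the space of integrable functions\<close>

text \<open>Against an integrable weight \<open>w > 0\<close>, the set function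
\<open>E \<mapsto> C * (\<integral>\<^sub>E w) + Re (L (1\<^sub>E * w))\<close> is a finite nonnegative measure, since \<open>\<bar>Re (L u)\<bar>\<close> is at most
\<open>C\<close> times the norm of \<open>u\<close>.  It is dominated by \<open>2 * C * w\<close>, so Radon-Nikodym gives it a density
\<open>h \<le> 2 * C * w\<close>, and \<open>h / w - C\<close> represents the real part of \<open>L\<close>.\<close>

lemma (in sigma_finite_measure) real_density_of_functional:
  fixes L :: "('a \<Rightarrow> complex) \<Rightarrow> complex" and w :: "'a \<Rightarrow> real"
  assumes lin: "\<And>u v c d. integrable M u \<Longrightarrow> integrable M v
        \<Longrightarrow> L (\<lambda>x. c * u x + d * v x) = c * L u + d * L v"
    and bound: "\<And>u. integrable M u \<Longrightarrow> norm (L u) \<le> C * (\<integral>x. norm (u x) \<partial>M)"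
    and w: "integrable M w" "\<And>x. w x > 0"
    and C: "C \<ge> 0"
  obtains m :: "'a \<Rightarrow> real" where "m \<in> borel_measurable M" "\<And>x. \<bar>m x\<bar> \<le> C"
    "\<And>E. E \<in> sets M \<Longrightarrow> Re (L (\<lambda>x. complex_of_real (indicator E x * w x)))
        = (\<integral>x. indicator E x * w x * m x \<partial>M)"
proof -
  note [measurable] = borel_measurable_integrable[OF w(1)]
  define W where "W E = (\<integral>x. indicator E x * w x \<partial>M)" for E
  define l where "l E = Re (L (\<lambda>x. complex_of_real (indicator E x * w x)))" for E
  have int_w: "integrable M (\<lambda>x. indicator E x * w x)" if "E \<in> sets M" for E
    using integrable_mult_indicator[OF that w(1)] by simp
  have int_cw: "integrable M (\<lambda>x. complex_of_real (indicator E x * w x))" if "E \<in> sets M" for E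
    using int_w[OF that] by (rule integrable_of_real)
  have W_nonneg: "0 \<le> W E" for E
    unfolding W_def using w(2) by (intro Bochner_Integration.integral_nonneg) (simp add: less_imp_le)
  have l_bound: "\<bar>l E\<bar> \<le> C * W E" if "E \<in> sets M" for E
  proof -
    have "\<bar>l E\<bar> \<le> norm (L (\<lambda>x. complex_of_real (indicator E x * w x)))"
      unfolding l_def by (rule abs_Re_le_cmod)
    also have "\<dots> \<le> C * (\<integral>x. norm (complex_of_real (indicator E x * w x)) \<partial>M)"
      by (rule bound[OF int_cw[OF that]])
    also have "(\<integral>x. norm (complex_of_real (indicator E x * w x)) \<partial>M) = W E"
      unfolding W_def using w(2) by (intro Bochner_Integration.integral_cong) (auto simp: norm_mult less_imp_le abs_of_nonneg)
    finally show ?thesis .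
  qed
  have W_union: "W (E \<union> F) = W E + W F" if "E \<in> sets M" "F \<in> sets M" "E \<inter> F = {}" for E F
  proof -
    have "W (E \<union> F) = (\<integral>x. indicator E x * w x + indicator F x * w x \<partial>M)"
      unfolding W_def using that(3) by (intro Bochner_Integration.integral_cong) (auto simp: indicator_def)
    then show ?thesis unfolding W_def using that int_w by simp
  qed
  have l_union: "l (E \<union> F) = l E + l F" if "E \<in> sets M" "F \<in> sets M" "E \<inter> F = {}" for E F
  proof -
    have "(\<lambda>x. complex_of_real (indicator (E \<union> F) x * w x))
        = (\<lambda>x. 1 * complex_of_real (indicator E x * w x) + 1 * complex_of_real (indicator F x * w x))"
      using that(3) by (auto simp: indicator_def fun_eq_iff)
    then show ?thesis
      unfolding l_def using lin[OF int_cw[OF that(1)] int_cw[OF that(2)], of 1 1] by simp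
  qed
  define \<nu> where "\<nu> E = C * W E + l E" for E
  have \<nu>_nonneg: "0 \<le> \<nu> E" if "E \<in> sets M" for E
    using l_bound[OF that] by (auto simp: \<nu>_def)
  have \<nu>_le: "\<nu> E \<le> 2 * C * W E" if "E \<in> sets M" for E
    using l_bound[OF that] by (auto simp: \<nu>_def)
  have \<nu>_union: "\<nu> (E \<union> F) = \<nu> E + \<nu> F" if "E \<in> sets M" "F \<in> sets M" "E \<inter> F = {}" for E F
    using W_union[OF that] l_union[OF that] by (simp add: \<nu>_def algebra_simps)
  have \<nu>_empty: "\<nu> {} = 0"
    using \<nu>_union[of "{}" "{}"] by simp
  have W_dec: "(\<lambda>n. W (F n)) \<longlonglongrightarrow> 0" if F: "range F \<subseteq> sets M" "decseq F" "(\<Inter>n. F n) = {}" for F :: "nat \<Rightarrow> 'a set"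
  proof -
    have "(\<lambda>n. \<integral>x. indicator (F n) x * w x \<partial>M) \<longlonglongrightarrow> (\<integral>x. 0 \<partial>M)"
    proof (rule integral_dominated_convergence[OF _ _ w(1)])
      show "AE x in M. (\<lambda>n. indicator (F n) x * w x) \<longlonglongrightarrow> 0"
      proof (rule AE_I2)
        fix x
        obtain n where "x \<notin> F n" using F(3) by auto
        then have "x \<notin> F k" if "k \<ge> n" for k
          using decseqD[OF F(2) that] by auto
        then have "eventually (\<lambda>k. indicator (F k) x * w x = 0) sequentially"
          unfolding eventually_sequentially by (intro exI[of _ n]) auto
        then show "(\<lambda>n. indicator (F n) x * w x) \<longlonglongrightarrow> 0"
          by (rule tendsto_eventually)
      qed
      show "AE x in M. norm (indicator (F n) x * w x) \<le> w x" for n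
        using w(2) by (auto simp: indicator_def less_imp_le)
    qed (use F(1) in auto)
    then show ?thesis by (simp add: W_def)
  qed
  define N where "N = measure_of (space M) (sets M) (\<lambda>E. ennreal (\<nu> E))"
  have em: "emeasure N E = ennreal (\<nu> E)" if "E \<in> sets M" for E
  proof (rule emeasure_measure_of[OF N_def])
    show "sets M \<subseteq> Pow (space M)" by (rule sets.space_closed)
    show "E \<in> sets N" using that by (simp add: N_def sets.sigma_sets_eq)
    show "positive (sets N) (\<lambda>E. ennreal (\<nu> E))"
      by (simp add: positive_def \<nu>_empty)
    have sN: "sets N = sets M" by (simp add: N_def sets.sigma_sets_eq)
    show "countably_additive (sets N) (\<lambda>E. ennreal (\<nu> E))"
      unfolding sN
    proof (rule sets.empty_continuous_imp_countably_additive)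
      show "positive (sets M) (\<lambda>E. ennreal (\<nu> E))"
        by (simp add: positive_def \<nu>_empty)
      show "additive (sets M) (\<lambda>E. ennreal (\<nu> E))"
        unfolding additive_def using \<nu>_union \<nu>_nonneg by (simp add: ennreal_plus)
      show "\<forall>A\<in>sets M. ennreal (\<nu> A) \<noteq> \<infinity>" by simp
      fix F :: "nat \<Rightarrow> 'a set" assume F: "range F \<subseteq> sets M" "decseq F" "\<Inter>(range F) = {}"
      have "(\<lambda>n. 2 * C * W (F n)) \<longlonglongrightarrow> 2 * C * 0"
        using W_dec[OF F(1,2)] F(3) by (intro tendsto_intros) auto
      then have "(\<lambda>n. \<nu> (F n)) \<longlonglongrightarrow> 0"
        using F(1) \<nu>_le \<nu>_nonneg
        by (intro tendsto_sandwich[of "\<lambda>_. 0" "\<lambda>n. \<nu> (F n)" _ "\<lambda>n. 2 * C * W (F n)"])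
           (auto intro!: always_eventually)
      then show "(\<lambda>n. ennreal (\<nu> (F n))) \<longlonglongrightarrow> 0"
        using tendsto_ennrealI by fastforce
    qed
  qed
  have sN: "sets N = sets M" by (simp add: N_def sets.sigma_sets_eq)
  have "absolutely_continuous M N"
  proof (unfold absolutely_continuous_def, rule subsetI)
    fix E assume E: "E \<in> null_sets M"
    then have "W E = 0"
      unfolding W_def by (intro integral_eq_zero_AE) (auto dest: AE_not_in simp: indicator_def)
    then have "\<nu> E = 0" using \<nu>_le[of E] \<nu>_nonneg[of E] E by auto
    then show "E \<in> null_sets N" using E em sN by (auto simp: null_sets_def)
  qed
  from Radon_Nikodym[OF this sN] obtain h where h[measurable]: "h \<in> borel_measurable M" and hN: "density M h = N"
    by blast
  have nnh: "(\<integral>\<^sup>+x. h x * indicator E x \<partial>M) = ennreal (\<nu> E)" if "E \<in> sets M" for E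
    using em[OF that] emeasure_density[OF h that] hN by simp
  have h_le: "AE x in M. h x \<le> ennreal (2 * C * w x)"
  proof -
    define E where "E = {x \<in> space M. ennreal (2 * C * w x) < h x}"
    have E[measurable]: "E \<in> sets M" unfolding E_def by measurable
    have "(\<integral>\<^sup>+x. ennreal (2 * C * w x) * indicator E x \<partial>M) = (\<integral>\<^sup>+x. ennreal (2 * C * (indicator E x * w x)) \<partial>M)"
      by (intro nn_integral_cong) (auto simp: indicator_def)
    also have "\<dots> = ennreal (2 * C * W E)"
      unfolding W_def using int_w[OF E] w(2) C
      by (subst nn_integral_eq_integral) (auto simp: less_imp_le)
    finally have wE: "(\<integral>\<^sup>+x. ennreal (2 * C * w x) * indicator E x \<partial>M) = ennreal (2 * C * W E)" .
    have "(\<integral>\<^sup>+x. h x * indicator E x - ennreal (2 * C * w x) * indicator E x \<partial>M)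
        = ennreal (\<nu> E) - ennreal (2 * C * W E)"
      unfolding nnh[OF E, symmetric] wE[symmetric]
    proof (rule nn_integral_diff)
      show "(\<integral>\<^sup>+x. ennreal (2 * C * w x) * indicator E x \<partial>M) \<noteq> \<infinity>"
        unfolding wE by simp
    qed (auto simp: E_def indicator_def)
    also have "\<dots> = 0"
      using \<nu>_le[OF E] by (simp add: diff_eq_0_iff_ennreal ennreal_leI)
    finally have "AE x in M. h x * indicator E x - ennreal (2 * C * w x) * indicator E x = 0"
      by (subst (asm) nn_integral_0_iff_AE) auto
    then show ?thesis
    proof (rule AE_mp, intro AE_I2 impI)
      fix x assume x: "x \<in> space M" "h x * indicator E x - ennreal (2 * C * w x) * indicator E x = 0"
      show "h x \<le> ennreal (2 * C * w x)"
      proof (cases "x \<in> E")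
        case True
        then show ?thesis using x by (simp add: diff_eq_0_iff_ennreal)
      qed (use x in \<open>auto simp: E_def\<close>)
    qed
  qed
  \<comment> \<open>Truncation makes the bound hold everywhere; it changes \<open>h / w - C\<close> on a null set only.\<close>
  define m where "m x = max (-C) (min C (enn2real (h x) / w x - C))" for x
  have m_eq: "AE x in M. enn2real (h x) = w x * (m x + C)"
    using h_le
  proof eventually_elim
    case (elim x)
    have "enn2real (h x) \<le> 2 * C * w x"
      using elim C w(2)[of x] by (intro enn2real_leI) (auto simp: less_imp_le)
    then have "enn2real (h x) / w x - C \<le> C" using w(2)[of x] by (simp add: field_simps)
    moreover have "-C \<le> enn2real (h x) / w x - C" using w(2)[of x] by (simp add: less_imp_le)
    ultimately have "m x = enn2real (h x) / w x - C" by (simp add: m_def)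
    then show ?case using w(2)[of x] by (simp add: field_simps)
  qed
  show thesis
  proof
    show m[measurable]: "m \<in> borel_measurable M" unfolding m_def by measurable
    show m_le: "\<bar>m x\<bar> \<le> C" for x using C by (auto simp: m_def)
    fix E assume E[measurable]: "E \<in> sets M"
    have int1: "integrable M (\<lambda>x. indicator E x * w x * m x)"
    proof (rule Bochner_Integration.integrable_bound[OF integrable_mult_right[OF w(1), of C]])
      show "AE x in M. norm (indicator E x * w x * m x) \<le> norm (C * w x)"
        using w(2) m_le C by (auto simp: indicator_def abs_mult less_imp_le mult.commute intro!: mult_left_mono)
    qed measurable
    have "\<nu> E = enn2real (\<integral>\<^sup>+x. h x * indicator E x \<partial>M)"
      using nnh[OF E] \<nu>_nonneg[OF E] by simp
    also have "(\<integral>\<^sup>+x. h x * indicator E x \<partial>M) = (\<integral>\<^sup>+x. ennreal (indicator E x * w x * (m x + C)) \<partial>M)"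
    proof (rule nn_integral_cong_AE, use m_eq h_le in eventually_elim)
      case (elim x)
      have "h x < \<infinity>" using le_less_trans[OF elim(2)] by simp
      then have "h x = ennreal (w x * (m x + C))"
        using ennreal_enn2real[of "h x"] unfolding elim(1) by simp
      then show ?case by (auto simp: indicator_def)
    qed
    also have "enn2real \<dots> = (\<integral>x. indicator E x * w x * (m x + C) \<partial>M)"
    proof (rule integral_eq_nn_integral[symmetric])
      show "AE x in M. 0 \<le> indicator E x * w x * (m x + C)"
      proof (rule AE_I2)
        fix x
        have "0 \<le> m x + C" using m_le[of x] by arith
        then show "0 \<le> indicator E x * w x * (m x + C)" using w(2)[of x] by simp
      qed
    qed measurable
    also have "\<dots> = (\<integral>x. indicator E x * w x * m x + C * (indicator E x * w x) \<partial>M)"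
      by (simp add: algebra_simps)
    also have "\<dots> = (\<integral>x. indicator E x * w x * m x \<partial>M) + C * W E"
      unfolding W_def using int1 int_w[OF E] by simp
    finally show "Re (L (\<lambda>x. complex_of_real (indicator E x * w x))) = (\<integral>x. indicator E x * w x * m x \<partial>M)"
      by (simp add: \<nu>_def l_def)
  qed
qed

text \<open>The dual of \<open>L\<^sub>1\<close> is \<open>L\<^sub>\<infinity>\<close>: the real and imaginary parts of the functional have bounded
densities on the functions \<open>1\<^sub>E * w\<close>, and these span a dense subspace.  The representing
function is chosen bounded everywhere, so that its pullbacks are bounded as well.\<close>

theorem (in sigma_finite_measure) L1_functional_eq_integral:
  fixes L :: "('a \<Rightarrow> complex) \<Rightarrow> complex"
  assumes lin: "\<And>u v c d. integrable M u \<Longrightarrow> integrable M v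
        \<Longrightarrow> L (\<lambda>x. c * u x + d * v x) = c * L u + d * L v"
    and bound: "\<And>u. integrable M u \<Longrightarrow> norm (L u) \<le> C * (\<integral>x. norm (u x) \<partial>M)"
  obtains m B where "m \<in> borel_measurable M" "\<And>x. norm (m x) \<le> B"
    "\<And>u. integrable M u \<Longrightarrow> L u = (\<integral>x. m x * u x \<partial>M)"
proof -
  obtain w :: "'a \<Rightarrow> real" where w: "w \<in> borel_measurable M" "\<And>x. w x > 0" "integrable M w"
    using obtain_positive_integrable_function by metis
  note [measurable] = w(1)
  define D where "D = max C 0"
  have D: "D \<ge> 0" by (simp add: D_def)
  have boundD: "norm (L u) \<le> D * (\<integral>x. norm (u x) \<partial>M)" if "integrable M u" for u
    using bound[OF that] by (rule order_trans) (auto simp: D_def intro!: mult_right_mono)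
  obtain a where a: "a \<in> borel_measurable M" "\<And>x. \<bar>a x\<bar> \<le> D"
    "\<And>E. E \<in> sets M \<Longrightarrow> Re (L (\<lambda>x. complex_of_real (indicator E x * w x)))
        = (\<integral>x. indicator E x * w x * a x \<partial>M)"
    using real_density_of_functional[OF lin boundD w(3) w(2) D] by blast
  obtain b where b: "b \<in> borel_measurable M" "\<And>x. \<bar>b x\<bar> \<le> D"
    "\<And>E. E \<in> sets M \<Longrightarrow> Re (- \<i> * L (\<lambda>x. complex_of_real (indicator E x * w x)))
        = (\<integral>x. indicator E x * w x * b x \<partial>M)"
    by (rule real_density_of_functional[of "\<lambda>u. - \<i> * L u", OF _ _ w(3) w(2) D])
       (auto simp: lin boundD norm_mult algebra_simps)
  define m where "m x = Complex (a x) (b x)" for x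
  have m_eq: "m = (\<lambda>x. complex_of_real (a x) + \<i> * complex_of_real (b x))"
    by (auto simp: m_def complex_eq_iff)
  have m[measurable]: "m \<in> borel_measurable M"
    unfolding m_eq using a(1) b(1) by measurable
  have m_le: "norm (m x) \<le> 2 * D" for x
    using a(2)[of x] b(2)[of x] cmod_le[of "m x"] by (simp add: m_def)
  have int_m: "integrable M (\<lambda>x. m x * u x)" if u: "integrable M u" for u
  proof (rule Bochner_Integration.integrable_bound[OF integrable_mult_right[OF integrable_norm[OF u], of "2 * D"]])
    show "AE x in M. norm (m x * u x) \<le> norm (2 * D * norm (u x))"
      using m_le D by (auto simp: norm_mult intro!: mult_right_mono)
  qed (use u in measurable)
  let ?M = "density M (\<lambda>x. ennreal (w x))"
  have int_dens: "integrable ?M u \<longleftrightarrow> integrable M (\<lambda>x. w x *\<^sub>R u x)"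
    if "u \<in> borel_measurable M" for u :: "'a \<Rightarrow> complex"
    using that w(2) by (subst integrable_density) (auto simp: less_imp_le)
  have step: "L (\<lambda>x. w x *\<^sub>R (indicator E x *\<^sub>R c)) = (\<integral>x. m x * (w x *\<^sub>R (indicator E x *\<^sub>R c)) \<partial>M)"
    if E: "E \<in> sets M" for E and c :: complex
  proof -
    note [measurable] = E a(1) b(1)
    have intw: "integrable M (\<lambda>x. complex_of_real (indicator E x * w x))"
      using integrable_mult_indicator[OF E w(3)] by (intro integrable_of_real) simp
    have ia: "integrable M (\<lambda>x. indicator E x * w x * k x)"
      if k: "k \<in> borel_measurable M" "\<And>x. \<bar>k x\<bar> \<le> D" for k
    proof (rule Bochner_Integration.integrable_bound[OF integrable_mult_right[OF w(3), of D]])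
      show "AE x in M. norm (indicator E x * w x * k x) \<le> norm (D * w x)"
        using w(2) k(2) D by (auto simp: indicator_def abs_mult less_imp_le mult.commute intro!: mult_left_mono)
    qed (use k in measurable)
    have "L (\<lambda>x. complex_of_real (indicator E x * w x))
        = Complex (\<integral>x. indicator E x * w x * a x \<partial>M) (\<integral>x. indicator E x * w x * b x \<partial>M)"
      using a(3)[OF E] b(3)[OF E] by (simp add: complex_eq_iff)
    also have "\<dots> = (\<integral>x. complex_of_real (indicator E x * w x * a x) + \<i> * complex_of_real (indicator E x * w x * b x) \<partial>M)"
    proof -
      have "(\<integral>x. complex_of_real (k x) \<partial>M) = complex_of_real (\<integral>x. k x \<partial>M)" for k
        by simp
      moreover have "integrable M (\<lambda>x. \<i> * complex_of_real (indicator E x * w x * b x))"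
        using ia[OF b(1,2)] by (intro integrable_mult_right integrable_of_real)
      moreover have "integrable M (\<lambda>x. complex_of_real (indicator E x * w x * a x))"
        using ia[OF a(1,2)] by (intro integrable_of_real)
      ultimately show ?thesis
        by (subst Bochner_Integration.integral_add) (simp_all only: integral_mult_right_zero, simp add: complex_eq_iff)
    qed
    also have "\<dots> = (\<integral>x. m x * complex_of_real (indicator E x * w x) \<partial>M)"
      by (intro Bochner_Integration.integral_cong) (auto simp: m_eq algebra_simps)
    finally have eq: "L (\<lambda>x. complex_of_real (indicator E x * w x)) = (\<integral>x. m x * complex_of_real (indicator E x * w x) \<partial>M)" .
    have "L (\<lambda>x. w x *\<^sub>R (indicator E x *\<^sub>R c)) = L (\<lambda>x. c * complex_of_real (indicator E x * w x) + 0 * complex_of_real (indicator E x * w x))"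
      by (intro arg_cong[where f = L]) (auto simp: scaleR_conv_of_real)
    also have "\<dots> = c * L (\<lambda>x. complex_of_real (indicator E x * w x))"
      by (subst lin[OF intw intw]) simp
    also have "\<dots> = (\<integral>x. c * (m x * complex_of_real (indicator E x * w x)) \<partial>M)"
      unfolding eq by simp
    also have "\<dots> = (\<integral>x. m x * (w x *\<^sub>R (indicator E x *\<^sub>R c)) \<partial>M)"
      by (intro Bochner_Integration.integral_cong) (auto simp: scaleR_conv_of_real)
    finally show ?thesis .
  qed
  have weighted: "L (\<lambda>x. w x *\<^sub>R u x) = (\<integral>x. m x * (w x *\<^sub>R u x) \<partial>M)" if "integrable ?M u" for u
    using that
  proof (induction u rule: integrable_induct)
    case (base E c)
    then show ?case using step by simp
  next
    case (add u v)
    have u: "integrable M (\<lambda>x. w x *\<^sub>R u x)" and v: "integrable M (\<lambda>x. w x *\<^sub>R v x)"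
      using \<open>integrable ?M u\<close> \<open>integrable ?M v\<close> int_dens borel_measurable_integrable[OF \<open>integrable ?M u\<close>]
        borel_measurable_integrable[OF \<open>integrable ?M v\<close>] by auto
    have "L (\<lambda>x. w x *\<^sub>R (u x + v x)) = L (\<lambda>x. 1 * (w x *\<^sub>R u x) + 1 * (w x *\<^sub>R v x))"
      by (simp add: scaleR_add_right)
    also have "\<dots> = (\<integral>x. m x * (w x *\<^sub>R u x) \<partial>M) + (\<integral>x. m x * (w x *\<^sub>R v x) \<partial>M)"
      using lin[OF u v, of 1 1] add.IH by simp
    also have "\<dots> = (\<integral>x. m x * (w x *\<^sub>R (u x + v x)) \<partial>M)"
      using int_m[OF u] int_m[OF v] by (simp add: scaleR_add_right ring_distribs)
    finally show ?case .
  next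
    case (lim u s)
    have [measurable]: "u \<in> borel_measurable M" "\<And>i. s i \<in> borel_measurable M"
      using lim.hyps(1,4) borel_measurable_integrable by force+
    have s: "integrable M (\<lambda>x. w x *\<^sub>R s i x)" for i
      using lim.hyps(1)[of i] int_dens by auto
    have u: "integrable M (\<lambda>x. w x *\<^sub>R u x)"
      using lim.hyps(4) int_dens by auto
    have ptw: "(\<lambda>i. s i x) \<longlonglongrightarrow> u x" "norm (s i x) \<le> 2 * norm (u x)" if "x \<in> space M" for i x
      using lim.hyps(2,3) that by auto
    have "(\<lambda>i. \<integral>x. norm (w x *\<^sub>R s i x - w x *\<^sub>R u x) \<partial>M) \<longlonglongrightarrow> (\<integral>x. 0 \<partial>M)"
    proof (rule integral_dominated_convergence[where w = "\<lambda>x. 3 * norm (w x *\<^sub>R u x)"])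
      show "integrable M (\<lambda>x. 3 * norm (w x *\<^sub>R u x))" using integrable_norm[OF u] by (rule integrable_mult_right)
      show "AE x in M. (\<lambda>i. norm (w x *\<^sub>R s i x - w x *\<^sub>R u x)) \<longlonglongrightarrow> 0"
      proof (rule AE_I2)
        fix x assume "x \<in> space M"
        then have "(\<lambda>i. norm (w x *\<^sub>R s i x - w x *\<^sub>R u x)) \<longlonglongrightarrow> norm (w x *\<^sub>R u x - w x *\<^sub>R u x)"
          by (intro tendsto_intros ptw)
        then show "(\<lambda>i. norm (w x *\<^sub>R s i x - w x *\<^sub>R u x)) \<longlonglongrightarrow> 0" by simp
      qed
      show "AE x in M. norm (norm (w x *\<^sub>R s i x - w x *\<^sub>R u x)) \<le> 3 * norm (w x *\<^sub>R u x)" for i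
      proof (rule AE_I2)
        fix x assume "x \<in> space M"
        have "norm (w x *\<^sub>R s i x - w x *\<^sub>R u x) = w x * norm (s i x - u x)"
          using w(2)[of x] by (simp add: scaleR_diff_right[symmetric])
        also have "\<dots> \<le> w x * (3 * norm (u x))"
          using ptw(2)[OF \<open>x \<in> space M\<close>, of i] norm_triangle_ineq4[of "s i x" "u x"] w(2)[of x]
          by (intro mult_left_mono) auto
        finally show "norm (norm (w x *\<^sub>R s i x - w x *\<^sub>R u x)) \<le> 3 * norm (w x *\<^sub>R u x)"
          using w(2)[of x] by simp
      qed
    qed measurable
    then have L1: "(\<lambda>i. \<integral>x. norm (w x *\<^sub>R s i x - w x *\<^sub>R u x) \<partial>M) \<longlonglongrightarrow> 0" by simp
    have "(\<lambda>i. L (\<lambda>x. w x *\<^sub>R s i x)) \<longlonglongrightarrow> \<Lambda>" if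
      \<Lambda>: "\<And>i. norm (L (\<lambda>x. w x *\<^sub>R s i x) - \<Lambda>) \<le> K * (\<integral>x. norm (w x *\<^sub>R s i x - w x *\<^sub>R u x) \<partial>M)" for \<Lambda> K
    proof (rule LIM_zero_cancel, rule Lim_null_comparison)
      show "(\<lambda>i. K * (\<integral>x. norm (w x *\<^sub>R s i x - w x *\<^sub>R u x) \<partial>M)) \<longlonglongrightarrow> 0"
        using tendsto_mult_right_zero[OF L1] .
    qed (use \<Lambda> in auto)
    note conv = this
    have diff: "integrable M (\<lambda>x. w x *\<^sub>R s i x - w x *\<^sub>R u x)" for i
      using s u by auto
    have "(\<lambda>i. L (\<lambda>x. w x *\<^sub>R s i x)) \<longlonglongrightarrow> L (\<lambda>x. w x *\<^sub>R u x)"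
    proof (rule conv[where K = D])
      fix i
      show "norm (L (\<lambda>x. w x *\<^sub>R s i x) - L (\<lambda>x. w x *\<^sub>R u x)) \<le> D * (\<integral>x. norm (w x *\<^sub>R s i x - w x *\<^sub>R u x) \<partial>M)"
        using lin[OF s[of i] u, of 1 "-1"] boundD[OF diff, of i] by simp
    qed
    moreover have "(\<lambda>i. L (\<lambda>x. w x *\<^sub>R s i x)) \<longlonglongrightarrow> (\<integral>x. m x * (w x *\<^sub>R u x) \<partial>M)"
    proof (rule conv[where K = "2 * D"])
      fix i
      have "L (\<lambda>x. w x *\<^sub>R s i x) - (\<integral>x. m x * (w x *\<^sub>R u x) \<partial>M) = (\<integral>x. m x * (w x *\<^sub>R s i x - w x *\<^sub>R u x) \<partial>M)"
        using lim.IH[of i] int_m[OF s[of i]] int_m[OF u] by (simp add: right_diff_distrib)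
      also have "norm \<dots> \<le> (\<integral>x. norm (m x * (w x *\<^sub>R s i x - w x *\<^sub>R u x)) \<partial>M)"
        by (rule integral_norm_bound)
      also have "\<dots> \<le> (\<integral>x. 2 * D * norm (w x *\<^sub>R s i x - w x *\<^sub>R u x) \<partial>M)"
        using integrable_norm[OF diff[of i]] integrable_norm[OF int_m[OF diff[of i]]] m_le
        by (intro integral_mono) (auto simp: norm_mult intro!: mult_right_mono)
      finally show "norm (L (\<lambda>x. w x *\<^sub>R s i x) - (\<integral>x. m x * (w x *\<^sub>R u x) \<partial>M))
          \<le> 2 * D * (\<integral>x. norm (w x *\<^sub>R s i x - w x *\<^sub>R u x) \<partial>M)" by simp
    qed
    ultimately show ?case by (rule LIMSEQ_unique)
  qed
  show thesis
  proof
    fix u :: "'a \<Rightarrow> complex" assume u: "integrable M u"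
    note [measurable] = borel_measurable_integrable[OF u]
    have eq: "w x *\<^sub>R (u x /\<^sub>R w x) = u x" for x using w(2)[of x] by simp
    have meas: "(\<lambda>x. u x /\<^sub>R w x) \<in> borel_measurable M" by measurable
    have "integrable ?M (\<lambda>x. u x /\<^sub>R w x)"
      unfolding int_dens[OF meas] eq by (rule u)
    from weighted[OF this] show "L u = (\<integral>x. m x * u x \<partial>M)" by (simp only: eq)
  qed (fact m m_le)+
qed


section \<open>Conformal change of variables\<close>

text \<open>The change of variables theorem for Lebesgue integrals lives on \<open>real ^ 'n\<close>.  It is carried over
to the complex plane along the measure preserving isomorphism with \<open>real ^ 2\<close>.\<close>

definition plane_of_complex :: "complex \<Rightarrow> real^2" where
  "plane_of_complex z = vector [Re z, Im z]"

definition complex_of_plane :: "real^2 \<Rightarrow> complex" where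
  "complex_of_plane v = Complex (v $ 1) (v $ 2)"

lemma complex_of_plane_inverse [simp]: "complex_of_plane (plane_of_complex z) = z"
  by (simp add: plane_of_complex_def complex_of_plane_def)

lemma plane_of_complex_inverse [simp]: "plane_of_complex (complex_of_plane v) = v"
  by (simp add: plane_of_complex_def complex_of_plane_def vec_eq_iff forall_2)

lemma bounded_linear_plane_of_complex: "bounded_linear plane_of_complex"
  by (intro linear_conv_bounded_linear[THEN iffD1] linearI)
     (simp_all add: plane_of_complex_def vec_eq_iff forall_2)

lemma bounded_linear_complex_of_plane: "bounded_linear complex_of_plane"
  by (intro linear_conv_bounded_linear[THEN iffD1] linearI)
     (simp_all add: complex_of_plane_def complex_eq_iff)

lemma continuous_on_plane_of_complex: "continuous_on S plane_of_complex"
  by (intro linear_continuous_on bounded_linear_plane_of_complex)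

lemma borel_measurable_plane_of_complex [measurable]: "plane_of_complex \<in> borel_measurable borel"
  by (intro borel_measurable_continuous_onI continuous_on_plane_of_complex)

lemma distr_lborel_plane_of_complex: "distr lborel borel plane_of_complex = lborel"
proof (rule lborel_eqI[symmetric])
  fix l u :: "real^2" assume le: "\<And>b. b \<in> Basis \<Longrightarrow> l \<bullet> b \<le> u \<bullet> b"
  have le': "l $ i \<le> u $ i" for i
    using le[of "axis i 1"] by (simp add: inner_axis)
  have vim: "plane_of_complex -` box l u = box (complex_of_plane l) (complex_of_plane u)"
    by (auto simp: box_def Basis_vec_def inner_axis plane_of_complex_def complex_of_plane_def
        Basis_complex_def forall_2 inner_complex_def)
  have "emeasure (distr lborel borel plane_of_complex) (box l u)
      = emeasure lborel (box (complex_of_plane l) (complex_of_plane u))"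
    by (subst emeasure_distr) (auto simp: vim)
  also have "\<dots> = ennreal ((u $ 1 - l $ 1) * (u $ 2 - l $ 2))"
    using le' by (subst emeasure_lborel_box)
      (auto simp: Basis_complex_def complex_of_plane_def inner_complex_def)
  also have "\<dots> = (\<Prod>b\<in>Basis. (u - l) \<bullet> b)"
  proof -
    have "(\<Prod>b\<in>Basis. (u - l) \<bullet> b) = (\<Prod>i\<in>UNIV. (u - l) $ i)"
      by (subst prod.reindex_bij_betw[symmetric, of "\<lambda>i. axis i (1::real)" UNIV])
         (auto simp: bij_betw_def inj_on_def axis_eq_axis Basis_vec_def inner_axis)
    then show ?thesis by (simp add: UNIV_2)
  qed
  finally show "emeasure (distr lborel borel plane_of_complex) (box l u)
      = ennreal (\<Prod>b\<in>Basis. (u - l) \<bullet> b)" .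
qed simp

lemma distr_lebesgue_plane_of_complex:
  "plane_of_complex \<in> lebesgue \<rightarrow>\<^sub>M lebesgue" "distr lebesgue lebesgue plane_of_complex = lebesgue"
proof -
  have meas: "plane_of_complex \<in> lebesgue \<rightarrow>\<^sub>M lborel"
    by (intro measurable_completion) simp
  have eq: "distr lebesgue lborel plane_of_complex = (lborel :: (real^2) measure)"
    using distr_completion[of plane_of_complex lborel lborel] distr_lborel_plane_of_complex
    by (metis borel_measurable_plane_of_complex distr_cong measurable_lborel1 measurable_lborel2 sets_lborel)
  show "plane_of_complex \<in> lebesgue \<rightarrow>\<^sub>M lebesgue"
    by (rule completion.measurable_completion2[OF meas]) (simp add: eq)
  show "distr lebesgue lebesgue plane_of_complex = lebesgue"
    using completion.completion_distr_eq[OF meas] eq by simp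
qed

lemma complex_of_plane_measurable: "complex_of_plane \<in> lebesgue \<rightarrow>\<^sub>M lebesgue"
proof (rule measurableI)
  fix S :: "complex set" assume S: "S \<in> sets lebesgue"
  have "complex_of_plane -` S \<inter> space lebesgue = plane_of_complex ` S"
    by (auto simp: image_iff) (metis plane_of_complex_inverse)
  also have "\<dots> \<in> sets lebesgue"
    by (rule differentiable_image_in_sets_lebesgue)
       (use S in \<open>auto intro!: linear_imp_differentiable_on bounded_linear.linear bounded_linear_plane_of_complex\<close>)
  finally show "complex_of_plane -` S \<inter> space lebesgue \<in> sets lebesgue" .
qed simp

lemma integral_plane_of_complex:
  fixes h :: "complex \<Rightarrow> 'a::euclidean_space"
  shows "(\<lambda>v. h (complex_of_plane v)) absolutely_integrable_on plane_of_complex ` S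
           \<longleftrightarrow> h absolutely_integrable_on S" (is ?A)
    and "h absolutely_integrable_on S \<Longrightarrow>
           integral (plane_of_complex ` S) (\<lambda>v. h (complex_of_plane v)) = integral S h"
proof -
  have ind: "indicator (plane_of_complex ` S) (plane_of_complex z) = (indicator S z :: real)" for z
    by (auto simp: indicator_def image_iff) (metis complex_of_plane_inverse)
  let ?h = "\<lambda>v. indicator (plane_of_complex ` S) v *\<^sub>R h (complex_of_plane v)"
  have comp: "?h (plane_of_complex z) = indicator S z *\<^sub>R h z" for z
    by (simp add: ind)
  have comp': "?h v = indicator S (complex_of_plane v) *\<^sub>R h (complex_of_plane v)" for v
    using comp[of "complex_of_plane v"] by simp
  have meas: "?h \<in> borel_measurable lebesgue" if "(\<lambda>z. indicator S z *\<^sub>R h z) \<in> borel_measurable lebesgue"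
    unfolding comp' using measurable_compose[OF complex_of_plane_measurable that] .
  have "integrable (distr lebesgue lebesgue plane_of_complex) ?h \<longleftrightarrow>
      integrable lebesgue (\<lambda>z. indicator S z *\<^sub>R h z)"
  proof
    assume "integrable (distr lebesgue lebesgue plane_of_complex) ?h"
    then show "integrable lebesgue (\<lambda>z. indicator S z *\<^sub>R h z)"
      using integrable_distr[OF distr_lebesgue_plane_of_complex(1), of ?h] by (simp add: ind)
  next
    assume int: "integrable lebesgue (\<lambda>z. indicator S z *\<^sub>R h z)"
    then show "integrable (distr lebesgue lebesgue plane_of_complex) ?h"
      by (subst integrable_distr_eq[OF distr_lebesgue_plane_of_complex(1)])
         (use meas in \<open>auto simp: ind\<close>)
  qed
  then show ?A
    by (simp add: set_integrable_def distr_lebesgue_plane_of_complex)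
  assume abs: "h absolutely_integrable_on S"
  then have abs': "(\<lambda>v. h (complex_of_plane v)) absolutely_integrable_on plane_of_complex ` S"
    using \<open>?A\<close> by simp
  have "integral\<^sup>L (distr lebesgue lebesgue plane_of_complex) ?h
      = integral\<^sup>L lebesgue (\<lambda>z. indicator S z *\<^sub>R h z)"
    by (subst integral_distr[OF distr_lebesgue_plane_of_complex(1)])
       (use meas abs in \<open>auto simp: ind set_integrable_def borel_measurable_integrable\<close>)
  then show "integral (plane_of_complex ` S) (\<lambda>v. h (complex_of_plane v)) = integral S h"
    using set_lebesgue_integral_eq_integral(2)[OF abs] set_lebesgue_integral_eq_integral(2)[OF abs']
    by (simp add: set_lebesgue_integral_def distr_lebesgue_plane_of_complex)
qed

text \<open>Multiplication by \<open>d\<close>, as a linear map of the plane, has determinant \<open>(norm d)\<^sup>2\<close>.\<close>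

lemma complex_change_of_variables:
  fixes h :: "complex \<Rightarrow> complex"
  assumes S: "S \<in> sets lebesgue"
    and der: "\<And>z. z \<in> S \<Longrightarrow> (g has_field_derivative g' z) (at z within S)"
    and inj: "inj_on g S"
  shows "(\<lambda>z. (norm (g' z))\<^sup>2 *\<^sub>R h (g z)) absolutely_integrable_on S \<and>
         integral S (\<lambda>z. (norm (g' z))\<^sup>2 *\<^sub>R h (g z)) = b
     \<longleftrightarrow> h absolutely_integrable_on g ` S \<and> integral (g ` S) h = b"
proof -
  let ?P = plane_of_complex and ?C = complex_of_plane
  let ?S = "?P ` S" and ?g = "\<lambda>v. ?P (g (?C v))" and ?g' = "\<lambda>v w. ?P (g' (?C v) * ?C w)"
  let ?h = "\<lambda>v. ?P (h (?C v))"
  have S': "?S \<in> sets lebesgue"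
    by (rule differentiable_image_in_sets_lebesgue)
       (use S in \<open>auto intro!: linear_imp_differentiable_on bounded_linear.linear bounded_linear_plane_of_complex\<close>)
  have der': "(?g has_derivative ?g' v) (at v within ?S)" if "v \<in> ?S" for v
  proof -
    from that obtain z where z: "z \<in> S" "v = ?P z" by auto
    have C: "?C ` ?S = S" by (auto simp: image_image)
    have 1: "(?C has_derivative ?C) (at v within ?S)"
      by (rule bounded_linear.has_derivative[OF bounded_linear_complex_of_plane]) simp
    have 2: "(g has_derivative (\<lambda>w. g' (?C v) * w)) (at (?C v) within ?C ` ?S)"
      using der[of z] z by (simp add: C has_field_derivative_def)
    have "((g \<circ> ?C) has_derivative ((\<lambda>w. g' (?C v) * w) \<circ> ?C)) (at v within ?S)"
      by (rule diff_chain_within[OF 1 2])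
    then show ?thesis
      by (auto dest: bounded_linear.has_derivative[OF bounded_linear_plane_of_complex] simp: o_def)
  qed
  have inj': "inj_on ?g ?S"
    using inj by (auto simp: inj_on_def) (metis complex_of_plane_inverse)
  have det: "\<bar>det (matrix (?g' v))\<bar> = (norm (g' (?C v)))\<^sup>2" for v
    by (simp add: det_2 matrix_def axis_def plane_of_complex_def complex_of_plane_def cmod_power2
        power2_eq_square[symmetric])
  have im: "?g ` ?S = ?P ` (g ` S)" by (auto simp: image_image)
  have lin: "?P (r *\<^sub>R w) = r *\<^sub>R ?P w" for r w
    by (simp add: plane_of_complex_def vec_eq_iff forall_2)
  have P_abs: "(\<lambda>z. ?P (k z)) absolutely_integrable_on T \<longleftrightarrow> k absolutely_integrable_on T"
    for k :: "real^2 \<Rightarrow> complex" and T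
    using absolutely_integrable_linear[OF _ bounded_linear_plane_of_complex, where f = k and s = T]
      absolutely_integrable_linear[OF _ bounded_linear_complex_of_plane, where f = "\<lambda>z. ?P (k z)" and s = T]
    by (auto simp: o_def)
  have P_int: "integral T (\<lambda>z. ?P (k z)) = ?P (integral T k)" if "k absolutely_integrable_on T"
    for k :: "real^2 \<Rightarrow> complex" and T
    using integral_linear[OF _ bounded_linear_plane_of_complex, where f = k and S = T] that
    by (simp add: o_def absolutely_integrable_on_def)
  have P_eq: "?P a = ?P b \<longleftrightarrow> a = b" for a b
    by (metis complex_of_plane_inverse)
  have left: "k absolutely_integrable_on T \<and> integral T k = b \<longleftrightarrow>
     (\<lambda>v. ?P (k (?C v))) absolutely_integrable_on ?P ` T \<and> integral (?P ` T) (\<lambda>v. ?P (k (?C v))) = ?P b" for k T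
    using integral_plane_of_complex[where h = k and S = T] P_abs[where k = "\<lambda>v. k (?C v)"] P_int[where k = "\<lambda>v. k (?C v)"] P_eq by metis
  have "(\<lambda>v. \<bar>det (matrix (?g' v))\<bar> *\<^sub>R ?h (?g v)) absolutely_integrable_on ?S \<and>
           integral ?S (\<lambda>v. \<bar>det (matrix (?g' v))\<bar> *\<^sub>R ?h (?g v)) = ?P b
     \<longleftrightarrow> ?h absolutely_integrable_on (?g ` ?S) \<and> integral (?g ` ?S) ?h = ?P b"
    by (rule has_absolute_integral_change_of_variables[OF S' der' inj'])
  then show ?thesis
    unfolding left[where k = h and T = "g ` S"] left[where k = "\<lambda>z. (norm (g' z))\<^sup>2 *\<^sub>R h (g z)" and T = S] im det
    by (simp add: lin)
qed

text \<open>Lebesgue sets are Borel sets up to null sets, so null preimages of null sets suffice.\<close>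

lemma measurable_lebesgue_nonsingular:
  fixes g :: "'a::euclidean_space \<Rightarrow> 'b::euclidean_space"
  assumes g: "g \<in> borel_measurable borel" and null: "\<And>N. negligible N \<Longrightarrow> negligible (g -` N)"
  shows "g \<in> lebesgue \<rightarrow>\<^sub>M lebesgue"
proof (rule completion.measurable_completion2)
  show g': "g \<in> lebesgue \<rightarrow>\<^sub>M lborel"
    using g by (intro measurable_completion) simp
  show "null_sets lborel \<subseteq> null_sets (distr lebesgue lborel g)"
  proof
    fix N :: "'b set" assume N: "N \<in> null_sets lborel"
    then have "negligible (g -` N)"
      by (intro null) (simp add: negligible_iff_null_sets null_sets_completionI)
    then show "N \<in> null_sets (distr lebesgue lborel g)"
      using null_setsD2[OF N] N g' by (simp add: null_sets_distr_iff negligible_iff_null_sets)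
  qed
qed

text \<open>The two statements express that \<open>\<phi> \<mapsto> (\<phi> \<circ> h) / (k' \<circ> h)\<^sup>2\<close>, the push-forward of quadratic
differentials under \<open>k\<close>, is dual to the pullback \<open>\<psi> \<mapsto> (\<psi> \<circ> k) * cnj k' / k'\<close> of Beltrami
differentials: the substitution \<open>x = k y\<close> contributes the Jacobian \<open>k' * cnj k'\<close>.\<close>

lemma conformal_transfer:
  fixes k :: "complex \<Rightarrow> complex"
  assumes W: "open W" and k: "k holomorphic_on W" and inj: "inj_on k W"
    and h: "\<And>y. y \<in> W \<Longrightarrow> h (k y) = y" and \<phi>: "set_integrable lebesgue W \<phi>"
  shows "set_integrable lebesgue (k ` W) (\<lambda>x. \<phi> (h x) / (deriv k (h x))\<^sup>2)"
    and "\<psi> \<in> borel_measurable lebesgue \<Longrightarrow> (\<And>x. norm (\<psi> x) \<le> B) \<Longrightarrow>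
      (LINT x:k ` W|lebesgue. \<psi> x * (\<phi> (h x) / (deriv k (h x))\<^sup>2))
        = (LINT y:W|lebesgue. \<psi> (k y) * (cnj (deriv k y) / deriv k y) * \<phi> y)"
proof -
  have opk: "open (k ` W)" by (rule open_mapping_thm3[OF k W inj])
  then have lk: "k ` W \<in> sets lebesgue" by (simp add: borel_open)
  have dk: "deriv k y \<noteq> 0" if "y \<in> W" for y
    by (rule holomorphic_injective_imp_regular[OF k W inj that])
  obtain g where g: "g holomorphic_on k ` W" "\<And>y. y \<in> W \<Longrightarrow> deriv k y * deriv g (k y) = 1"
    "\<And>y. y \<in> W \<Longrightarrow> g (k y) = y"
    using holomorphic_has_inverse[OF k W inj] by metis
  have hg: "h x = g x" if "x \<in> k ` W" for x using that h g(3) by auto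
  have der: "(h has_field_derivative inverse (deriv k (h x))) (at x within k ` W)" if x: "x \<in> k ` W" for x
  proof -
    obtain y where y: "y \<in> W" "x = k y" using x by auto
    have "(g has_field_derivative deriv g x) (at x)"
      by (rule holomorphic_derivI[OF g(1) opk x])
    then have "(h has_field_derivative deriv g x) (at x)"
      by (rule has_field_derivative_transform_within_open[OF _ opk x]) (simp add: hg)
    moreover have "deriv g x = inverse (deriv k (h x))"
      using g(2)[OF y(1)] dk[OF y(1)] y h by (simp add: field_simps)
    ultimately show ?thesis by (simp add: has_field_derivative_at_within)
  qed
  have inj_h: "inj_on h (k ` W)" using h by (auto simp: inj_on_def)
  have im_h: "h ` k ` W = W" using h by (force simp: image_image)
  have cov: "(\<lambda>x. (norm (inverse (deriv k (h x))))\<^sup>2 *\<^sub>R H (h x)) absolutely_integrable_on k ` W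
      \<and> integral (k ` W) (\<lambda>x. (norm (inverse (deriv k (h x))))\<^sup>2 *\<^sub>R H (h x)) = b
      \<longleftrightarrow> H absolutely_integrable_on W \<and> integral W H = b" for H :: "complex \<Rightarrow> complex" and b
    using complex_change_of_variables[where S = "k ` W" and g = h and h = H and b = b
        and g' = "\<lambda>x. inverse (deriv k (h x))", OF lk _ inj_h, unfolded im_h] der by blast
  have eq: "(norm (inverse (deriv k (h x))))\<^sup>2 *\<^sub>R (\<psi> (k (h x)) * (cnj (deriv k (h x)) / deriv k (h x)) * \<phi> (h x))
      = \<psi> x * (\<phi> (h x) / (deriv k (h x))\<^sup>2)" if x: "x \<in> k ` W" for x \<psi>
  proof -
    obtain y where y: "y \<in> W" "x = k y" using x by blast
    let ?d = "deriv k y"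
    have d: "?d \<noteq> 0" "cnj ?d \<noteq> 0" using dk[OF y(1)] by auto
    have "complex_of_real ((norm (inverse ?d))\<^sup>2) = inverse ?d * inverse (cnj ?d)"
      by (simp add: complex_norm_square del: of_real_power)
    then show ?thesis using d by (simp add: y h scaleR_conv_of_real power2_eq_square field_simps del: of_real_power)
  qed
  let ?q = "\<lambda>y. cnj (deriv k y) / deriv k y"
  have q_cont: "continuous_on W ?q"
    by (intro continuous_intros holomorphic_on_imp_continuous_on holomorphic_deriv k W) (use dk in auto)
  have lW: "W \<in> sets lebesgue" using W by (simp add: borel_open)
  have q_meas: "?q \<in> borel_measurable (lebesgue_on W)"
    by (rule continuous_imp_measurable_on_sets_lebesgue[OF q_cont lW])
  have "(\<lambda>y. ?q y * \<phi> y) absolutely_integrable_on W"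
  proof (rule absolutely_integrable_bounded_measurable_product[OF bilinear_times q_meas lW _ \<phi>])
    show "bounded (?q ` W)" by (auto simp: bounded_iff norm_divide intro!: exI[of _ 1])
  qed
  then have *: "(\<lambda>y. 1 * ?q y * \<phi> y) absolutely_integrable_on W" by simp
  have "(\<lambda>x. (norm (inverse (deriv k (h x))))\<^sup>2 *\<^sub>R (1 * ?q (h x) * \<phi> (h x))) absolutely_integrable_on k ` W"
    by (rule conjunct1[OF iffD2[OF cov[of "\<lambda>y. 1 * ?q y * \<phi> y"] conjI[OF * refl]]])
  then show int: "set_integrable lebesgue (k ` W) (\<lambda>x. \<phi> (h x) / (deriv k (h x))\<^sup>2)"
    by (rule iffD1[OF set_integrable_cong[OF refl refl], rotated]) (use eq[of _ "\<lambda>_. 1"] in simp)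
  assume \<psi>: "\<psi> \<in> borel_measurable lebesgue" "\<And>x. norm (\<psi> x) \<le> B"
  have "(\<lambda>x. \<psi> x * (\<phi> (h x) / (deriv k (h x))\<^sup>2)) absolutely_integrable_on k ` W"
  proof (rule absolutely_integrable_bounded_measurable_product[OF bilinear_times _ lk _ int])
    show "\<psi> \<in> borel_measurable (lebesgue_on (k ` W))" using \<psi>(1) by (rule measurable_restrict_space1)
    show "bounded (\<psi> ` k ` W)" using \<psi>(2) by (auto simp: bounded_iff)
  qed
  note intL = this
  let ?L = "\<lambda>x. (norm (inverse (deriv k (h x))))\<^sup>2 *\<^sub>R (\<psi> (k (h x)) * ?q (h x) * \<phi> (h x))"
  have L: "?L absolutely_integrable_on k ` W"
    by (rule iffD1[OF set_integrable_cong[OF refl refl] intL]) (rule eq[symmetric])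
  from iffD1[OF cov[of "\<lambda>y. \<psi> (k y) * ?q y * \<phi> y"] conjI[OF L refl]]
  have R: "(\<lambda>y. \<psi> (k y) * ?q y * \<phi> y) absolutely_integrable_on W"
    and RL: "integral W (\<lambda>y. \<psi> (k y) * ?q y * \<phi> y) = integral (k ` W) ?L"
    by blast+
  have LL: "integral (k ` W) ?L = integral (k ` W) (\<lambda>x. \<psi> x * (\<phi> (h x) / (deriv k (h x))\<^sup>2))"
    by (rule Henstock_Kurzweil_Integration.integral_cong) (rule eq)
  show "(LINT x:k ` W|lebesgue. \<psi> x * (\<phi> (h x) / (deriv k (h x))\<^sup>2))
        = (LINT y:W|lebesgue. \<psi> (k y) * ?q y * \<phi> y)"
    unfolding set_lebesgue_integral_eq_integral(2)[OF intL] set_lebesgue_integral_eq_integral(2)[OF R] RL LL ..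
qed

lemma AE_summable_norm:
  fixes t :: "nat \<Rightarrow> 'a \<Rightarrow> 'b::{banach, second_countable_topology}"
  assumes int: "\<And>n. integrable M (t n)" and sum: "summable (\<lambda>n. \<integral>x. norm (t n x) \<partial>M)"
  shows "AE x in M. summable (\<lambda>n. norm (t n x))"
proof -
  have [measurable]: "t n \<in> borel_measurable M" for n using int by auto
  have "(\<integral>\<^sup>+x. (\<Sum>n. ennreal (norm (t n x))) \<partial>M) = (\<Sum>n. \<integral>\<^sup>+x. ennreal (norm (t n x)) \<partial>M)"
    by (rule nn_integral_suminf) measurable
  also have "\<dots> = (\<Sum>n. ennreal (\<integral>x. norm (t n x) \<partial>M))"
    by (intro suminf_cong nn_integral_eq_integral integrable_norm int) auto
  also have "\<dots> \<noteq> \<infinity>"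
    using sum by (simp add: ennreal_suminf_neq_top)
  finally have "AE x in M. (\<Sum>n. ennreal (norm (t n x))) \<noteq> \<infinity>"
    by (intro nn_integral_PInf_AE) auto
  then show ?thesis
  proof eventually_elim
    case (elim x)
    show ?case by (rule summable_suminf_not_top) (use elim in simp_all)
  qed
qed


section \<open>Rectifiable rays and their complements\<close>

text \<open>The arc length \<open>s\<close> satisfies \<open>dist (r t) (r t') \<le> \<bar>s t - s t'\<bar>\<close>.  Hence the curve is the image of a
subset of the real axis, a null set of the plane, under a 1-Lipschitz map.\<close>

lemma negligible_finite_length:
  fixes r :: "real \<Rightarrow> complex"
  assumes fin: "finite_length_on a b r"
  shows "negligible (r ` {a..b})"
proof (cases "a \<le> b")
  case False
  then show ?thesis by simp
next
  case True
  define P where "P t = {(n, p). mono_on {..n::nat} p \<and> p ` {..n} \<subseteq> {a..t}}" for t :: real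
  define len where "len = (\<lambda>(n, p). \<Sum>i<n. dist (r (p i)) (r (p (Suc i))))"
  define s where "s t = (SUP q\<in>P t. len q)" for t
  obtain L where L: "\<And>n p. mono_on {..n::nat} p \<Longrightarrow> p ` {..n} \<subseteq> {a..b} \<Longrightarrow> len (n, p) \<le> L"
    using fin unfolding finite_length_on_def len_def by auto
  have bdd: "bdd_above (len ` P t)" if "t \<le> b" for t
  proof (rule bdd_aboveI2)
    fix q assume "q \<in> P t"
    then show "len q \<le> L" using L[of "fst q" "snd q"] that by (force simp: P_def)
  qed
  have ne: "P t \<noteq> {}" if "a \<le> t" for t
  proof -
    have "(0, \<lambda>_. t) \<in> P t" using that by (auto simp: P_def mono_on_def)
    then show ?thesis by blast
  qed
  have step: "s t + dist (r t) (r t') \<le> s t'" if t: "a \<le> t" "t \<le> t'" "t' \<le> b" for t t'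
  proof -
    have "s t \<le> s t' - dist (r t) (r t')"
      unfolding s_def[of t]
    proof (rule cSUP_least[OF ne[OF t(1)]])
      fix q assume "q \<in> P t"
      then obtain n p where q: "q = (n, p)" and p: "mono_on {..n} p" "p ` {..n} \<subseteq> {a..t}"
        by (auto simp: P_def)
      define p' where "p' i = (if i \<le> n then p i else if i = Suc n then t else t')" for i
      have pn: "p i \<in> {a..t}" if "i \<le> n" for i using p(2) that by auto
      have "(Suc (Suc n), p') \<in> P t'"
        using p(1) pn t by (force simp: P_def p'_def mono_on_def le_Suc_eq)
      then have "len (Suc (Suc n), p') \<le> s t'"
        unfolding s_def by (intro cSUP_upper bdd t)
      moreover have "len (Suc (Suc n), p') = len q + dist (r (p n)) (r t) + dist (r t) (r t')"
        by (simp add: len_def q p'_def)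
      ultimately show "len q \<le> s t' - dist (r t) (r t')"
        using zero_le_dist[of "r (p n)" "r t"] by linarith
    qed
    then show ?thesis by simp
  qed
  have lip: "dist (r t) (r t') \<le> \<bar>s t - s t'\<bar>" if "t \<in> {a..b}" "t' \<in> {a..b}" for t t'
    using step[of t t'] step[of t' t] that by (cases "t \<le> t'") (auto simp: dist_commute)
  define S where "S = (\<lambda>t. complex_of_real (s t)) ` {a..b}"
  define F where "F z = r (SOME t. t \<in> {a..b} \<and> complex_of_real (s t) = z)" for z
  have F: "F (complex_of_real (s t)) = r t" if "t \<in> {a..b}" for t
  proof -
    have "\<exists>t'. t' \<in> {a..b} \<and> complex_of_real (s t') = complex_of_real (s t)" using that by blast
    from someI_ex[OF this] show ?thesis
      unfolding F_def using lip[OF _ that] by force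
  qed
  have "S \<subseteq> {z. z \<bullet> \<i> = 0}" by (auto simp: S_def)
  then have "negligible S"
    by (rule negligible_subset[OF negligible_standard_hyperplane, rotated]) (simp add: Basis_complex_def)
  then have "negligible (F ` S)"
  proof (rule negligible_locally_Lipschitz_image[OF order_refl])
    fix z assume z: "z \<in> S"
    have "norm (F y - F z) \<le> 1 * norm (y - z)" if y: "y \<in> S" for y
    proof -
      obtain t t' where t: "t \<in> {a..b}" "z = complex_of_real (s t)" "t' \<in> {a..b}" "y = complex_of_real (s t')"
        using y z by (auto simp: S_def)
      then have "norm (y - z) = \<bar>s t' - s t\<bar>"
        by (metis norm_of_real of_real_diff)
      then show ?thesis using t lip[of t' t] by (simp add: F dist_norm)
    qed
    then show "\<exists>T B. open T \<and> z \<in> T \<and> (\<forall>y\<in>S \<inter> T. norm (F y - F z) \<le> B * norm (y - z))"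
      by (intro exI[of _ UNIV] exI[of _ 1]) auto
  qed
  moreover have "F ` S = r ` {a..b}"
    by (auto simp: S_def F image_iff intro!: bexI)
  ultimately show ?thesis by simp
qed

lemma negligible_rectifiable_ray:
  assumes "rectifiable_ray R"
  shows "negligible R"
proof -
  obtain r :: "real \<Rightarrow> complex" where r: "\<And>T. T \<ge> 0 \<Longrightarrow> finite_length_on 0 T r" "R = r ` {0..}"
    using assms by (auto simp: rectifiable_ray_def)
  have "R = (\<Union>n::nat. r ` {0..real n})"
    unfolding r(2) by (force intro: real_nat_ceiling_ge)
  moreover have "negligible (\<Union>n::nat. r ` {0..real n})"
    by (intro negligible_Union_nat negligible_finite_length r(1)) simp
  ultimately show ?thesis by simp
qed

lemma closed_rectifiable_ray:
  assumes "rectifiable_ray R"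
  shows "closed R"
proof -
  obtain r :: "real \<Rightarrow> complex" where cont: "continuous_on {0..} r" and inf: "filterlim r at_infinity at_top"
    and R: "R = r ` {0..}"
    using assms by (auto simp: rectifiable_ray_def)
  have "\<exists>e>0. ball x e \<subseteq> - R" if x: "x \<notin> R" for x
  proof -
    have "eventually (\<lambda>t. norm x + 1 \<le> norm (r t)) at_top"
      using inf[unfolded filterlim_at_infinity[OF order_refl], rule_format, of "norm x + 1"]
      by (simp add: add_nonneg_pos)
    then obtain T where T: "\<And>t. t \<ge> T \<Longrightarrow> norm x + 1 \<le> norm (r t)"
      unfolding eventually_at_top_linorder by blast
    have "compact (r ` {0..T})"
      by (intro compact_continuous_image continuous_on_subset[OF cont]) auto
    moreover have "x \<notin> r ` {0..T}" using x R by auto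
    ultimately obtain e where e: "e > 0" "ball x e \<subseteq> - r ` {0..T}"
      by (metis ComplI compact_imp_closed open_Compl open_contains_ball)
    have "y \<notin> R" if "y \<in> ball x (min e 1)" for y
    proof
      assume "y \<in> R"
      then obtain t where t: "t \<ge> 0" "y = r t" using R by auto
      have "y \<notin> r ` {0..T}" using e that by auto
      then have "norm x + 1 \<le> norm y" using t T[of t] by force
      moreover have "norm y \<le> norm x + dist x y"
        by (metis dist_commute dist_norm norm_triangle_sub)
      ultimately show False using that by simp
    qed
    then show ?thesis using e(1) by (intro exI[of _ "min e 1"]) auto
  qed
  then show ?thesis
    by (simp add: closed_def open_contains_ball)
qed

text \<open>Inversion at a point \<open>p\<close> off the ray turns the ray, together with infinity, into a compact arc
through 0; an arc does not separate the plane, so the complement of the ray is connected.  It is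
simply connected since the only component of its own complement is the unbounded ray.\<close>

lemma simply_connected_complement_ray:
  assumes ray: "rectifiable_ray R"
  shows "simply_connected (- R)"
proof -
  obtain r :: "real \<Rightarrow> complex" where cont: "continuous_on {0..} r" and inj: "inj_on r {0..}"
    and inf: "filterlim r at_infinity at_top" and R: "R = r ` {0..}"
    using ray by (auto simp: rectifiable_ray_def)
  have op: "open (- R)" using closed_rectifiable_ray[OF ray] by auto
  have "R \<noteq> UNIV"
    using negligible_rectifiable_ray[OF ray] by (metis negligible_imp_measurable non_negligible_UNIV)
  then obtain p where p: "p \<notin> R" by blast
  \<comment> \<open>The substitution \<open>t / (1 - t)\<close> maps \<open>[0, 1)\<close> onto the parameter range of the ray.\<close>
  define \<gamma> where "\<gamma> t = (if t < 1 then inverse (r (t / (1 - t)) - p) else 0)" for t :: real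
  have nz: "r t \<noteq> p" if "t \<ge> 0" for t using p R that by auto
  have cont_r: "continuous_on {0..<1} (\<lambda>t. inverse (r (t / (1 - t)) - p))"
    by (intro continuous_intros continuous_on_compose2[OF cont]) (auto simp: nz)
  have "path \<gamma>"
    unfolding path_def continuous_on_eq_continuous_within
  proof
    fix t :: real assume t: "t \<in> {0..1}"
    show "continuous (at t within {0..1}) \<gamma>"
    proof (cases "t < 1")
      case True
      have "continuous (at t within {0..<1}) (\<lambda>t. inverse (r (t / (1 - t)) - p))"
        using cont_r True t by (auto simp: continuous_on_eq_continuous_within)
      then have "continuous (at t within {0..<1}) \<gamma>"
        by (rule continuous_transform_within[OF _ zero_less_one]) (use True t in \<open>auto simp: \<gamma>_def\<close>)
      moreover have "at t within {0..<1} = at t within {0..1}"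
        by (rule at_within_nhd[of _ "{..<1}"]) (use True in auto)
      ultimately show ?thesis by (simp add: continuous_within)
    next
      case False
      then have t1: "t = 1" using t by simp
      have "filterlim (\<lambda>t::real. t / (1 - t)) at_top (at_left 1)"
        by real_asymp
      from filterlim_compose[OF inf this]
      have "filterlim (\<lambda>t. - p + r (t / (1 - t))) at_infinity (at_left 1)"
        by (rule tendsto_add_filterlim_at_infinity[OF tendsto_const])
      then have "filterlim (\<lambda>t. r (t / (1 - t)) - p) at_infinity (at_left 1)"
        by simp
      then have "((\<lambda>t. inverse (r (t / (1 - t)) - p)) \<longlongrightarrow> 0) (at_left 1)"
        by (rule filterlim_compose[OF tendsto_inverse_0])
      then have "(\<gamma> \<longlongrightarrow> 0) (at_left 1)"
        by (rule Lim_transform_eventually)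
           (auto simp: \<gamma>_def eventually_at_filter)
      moreover have "at 1 within {0..1::real} = at_left 1"
        by (rule at_within_nhd[of _ "{0<..}"]) auto
      ultimately show ?thesis unfolding t1 continuous_within by (simp add: \<gamma>_def)
    qed
  qed
  moreover have "inj_on \<gamma> {0..1}"
  proof (rule inj_onI)
    fix a b :: real assume ab: "a \<in> {0..1}" "b \<in> {0..1}" "\<gamma> a = \<gamma> b"
    have nz': "r (t / (1 - t)) \<noteq> p" if "0 \<le> t" "t < 1" for t :: real
      using nz[of "t / (1 - t)"] that by simp
    show "a = b"
    proof (cases "a < 1 \<and> b < 1")
      case True
      then have "r (a / (1 - a)) = r (b / (1 - b))" using ab by (simp add: \<gamma>_def)
      then have "a / (1 - a) = b / (1 - b)"
        using inj True ab by (auto dest!: inj_onD)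
      then show ?thesis using True by (simp add: field_simps)
    next
      case False
      then show ?thesis using ab nz'[of a] nz'[of b]
        by (auto simp: \<gamma>_def split: if_splits)
    qed
  qed
  ultimately have "arc \<gamma>" by (simp add: arc_def)
  then have conn: "connected (- path_image \<gamma>)"
    by (rule connected_arc_complement) simp
  have "1 \<in> {0..1::real}" "\<gamma> 1 = 0" by (auto simp: \<gamma>_def)
  then have zero: "0 \<in> path_image \<gamma>" unfolding path_image_def by (metis image_eqI)
  have on_arc: "inverse (r s - p) \<in> path_image \<gamma>" if "s \<ge> 0" for s
  proof -
    have "\<gamma> (s / (1 + s)) = inverse (r s - p)"
    proof -
      have "1 - s / (1 + s) = 1 / (1 + s)" using that by (simp add: field_simps)
      then have "s / (1 + s) / (1 - s / (1 + s)) = s" using that by simp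
      then show ?thesis using that by (simp add: \<gamma>_def)
    qed
    moreover have "s / (1 + s) \<in> {0..1}" using that by (simp add: field_simps)
    ultimately show ?thesis unfolding path_image_def by (metis image_eqI)
  qed
  have im: "(\<lambda>w. p + inverse w) ` (- path_image \<gamma>) = - R - {p}"
  proof (intro set_eqI iffI)
    fix y assume "y \<in> (\<lambda>w. p + inverse w) ` (- path_image \<gamma>)"
    then obtain w where w: "w \<notin> path_image \<gamma>" "y = p + inverse w" by auto
    have "w \<noteq> 0" using w zero by auto
    moreover have "y \<notin> R"
    proof
      assume "y \<in> R"
      then obtain s where s: "s \<ge> 0" "y = r s" using R by auto
      have "inverse (r s - p) = w" using w(2) s(2) by simp
      then show False using on_arc[OF s(1)] w(1) by simp
    qed
    ultimately show "y \<in> - R - {p}" using w by simp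
  next
    fix y assume y: "y \<in> - R - {p}"
    have "inverse (y - p) \<notin> path_image \<gamma>"
    proof
      assume "inverse (y - p) \<in> path_image \<gamma>"
      then obtain t where t: "0 \<le> t" "t \<le> 1" "inverse (y - p) = \<gamma> t" by (auto simp: path_image_def)
      then have "t < 1" using y by (auto simp: \<gamma>_def split: if_splits)
      then have "y = r (t / (1 - t))" using t by (simp add: \<gamma>_def)
      then show False using y R t \<open>t < 1\<close> by auto
    qed
    moreover have "y = p + inverse (inverse (y - p))" by simp
    ultimately show "y \<in> (\<lambda>w. p + inverse w) ` (- path_image \<gamma>)" by blast
  qed
  have "connected (- R - {p})"
    unfolding im[symmetric]
    by (intro connected_continuous_image conn continuous_intros) (use zero in auto)
  then have "connected (- R)"
  proof (rule connected_intermediate_closure)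
    have "p islimpt (- R)"
      using op p interior_limit_point[of p "- R"] by (simp add: interior_open)
    then have "p \<in> closure (- R - {p})"
      by (simp add: closure_def islimpt_def) blast
    then show "- R \<subseteq> closure (- R - {p})"
      using closure_subset[of "- R - {p}"] by blast
  qed auto
  moreover have "\<not> bounded C" if C: "C \<in> components R" for C
  proof -
    have "connected R" unfolding R by (intro connected_continuous_image cont) auto
    then have "C = R" using C by (metis components_eq_sing_iff in_components_nonempty components_empty empty_iff singletonD)
    moreover have "\<not> bounded R"
    proof
      assume "bounded R"
      then obtain B where B: "\<And>t. t \<ge> 0 \<Longrightarrow> norm (r t) \<le> B" by (auto simp: bounded_iff R)
      then have "B \<ge> 0" using norm_ge_zero order_trans by blast
      then have "eventually (\<lambda>t. B + 1 \<le> norm (r t)) at_top"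
        using inf[unfolded filterlim_at_infinity[OF order_refl], rule_format, of "B + 1"] by simp
      then have "eventually (\<lambda>t::real. False) at_top"
        using eventually_ge_at_top[of 0] by eventually_elim (use B in force)
      then show False by simp
    qed
    ultimately show ?thesis by simp
  qed
  ultimately show ?thesis
    by (simp add: simply_connected_eq_unbounded_complement_components[OF op])
qed


section \<open>Right inverses over a disc\<close>

text \<open>Where two lifts agree they agree nearby, because \<open>F\<close> is locally injective; the coincidence set is
also closed.\<close>

lemma lifts_agree:
  fixes F :: "'a::metric_space \<Rightarrow> 'b" and g h :: "'c::topological_space \<Rightarrow> 'a"
  assumes S: "connected S" and g: "continuous_on S g" and h: "continuous_on S h"
    and eq: "\<And>x. x \<in> S \<Longrightarrow> F (g x) = F (h x)"
    and inj: "\<And>x. x \<in> S \<Longrightarrow> \<exists>r>0. inj_on F (ball (g x) r)"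
    and a: "a \<in> S" "g a = h a" and x: "x \<in> S"
  shows "g x = h x"
proof -
  let ?E = "{x \<in> S. g x = h x}"
  have "openin (top_of_set S) ?E"
  proof (subst openin_subopen, intro ballI)
    fix x assume x: "x \<in> ?E"
    then obtain r where r: "r > 0" "inj_on F (ball (g x) r)" using inj by blast
    let ?N = "(S \<inter> g -` ball (g x) r) \<inter> (S \<inter> h -` ball (g x) r)"
    have "openin (top_of_set S) ?N"
      by (intro openin_Int continuous_openin_preimage_gen g h open_ball)
    moreover have "x \<in> ?N" using x r by auto
    moreover have "?N \<subseteq> ?E" using r eq by (auto dest: inj_onD)
    ultimately show "\<exists>T. openin (top_of_set S) T \<and> x \<in> T \<and> T \<subseteq> ?E" by blast
  qed
  moreover have "closedin (top_of_set S) ?E"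
  proof -
    have "?E = S \<inter> (\<lambda>x. dist (g x) (h x)) -` {0}" by auto
    then show ?thesis
      by (simp only:) (intro continuous_closedin_preimage continuous_on_dist g h closed_singleton)
  qed
  moreover have "?E \<noteq> {}" using a by blast
  ultimately have "?E = S" using S unfolding connected_clopen by blast
  then show ?thesis using x by blast
qed

lemma continuous_on_glue:
  fixes \<phi> :: "'i \<Rightarrow> 'a::topological_space \<Rightarrow> 'b::topological_space"
  assumes op: "\<And>i. i \<in> I \<Longrightarrow> open (P i)"
    and cont: "\<And>i. i \<in> I \<Longrightarrow> continuous_on (P i) (\<phi> i)"
    and agree: "\<And>i j x. i \<in> I \<Longrightarrow> j \<in> I \<Longrightarrow> x \<in> P i \<Longrightarrow> x \<in> P j \<Longrightarrow> \<phi> i x = \<phi> j x"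
  obtains G where "continuous_on (\<Union>i\<in>I. P i) G" "\<And>i x. i \<in> I \<Longrightarrow> x \<in> P i \<Longrightarrow> G x = \<phi> i x"
proof -
  define G where "G x = \<phi> (SOME i. i \<in> I \<and> x \<in> P i) x" for x
  have G: "G x = \<phi> i x" if "i \<in> I" "x \<in> P i" for i x
  proof -
    have "\<exists>i. i \<in> I \<and> x \<in> P i" using that by blast
    from someI_ex[OF this] show ?thesis unfolding G_def using agree that by blast
  qed
  have "continuous_on (P i) G" if i: "i \<in> I" for i
    using cont[OF i] by (rule continuous_on_eq) (rule G[OF i, symmetric])
  then have "continuous_on (\<Union>i\<in>I. P i) G"
    using op by (intro continuous_on_open_UN)
  then show thesis using that G by blast
qed

text \<open>A right inverse of \<open>F\<close> over a small disc about 0 is continued to larger discs.  The hypothesis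
\<open>accumulate\<close> is the only obstruction: the lift of a radius over the current disc must have an
accumulation point in \<open>V\<close> as the radius ends.  Near that point \<open>F\<close> has a local inverse, which agrees
with the right inverse constructed so far.  Compactness of the circle then yields a right inverse
over a larger disc, so the supremum of the possible radii is 1.\<close>

lemma section_over_disc:
  fixes F :: "complex \<Rightarrow> complex"
  assumes V: "open V" and F: "F holomorphic_on V" and nz: "\<And>z. z \<in> V \<Longrightarrow> deriv F z \<noteq> 0"
    and z0: "z0 \<in> V" "F z0 = 0"
    and accumulate: "\<And>c w. norm w < 1 \<Longrightarrow> continuous_on {0..<1::real} c \<Longrightarrow> c ` {0..<1} \<subseteq> V
      \<Longrightarrow> (\<And>t. t \<in> {0..<1} \<Longrightarrow> F (c t) = t *\<^sub>R w)
      \<Longrightarrow> \<exists>z\<in>V. F z = w \<and> (\<exists>t. range t \<subseteq> {0..<1} \<and> t \<longlonglongrightarrow> 1 \<and> (\<lambda>n. c (t n)) \<longlonglongrightarrow> z)"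
  obtains G where "continuous_on (ball 0 1) G" "G ` ball 0 1 \<subseteq> V"
    "\<And>w. w \<in> ball 0 1 \<Longrightarrow> F (G w) = w" "G 0 = z0"
proof -
  define Sec where "Sec s G \<longleftrightarrow> continuous_on (ball 0 s) G \<and> G ` ball 0 s \<subseteq> V
     \<and> (\<forall>w\<in>ball 0 s. F (G w) = w) \<and> G 0 = z0" for s :: real and G :: "complex \<Rightarrow> complex"
  have local: "\<exists>N e H. open N \<and> z \<in> N \<and> N \<subseteq> V \<and> 0 < e \<and> continuous_on (ball (F z) e) H \<and>
      H ` ball (F z) e \<subseteq> N \<and> (\<forall>w\<in>ball (F z) e. F (H w) = w) \<and> (\<forall>y\<in>N. H (F y) = y)" if z: "z \<in> V" for z
  proof -
    obtain r where r: "r > 0" "ball z r \<subseteq> V" "open (F ` ball z r)" "inj_on F (ball z r)"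
      using has_complex_derivative_locally_invertible[OF F z V nz[OF z]] by blast
    have hol: "F holomorphic_on ball z r" using F r(2) holomorphic_on_subset by blast
    obtain H where H: "H holomorphic_on F ` ball z r" "\<And>y. y \<in> ball z r \<Longrightarrow> H (F y) = y"
      using holomorphic_has_inverse[OF hol open_ball r(4)] by metis
    have "F z \<in> F ` ball z r" using r(1) by simp
    then obtain e where e: "e > 0" "ball (F z) e \<subseteq> F ` ball z r"
      using r(3) open_contains_ball by metis
    have "continuous_on (ball (F z) e) H"
      using H(1) e(2) holomorphic_on_imp_continuous_on continuous_on_subset by blast
    moreover have "H w \<in> ball z r \<and> F (H w) = w" if "w \<in> ball (F z) e" for w
      using that e(2) H(2) by force
    ultimately show ?thesis
      using r e H(2) by (intro exI[of _ "ball z r"] exI[of _ e] exI[of _ H]) auto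
  qed
  have inj: "\<exists>r>0. inj_on F (ball z r)" if "z \<in> V" for z
    using has_complex_derivative_locally_invertible[OF F that V nz[OF that]] by metis
  have unique: "G w = G' w" if "Sec s G" "Sec s' G'" "w \<in> ball 0 s" "w \<in> ball 0 s'" for s s' G G' w
  proof (rule lifts_agree[where F = F and g = G and h = G' and S = "ball 0 s \<inter> ball 0 s'" and a = 0])
    show "connected (ball 0 s \<inter> ball 0 s' :: complex set)"
      by (intro convex_connected convex_Int convex_ball)
    show "\<exists>r>0. inj_on F (ball (G x) r)" if "x \<in> ball 0 s \<inter> ball 0 s'" for x
      using \<open>Sec s G\<close> that by (intro inj) (auto simp: Sec_def)
    have "norm w < s" "norm w < s'" using that by auto
    then have "0 < s" "0 < s'" using norm_ge_zero[of w] by linarith+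
    then show "0 \<in> ball 0 s \<inter> ball (0::complex) s'" by auto
  qed (use that in \<open>auto simp: Sec_def intro: continuous_on_subset\<close>)
  define T where "T = {s. 0 < s \<and> s \<le> 1 \<and> (\<exists>G. Sec s G)}"
  define m where "m = Sup T"
  have T_bdd: "bdd_above T" by (auto simp: T_def intro: bdd_aboveI[of _ 1])
  obtain s0 where s0: "s0 \<in> T"
  proof -
    obtain N e H where *: "open N" "z0 \<in> N" "N \<subseteq> V" "0 < e" "continuous_on (ball 0 e) H"
      "H ` ball 0 e \<subseteq> N" "\<And>w. w \<in> ball 0 e \<Longrightarrow> F (H w) = w" "\<And>y. y \<in> N \<Longrightarrow> H (F y) = y"
      using local[OF z0(1)] unfolding z0(2) by metis
    have "H 0 = z0" using *(8)[OF *(2)] z0(2) by simp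
    then have "Sec (min e 1) H"
      using * by (fastforce simp: Sec_def intro: continuous_on_subset)
    then show thesis using that[of "min e 1"] *(4) by (auto simp: T_def)
  qed
  have m0: "0 < m" "m \<le> 1"
  proof -
    show "0 < m" using s0 cSup_upper[OF s0 T_bdd] by (simp add: m_def T_def)
    show "m \<le> 1" unfolding m_def using s0 by (intro cSup_least) (auto simp: T_def)
  qed
  obtain G where G: "Sec m G"
  proof -
    define \<phi> where "\<phi> s = (SOME G. Sec s G)" for s
    have \<phi>: "Sec s (\<phi> s)" if "s \<in> T" for s
      using that someI_ex[of "Sec s"] unfolding T_def \<phi>_def by blast
    have \<phi>_cont: "continuous_on (ball 0 s) (\<phi> s)" if "s \<in> T" for s
      using \<phi>[OF that] by (simp add: Sec_def)
    obtain G where G: "continuous_on (\<Union>s\<in>T. ball 0 s) G" "\<And>s x. s \<in> T \<Longrightarrow> x \<in> ball 0 s \<Longrightarrow> G x = \<phi> s x"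
      by (rule continuous_on_glue[of T "\<lambda>s. ball (0::complex) s" \<phi>])
         (use \<phi>_cont unique[OF \<phi> \<phi>] in blast)+
    have "(\<Union>s\<in>T. ball 0 s) = ball (0::complex) m"
    proof (intro set_eqI iffI)
      fix w :: complex assume "w \<in> (\<Union>s\<in>T. ball 0 s)"
      then obtain s where s: "s \<in> T" "norm w < s" by auto
      then show "w \<in> ball 0 m" using cSup_upper[OF s(1) T_bdd] by (simp add: m_def)
    next
      fix w :: complex assume "w \<in> ball 0 m"
      then have "norm w < Sup T" by (simp add: m_def)
      then obtain s where "s \<in> T" "norm w < s" using less_cSup_iff[OF _ T_bdd] s0 by blast
      then show "w \<in> (\<Union>s\<in>T. ball 0 s)" by auto
    qed
    moreover have "G w \<in> V \<and> F (G w) = w" if "w \<in> (\<Union>s\<in>T. ball 0 s)" for w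
      using that \<phi> G(2) by (fastforce simp: Sec_def)
    moreover have "G 0 = z0" using G(2)[OF s0, of 0] \<phi>[OF s0] s0 by (simp add: Sec_def T_def)
    ultimately have "Sec m G" using G(1) by (auto simp: Sec_def)
    then show thesis by (rule that)
  qed
  have "m = 1"
  proof (rule ccontr)
    assume "m \<noteq> 1"
    then have m1: "m < 1" using m0 by simp
    have Gc: "continuous_on (ball 0 m) G" "\<And>w. w \<in> ball 0 m \<Longrightarrow> G w \<in> V \<and> F (G w) = w" "G 0 = z0"
      using G by (auto simp: Sec_def)
    have ext: "\<exists>e H. 0 < e \<and> continuous_on (ball w e) H \<and> (\<forall>x\<in>ball w e. H x \<in> V \<and> F (H x) = x) \<and>
        (\<forall>x\<in>ball w e \<inter> ball 0 m. H x = G x)" if w: "norm w = m" for w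
    proof -
      let ?c = "\<lambda>t::real. G (t *\<^sub>R w)"
      have tw: "t *\<^sub>R w \<in> ball 0 m" if "t \<in> {0..<1}" for t
        using that w m0 by simp
      have "\<exists>z\<in>V. F z = w \<and> (\<exists>t. range t \<subseteq> {0..<1} \<and> t \<longlonglongrightarrow> 1 \<and> (\<lambda>n. ?c (t n)) \<longlonglongrightarrow> z)"
        by (rule accumulate) (use w m1 tw Gc in \<open>auto intro!: continuous_intros continuous_on_compose2[OF Gc(1)]\<close>)
      then obtain z t where z: "z \<in> V" "F z = w" and t: "range t \<subseteq> {0..<1}" "t \<longlonglongrightarrow> (1::real)" "(\<lambda>n. ?c (t n)) \<longlonglongrightarrow> z"
        by blast
      obtain N e H where *: "open N" "z \<in> N" "N \<subseteq> V" "0 < e" "continuous_on (ball w e) H"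
        "H ` ball w e \<subseteq> N" "\<And>x. x \<in> ball w e \<Longrightarrow> F (H x) = x" "\<And>y. y \<in> N \<Longrightarrow> H (F y) = y"
        using local[OF z(1)] unfolding z(2) by metis
      have "eventually (\<lambda>n. ?c (t n) \<in> N) sequentially"
        using t(3) *(1,2) by (rule topological_tendstoD)
      moreover have "(\<lambda>n. t n *\<^sub>R w) \<longlonglongrightarrow> 1 *\<^sub>R w" by (intro tendsto_intros t(2))
      then have "eventually (\<lambda>n. t n *\<^sub>R w \<in> ball w e) sequentially"
        using *(4) by (intro topological_tendstoD[where S = "ball w e"]) auto
      ultimately have "eventually (\<lambda>n. ?c (t n) \<in> N \<and> t n *\<^sub>R w \<in> ball w e) sequentially"
        by eventually_elim auto
      then obtain n where n: "?c (t n) \<in> N" "t n *\<^sub>R w \<in> ball w e"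
        by (auto simp: eventually_sequentially)
      have tn: "t n *\<^sub>R w \<in> ball 0 m" using t(1) by (intro tw) blast
      have eqn: "H (t n *\<^sub>R w) = G (t n *\<^sub>R w)"
        using *(8)[OF n(1)] Gc(2)[OF tn] by simp
      have "H x = G x" if "x \<in> ball w e \<inter> ball 0 m" for x
      proof (rule lifts_agree[where F = F and g = H and h = G and S = "ball w e \<inter> ball 0 m" and a = "t n *\<^sub>R w"])
        show "connected (ball w e \<inter> ball 0 m)"
          by (intro convex_connected convex_Int convex_ball)
        show "\<exists>r>0. inj_on F (ball (H x) r)" if "x \<in> ball w e \<inter> ball 0 m" for x
          using *(3,6) that by (intro inj) blast
      qed (use * Gc n tn eqn that in \<open>auto intro: continuous_on_subset\<close>)
      then show ?thesis using * by (intro exI[of _ e] exI[of _ H]) auto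
    qed
    obtain e H where eH: "\<And>w. norm w = m \<Longrightarrow> 0 < e w \<and> continuous_on (ball w (e w)) (H w) \<and>
        (\<forall>x\<in>ball w (e w). H w x \<in> V \<and> F (H w x) = x) \<and> (\<forall>x\<in>ball w (e w) \<inter> ball 0 m. H w x = G x)"
      using ext by metis
    have HG: "H w x = G x" if "norm w = m" "x \<in> ball w (e w)" "x \<in> ball 0 m" for w x
      using eH[OF that(1)] that(2,3) by blast
    define I where "I = insert None (Some ` sphere (0::complex) m)"
    define P where "P i = (case i of None \<Rightarrow> ball 0 m | Some w \<Rightarrow> ball w (e w))" for i
    define \<phi> where "\<phi> i = (case i of None \<Rightarrow> G | Some w \<Rightarrow> H w)" for i
    have secP: "continuous_on (P i) (\<phi> i)" "\<And>x. x \<in> P i \<Longrightarrow> \<phi> i x \<in> V \<and> F (\<phi> i x) = x" if "i \<in> I" for i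
      using that eH Gc by (auto simp: I_def P_def \<phi>_def)
    \<comment> \<open>Two overlapping extension discs also overlap inside the current disc, because a chord of the
      circle runs inside it; this is what makes the local extensions compatible.\<close>
    have meet: "\<exists>y. y \<in> ball w (e w) \<and> y \<in> ball w' (e w') \<and> y \<in> ball 0 m"
      if w: "norm w = m" "norm w' = m" and x: "x \<in> ball w (e w)" "x \<in> ball w' (e w')" for w w' x
    proof (cases "w = w'")
      case True
      define d where "d = min (e w / 2) (m / 2)"
      have d: "0 < d" "d < e w" "d < m" using eH[OF w(1)] m0 by (auto simp: d_def)
      define y where "y = ((m - d) / m) *\<^sub>R w"
      have "norm y = m - d" using w d m0 by (simp add: y_def)
      moreover have "w - y = (d / m) *\<^sub>R w"
      proof -
        have "w - y = (1 - (m - d) / m) *\<^sub>R w" by (simp add: y_def scaleR_left_diff_distrib)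
        also have "1 - (m - d) / m = d / m" using m0 by (simp add: field_simps)
        finally show ?thesis .
      qed
      then have "dist w y = d" using w d m0 by (simp add: dist_norm)
      ultimately show ?thesis unfolding True[symmetric] using d by (intro exI[of _ y]) simp
    next
      case False
      let ?a = "e w" and ?b = "e w'"
      have ab: "0 < ?a" "0 < ?b" using eH w by auto
      have dd: "dist w w' < ?a + ?b" using x dist_triangle[of w w' x] by (simp add: dist_commute)
      define u where "u = ?a / (?a + ?b)"
      have u: "0 < u" "u < 1" using ab by (auto simp: u_def)
      define y where "y = (1 - u) *\<^sub>R w + u *\<^sub>R w'"
      have "y \<in> open_segment w w'" using u False by (auto simp: y_def in_segment)
      from dist_decreases_open_segment[OF this, of 0] have "norm y < m"
        using w by (simp add: dist_norm)
      moreover have "w - y = u *\<^sub>R (w - w')" "w' - y = (1 - u) *\<^sub>R (w' - w)"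
        by (simp_all add: y_def scaleR_left_diff_distrib scaleR_right_diff_distrib)
      then have "dist w y = u * dist w w'" "dist w' y = (1 - u) * dist w w'"
        using u by (simp_all add: dist_norm norm_minus_commute[of w' w])
      moreover have "u * dist w w' < u * (?a + ?b)" "(1 - u) * dist w w' < (1 - u) * (?a + ?b)"
        using u dd by auto
      moreover have "u * (?a + ?b) = ?a" "(1 - u) * (?a + ?b) = ?b"
        using ab by (simp_all add: u_def field_simps)
      ultimately show ?thesis by (intro exI[of _ y]) simp
    qed
    have agree: "\<phi> i x = \<phi> j x" if ij: "i \<in> I" "j \<in> I" "x \<in> P i" "x \<in> P j" for i j x
    proof (cases i)
      case None
      show ?thesis
      proof (cases j)
        case (Some w)
        then have "norm w = m" "x \<in> ball w (e w)" "x \<in> ball 0 m"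
          using ij None by (simp_all add: I_def P_def image_iff)
        then show ?thesis unfolding None Some by (simp add: \<phi>_def HG)
      qed (simp add: None)
    next
      case (Some w)
      note i = this
      show ?thesis
      proof (cases j)
        case None
        then have "norm w = m" "x \<in> ball w (e w)" "x \<in> ball 0 m"
          using ij i by (simp_all add: I_def P_def image_iff)
        then show ?thesis unfolding None i by (simp add: \<phi>_def HG)
      next
        case (Some w')
        have w: "norm w = m" "norm w' = m" "x \<in> ball w (e w)" "x \<in> ball w' (e w')"
          using ij i Some by (simp_all add: I_def P_def image_iff)
        obtain y where y: "y \<in> ball w (e w)" "y \<in> ball w' (e w')" "y \<in> ball 0 m"
          using meet[OF w] by blast
        have "H w x = H w' x"
        proof (rule lifts_agree[where F = F and g = "H w" and h = "H w'" and S = "ball w (e w) \<inter> ball w' (e w')" and a = y])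
          show "connected (ball w (e w) \<inter> ball w' (e w'))"
            by (intro convex_connected convex_Int convex_ball)
          show "\<exists>r>0. inj_on F (ball (H w x) r)" if "x \<in> ball w (e w) \<inter> ball w' (e w')" for x
            using eH[OF w(1)] that by (intro inj) blast
          show "continuous_on (ball w (e w) \<inter> ball w' (e w')) (H w)"
            using eH[OF w(1)] continuous_on_subset by blast
          show "continuous_on (ball w (e w) \<inter> ball w' (e w')) (H w')"
            using eH[OF w(2)] continuous_on_subset by blast
          show "F (H w x) = F (H w' x)" if "x \<in> ball w (e w) \<inter> ball w' (e w')" for x
            using eH[OF w(1)] eH[OF w(2)] that by simp
          show "H w y = H w' y" using HG[OF w(1)] HG[OF w(2)] y by simp
        qed (use y w in blast)+
        then show ?thesis by (simp add: \<phi>_def i Some)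
      qed
    qed
    have opP: "open (P i)" for i by (cases i) (simp_all add: P_def)
    obtain G' where G': "continuous_on (\<Union>i\<in>I. P i) G'" "\<And>i x. i \<in> I \<Longrightarrow> x \<in> P i \<Longrightarrow> G' x = \<phi> i x"
      by (rule continuous_on_glue[of I P \<phi>])
         (use opP secP(1) agree in blast)+
    have op: "open (\<Union>i\<in>I. P i)" by (intro open_UN ballI opP)
    have sub: "cball 0 m \<subseteq> (\<Union>i\<in>I. P i)"
    proof
      fix x :: complex assume x: "x \<in> cball 0 m"
      show "x \<in> (\<Union>i\<in>I. P i)"
      proof (cases "norm x = m")
        case True
        then have "Some x \<in> I" "x \<in> P (Some x)" using eH[OF True] by (simp_all add: I_def P_def image_iff)
        then show ?thesis by blast
      next
        case False
        then have "None \<in> I" "x \<in> P None" using x by (simp_all add: I_def P_def)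
        then show ?thesis by blast
      qed
    qed
    obtain d where d: "d > 0" "(\<Union>x\<in>cball 0 m. ball x d) \<subseteq> (\<Union>i\<in>I. P i)"
      using compact_subset_open_imp_ball_epsilon_subset[OF compact_cball op sub] by blast
    define s where "s = min 1 (m + d / 2)"
    have s: "m < s" "s \<le> 1" "s < m + d" using d(1) m1 by (auto simp: s_def)
    have ball_s: "ball 0 s \<subseteq> (\<Union>i\<in>I. P i)"
    proof
      fix x :: complex assume x: "x \<in> ball 0 s"
      show "x \<in> (\<Union>i\<in>I. P i)"
      proof (cases "norm x \<le> m")
        case True
        then show ?thesis using sub by auto
      next
        case False
        then have nx: "norm x > 0" using m0 by linarith
        define y where "y = (m / norm x) *\<^sub>R x"
        have "norm y = m" using nx m0 by (simp add: y_def)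
        moreover have "x - y = ((norm x - m) / norm x) *\<^sub>R x"
        proof -
          have "x - y = (1 - m / norm x) *\<^sub>R x" by (simp add: y_def scaleR_left_diff_distrib)
          also have "1 - m / norm x = (norm x - m) / norm x" using nx by (simp add: field_simps)
          finally show ?thesis .
        qed
        then have "norm (x - y) = norm x - m" using nx False by simp
        then have "dist y x < d" using x s by (simp add: dist_norm norm_minus_commute)
        moreover have "y \<in> cball 0 m" "x \<in> ball y d" using calculation by auto
        ultimately show ?thesis using d(2) by blast
      qed
    qed
    have "Sec s G'"
      unfolding Sec_def
    proof (intro conjI ballI image_subsetI)
      show "continuous_on (ball 0 s) G'" using G'(1) ball_s continuous_on_subset by blast
      fix x assume "x \<in> ball (0::complex) s"
      then obtain i where i: "i \<in> I" "x \<in> P i" using ball_s by blast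
      then show "G' x \<in> V" "F (G' x) = x" using G'(2)[OF i] secP(2)[OF i] by simp_all
    next
      have "None \<in> I" "0 \<in> P None" using m0 by (simp_all add: I_def P_def)
      then show "G' 0 = z0" using G'(2)[of None 0] Gc(3) by (simp add: \<phi>_def)
    qed
    then have "s \<in> T" using s m0 by (auto simp: T_def)
    then have "s \<le> m" unfolding m_def by (intro cSup_upper T_bdd)
    then show False using s by simp
  qed
  then show thesis using G by (intro that[of G]) (auto simp: Sec_def)
qed


section \<open>Components over the complement of the ray\<close>

text \<open>The standing situation, except for the invariant set: all singular values of the non-linear
entire map \<open>f\<close> lie on the ray \<open>R\<close>.\<close>

locale ray_map =
  fixes f :: "complex \<Rightarrow> complex" and R :: "complex set"
  assumes entire: "f holomorphic_on UNIV"
    and nonlinear: "\<not> (\<exists>a b. \<forall>z. f z = a * z + b)"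
    and ray: "rectifiable_ray R"
    and class_R: "singular_set f \<subseteq> R"
begin

definition U where "U = - R"
definition V where "V = deck_domain f R"

lemma in_V_iff: "z \<in> V \<longleftrightarrow> f z \<in> U"
  by (simp add: V_def U_def deck_domain_def)

lemma hol_f [holomorphic_intros]: "f holomorphic_on S"
  using entire holomorphic_on_subset by blast

lemma cont_f [continuous_intros]: "continuous_on S f"
  using hol_f holomorphic_on_imp_continuous_on by blast

lemma open_U: "open U"
  using closed_rectifiable_ray[OF ray] by (simp add: U_def open_Compl)

lemma open_V: "open V"
proof -
  have "V = f -` U" using in_V_iff by auto
  then show ?thesis using cont_f[of UNIV] open_U by (simp add: continuous_on_open_vimage)
qed

lemma deriv_nz: "deriv f z \<noteq> 0" if "z \<in> V"
  using class_R that by (auto simp: in_V_iff U_def singular_set_def critical_values_def)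

lemma negligible_R: "negligible R"
  using negligible_rectifiable_ray[OF ray] .

text \<open>Every branch of the inverse of \<open>f\<close> extends to all of \<open>U\<close>.  By the Riemann mapping theorem \<open>U\<close> may be
replaced by the unit disc.  If the lift of a radius tended to infinity, then the image of the end
of this radius would be an asymptotic value of \<open>f\<close> in \<open>U\<close>; so the lift accumulates at a point,
and this point lies in \<open>V\<close> and is not critical.\<close>

lemma section_exists:
  assumes z0: "z0 \<in> V"
  obtains g where "continuous_on U g" "g ` U \<subseteq> V" "\<And>x. x \<in> U \<Longrightarrow> f (g x) = x" "g (f z0) = z0"
proof -
  have "simply_connected U" using simply_connected_complement_ray[OF ray] by (simp add: U_def)
  moreover have "U \<noteq> {}" using z0 in_V_iff by auto
  moreover have "U \<noteq> UNIV" using ray unfolding U_def rectifiable_ray_def by auto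
  ultimately obtain p q where p: "p holomorphic_on U" "\<And>z. z \<in> U \<Longrightarrow> p z \<in> ball 0 1 \<and> q (p z) = z"
    and q: "q holomorphic_on ball 0 1" "\<And>z. z \<in> ball 0 1 \<Longrightarrow> q z \<in> U \<and> p (q z) = z"
    using simply_connected_eq_biholomorphic_to_disc[OF open_U] by blast
  have fz0: "f z0 \<in> U" using z0 in_V_iff by simp
  obtain a b where a: "a (p (f z0)) = 0" "a holomorphic_on ball 0 1" "a ` ball 0 1 \<subseteq> ball 0 1"
    and b: "b holomorphic_on ball 0 1" "b ` ball 0 1 \<subseteq> ball 0 1"
      "\<And>z. z \<in> ball 0 1 \<Longrightarrow> a (b z) = z" "\<And>z. z \<in> ball 0 1 \<Longrightarrow> b (a z) = z"
    using ball_biholomorphism_exists[of "p (f z0)"] p(2)[OF fz0] by metis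
  define \<psi> where "\<psi> = a \<circ> p"
  define \<xi> where "\<xi> = q \<circ> b"
  have a_ball: "a w \<in> ball 0 1" and b_ball: "b w \<in> ball 0 1" if "w \<in> ball 0 1" for w
    using a(3) b(2) that by blast+
  have \<psi>1: "\<psi> holomorphic_on U"
    unfolding \<psi>_def by (rule holomorphic_on_compose_gen[OF p(1) a(2)]) (use p(2) in blast)
  have \<psi>2: "\<psi> z \<in> ball 0 1 \<and> \<xi> (\<psi> z) = z" if "z \<in> U" for z
  proof -
    have "p z \<in> ball 0 1" "q (p z) = z" using p(2)[OF that] by blast+
    then show ?thesis using a_ball[of "p z"] b(4)[of "p z"] by (simp only: \<psi>_def \<xi>_def o_apply simp_thms)
  qed
  have \<psi>3: "\<psi> (f z0) = 0" using a(1) by (simp add: \<psi>_def)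
  note \<psi> = \<psi>1 \<psi>2 \<psi>3
  have \<xi>1: "continuous_on (ball 0 1) \<xi>"
    unfolding \<xi>_def
    by (intro holomorphic_on_imp_continuous_on holomorphic_on_compose_gen[OF b(1) q(1)]) (use b_ball in blast)
  have \<xi>2: "\<xi> z \<in> U \<and> \<psi> (\<xi> z) = z" if "z \<in> ball 0 1" for z
  proof -
    have "q (b z) \<in> U" "p (q (b z)) = b z" using q(2)[OF b_ball[OF that]] by blast+
    then show ?thesis using b(3)[OF that] by (simp only: \<psi>_def \<xi>_def o_apply simp_thms)
  qed
  note \<xi> = \<xi>1 \<xi>2
  have inj_\<psi>: "inj_on \<psi> U" using \<psi>2 by (intro inj_on_inverseI[where g = \<xi>]) blast
  let ?F = "\<psi> \<circ> f"
  have F: "?F holomorphic_on V"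
    by (rule holomorphic_on_compose_gen[OF hol_f \<psi>(1)]) (auto simp: in_V_iff)
  have dF: "deriv ?F z \<noteq> 0" if z: "z \<in> V" for z
  proof -
    have "f z \<in> U" using z by (simp add: in_V_iff)
    then have "deriv ?F z = deriv \<psi> (f z) * deriv f z"
      by (intro deriv_chain holomorphic_on_imp_differentiable_at[OF entire open_UNIV UNIV_I]
          holomorphic_on_imp_differentiable_at[OF \<psi>1 open_U])
    then show ?thesis
      using deriv_nz[OF z] holomorphic_injective_imp_regular[OF \<psi>(1) open_U inj_\<psi>] z by (simp add: in_V_iff)
  qed
  have acc: "\<exists>z\<in>V. ?F z = w \<and> (\<exists>t. range t \<subseteq> {0..<1} \<and> t \<longlonglongrightarrow> 1 \<and> (\<lambda>n. c (t n)) \<longlonglongrightarrow> z)"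
    if w: "norm w < 1" and c: "continuous_on {0..<1::real} c" "c ` {0..<1} \<subseteq> V"
      and lift: "\<And>t. t \<in> {0..<1} \<Longrightarrow> ?F (c t) = t *\<^sub>R w" for c w
  proof -
    have fc: "f (c t) = \<xi> (t *\<^sub>R w)" if "t \<in> {0..<1}" for t
    proof -
      have "c t \<in> V" using c(2) that by blast
      then have "\<xi> (\<psi> (f (c t))) = f (c t)" using \<psi>2 unfolding in_V_iff by blast
      then show ?thesis using lift[OF that] unfolding o_apply by simp
    qed
    have tw: "t *\<^sub>R w \<in> ball 0 1" if "t \<in> {0..1}" for t :: real
    proof -
      have "norm (t *\<^sub>R w) \<le> 1 * norm w" using that by (simp add: mult_left_le_one_le)
      then show ?thesis using w by simp
    qed
    have w1: "w \<in> ball 0 1" using w by simp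
    have cont_\<xi>: "continuous_on {0..1} (\<lambda>t::real. \<xi> (t *\<^sub>R w))"
    proof (rule continuous_on_compose2[OF \<xi>1])
      show "continuous_on {0..1} (\<lambda>t::real. t *\<^sub>R w)" by (intro continuous_intros)
      show "(\<lambda>t::real. t *\<^sub>R w) ` {0..1} \<subseteq> ball 0 1" using tw by (intro image_subsetI)
    qed
    have lim_seq: "(\<lambda>n. f (c (t n))) \<longlonglongrightarrow> \<xi> w" if t: "range t \<subseteq> {0..<1}" "t \<longlonglongrightarrow> 1" for t :: "nat \<Rightarrow> real"
    proof -
      have "(\<lambda>n. \<xi> (t n *\<^sub>R w)) \<longlonglongrightarrow> \<xi> (1 *\<^sub>R w)"
      proof (rule continuous_on_tendsto_compose[OF cont_\<xi> t(2)])
        show "\<forall>\<^sub>F n in sequentially. t n \<in> {0..1}"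
        proof (intro always_eventually allI)
          fix n have "t n \<in> {0..<1}" using t(1) by blast
          then show "t n \<in> {0..1}" by simp
        qed
      qed simp
      moreover have "f (c (t n)) = \<xi> (t n *\<^sub>R w)" for n
      proof -
        have "t n \<in> {0..<1}" using t(1) by blast
        then show ?thesis by (rule fc)
      qed
      ultimately show ?thesis by simp
    qed
    have "\<not> filterlim c at_infinity (at_left 1)"
    proof
      assume inf: "filterlim c at_infinity (at_left 1)"
      define r where "r s = c (s / (1 + s))" for s :: real
      have rng: "s / (1 + s) \<in> {0..<1}" if "s \<ge> 0" for s :: real using that by (simp add: field_simps)
      have "continuous_on {0..} r"
        unfolding r_def
      proof (rule continuous_on_compose2[OF c(1)])
        show "continuous_on {0..} (\<lambda>s::real. s / (1 + s))" by (intro continuous_intros) auto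
        show "(\<lambda>s::real. s / (1 + s)) ` {0..} \<subseteq> {0..<1}"
          using rng by (intro image_subsetI) simp
      qed
      moreover have s1: "filterlim (\<lambda>s::real. s / (1 + s)) (at_left 1) at_top"
        by real_asymp
      then have "filterlim r at_infinity at_top"
        unfolding r_def by (rule filterlim_compose[OF inf])
      moreover have "((\<lambda>s. f (r s)) \<longlongrightarrow> \<xi> w) at_top"
      proof (rule Lim_transform_eventually)
        have "((\<lambda>s::real. \<xi> ((s / (1 + s)) *\<^sub>R w)) \<longlongrightarrow> \<xi> (1 *\<^sub>R w)) at_top"
        proof (rule continuous_on_tendsto_compose[OF cont_\<xi>])
          show "((\<lambda>s::real. s / (1 + s)) \<longlongrightarrow> 1) at_top" by real_asymp
          show "\<forall>\<^sub>F s in at_top. s / (1 + s) \<in> {0..1::real}"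
            using eventually_ge_at_top[of 0] by eventually_elim simp
        qed simp
        then show "((\<lambda>s::real. \<xi> ((s / (1 + s)) *\<^sub>R w)) \<longlongrightarrow> \<xi> w) at_top" by simp
        show "\<forall>\<^sub>F s in at_top. \<xi> ((s / (1 + s)) *\<^sub>R w) = f (r s)"
          using eventually_ge_at_top[of 0] by eventually_elim (simp only: r_def fc[OF rng])
      qed
      ultimately have "\<xi> w \<in> asymptotic_values f" unfolding asymptotic_values_def by blast
      then have "\<xi> w \<in> R" using class_R unfolding singular_set_def by blast
      then show False using \<xi>(2)[OF w1] by (simp add: U_def)
    qed
    then obtain B where B: "B > 0" "\<not> (\<forall>\<^sub>F t in at_left 1. B \<le> norm (c t))"
      unfolding filterlim_at_infinity[OF order_refl] by blast
    \<comment> \<open>As the lift does not tend to infinity, it returns to a fixed disc at parameters close to 1.\<close>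
    have "\<exists>t. t \<in> {0..<1} \<and> 1 - 1 / Suc n < t \<and> norm (c t) \<le> B" for n
    proof (rule ccontr)
      assume no: "\<nexists>t. t \<in> {0..<1} \<and> 1 - 1 / Suc n < t \<and> norm (c t) \<le> B"
      have "\<forall>\<^sub>F t in at_left 1. t \<in> {max 0 (1 - 1 / Suc n)<..<1}"
        by (rule eventually_at_left_real) simp
      then have "\<forall>\<^sub>F t in at_left 1. B \<le> norm (c t)"
      proof eventually_elim
        case (elim t)
        then have "0 < t" "1 - 1 / Suc n < t" "t < 1"
          unfolding greaterThanLessThan_iff max_less_iff_conj by blast+
        then have "t \<in> {0..<1}" "1 - 1 / Suc n < t" by simp_all
        then show ?case using no by (meson linear)
      qed
      then show False using B by simp
    qed
    then obtain t where tt: "\<And>n. t n \<in> {0..<1} \<and> 1 - 1 / Suc n < t n \<and> norm (c (t n)) \<le> B"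
      by metis
    have t: "t n \<in> {0..<1}" "1 - 1 / Suc n < t n" "norm (c (t n)) \<le> B" for n
      using tt[of n] by blast+
    have t1: "t \<longlonglongrightarrow> 1"
    proof (rule tendsto_sandwich)
      show "(\<lambda>n. 1 - 1 / real (Suc n)) \<longlonglongrightarrow> 1" by real_asymp
      show "(\<lambda>n. 1) \<longlonglongrightarrow> (1::real)" by simp
      show "\<forall>\<^sub>F n in sequentially. 1 - 1 / real (Suc n) \<le> t n"
        using t(2) by (intro always_eventually allI less_imp_le)
      show "\<forall>\<^sub>F n in sequentially. t n \<le> 1"
        using t(1) by (intro always_eventually allI less_imp_le) simp
    qed
    have "\<forall>n. c (t n) \<in> cball 0 B" using t(3) by simp
    then obtain z s where s: "strict_mono (s::nat \<Rightarrow> nat)" and z': "((\<lambda>n. c (t n)) \<circ> s) \<longlonglongrightarrow> z"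
      using seq_compactE[of "cball 0 B" "\<lambda>n. c (t n)"] compact_cball[of "0::complex" B]
      unfolding compact_eq_seq_compact_metric by metis
    then have z: "(\<lambda>n. c (t (s n))) \<longlonglongrightarrow> z" by (simp add: o_def)
    have ts: "range (\<lambda>n. t (s n)) \<subseteq> {0..<1}" "(\<lambda>n. t (s n)) \<longlonglongrightarrow> 1"
      using t(1) LIMSEQ_subseq_LIMSEQ[OF t1 s] unfolding o_def by blast+
    have "(\<lambda>n. f (c (t (s n)))) \<longlonglongrightarrow> f z"
      by (rule continuous_on_tendsto_compose[OF cont_f[of UNIV] z]) auto
    then have "f z = \<xi> w" using lim_seq[OF ts] LIMSEQ_unique by blast
    then have "z \<in> V" "?F z = w" using \<xi>(2)[OF w1] by (simp_all add: in_V_iff)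
    then show ?thesis using ts z by blast
  qed
  obtain G where G: "continuous_on (ball 0 1) G" "G ` ball 0 1 \<subseteq> V"
    "\<And>w. w \<in> ball 0 1 \<Longrightarrow> ?F (G w) = w" "G 0 = z0"
  proof -
    assume G_thesis: "\<And>G. continuous_on (ball 0 1) G \<Longrightarrow> G ` ball 0 1 \<subseteq> V \<Longrightarrow>
      (\<And>w. w \<in> ball 0 1 \<Longrightarrow> ?F (G w) = w) \<Longrightarrow> G 0 = z0 \<Longrightarrow> thesis"
    show thesis
    proof (rule section_over_disc[OF open_V F dF z0])
      show "?F z0 = 0" using \<psi>3 by simp
      show "\<exists>z\<in>V. ?F z = w \<and> (\<exists>t. range t \<subseteq> {0..<1} \<and> t \<longlonglongrightarrow> 1 \<and> (\<lambda>n. c (t n)) \<longlonglongrightarrow> z)"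
        if "norm w < 1" "continuous_on {0..<1::real} c" "c ` {0..<1} \<subseteq> V"
          "\<And>t. t \<in> {0..<1} \<Longrightarrow> ?F (c t) = t *\<^sub>R w" for c w
        by (rule acc[OF that])
      show thesis if "continuous_on (ball 0 1) G" "G ` ball 0 1 \<subseteq> V"
        "\<And>w. w \<in> ball 0 1 \<Longrightarrow> ?F (G w) = w" "G 0 = z0" for G
        by (rule G_thesis[OF that])
    qed
  qed
  show thesis
  proof
    show "continuous_on U (\<lambda>x. G (\<psi> x))"
      by (rule continuous_on_compose2[OF G(1) holomorphic_on_imp_continuous_on[OF \<psi>(1)]]) (use \<psi>(2) in auto)
    show "(\<lambda>x. G (\<psi> x)) ` U \<subseteq> V" using G(2) \<psi>(2) by auto
    show "G (\<psi> (f z0)) = z0" using \<psi>(3) G(4) by simp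
    show "f (G (\<psi> x)) = x" if x: "x \<in> U" for x
    proof -
      have "G (\<psi> x) \<in> V" using G(2) \<psi>(2)[OF x] by blast
      then have "\<xi> (\<psi> (f (G (\<psi> x)))) = f (G (\<psi> x))" using \<psi>(2) by (simp add: in_V_iff)
      then show ?thesis using G(3)[of "\<psi> x"] \<psi>(2)[OF x] by simp
    qed
  qed
qed

text \<open>The image of \<open>U\<close> under a branch of the inverse of \<open>f\<close> is a connected subset of \<open>V\<close>, and uniqueness of
lifts shows that it exhausts a component.\<close>

lemma bij_betw_component:
  assumes W: "W \<in> components V"
  shows "bij_betw f W U"
proof -
  obtain z0 where z0: "z0 \<in> V" "W = connected_component_set V z0"
    using W by (auto simp: components_def)
  obtain g where g: "continuous_on U g" "g ` U \<subseteq> V" "\<And>x. x \<in> U \<Longrightarrow> f (g x) = x" "g (f z0) = z0"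
    using section_exists[OF z0(1)] by blast
  have fz0: "f z0 \<in> U" using z0 in_V_iff by simp
  have sub: "g ` U \<subseteq> W"
    unfolding z0(2)
  proof (rule connected_component_maximal)
    show "z0 \<in> g ` U" using g(4) fz0 by (metis image_eqI)
    show "connected (g ` U)"
      using simply_connected_complement_ray[OF ray] g(1)
      by (intro connected_continuous_image) (auto simp: U_def simply_connected_imp_connected)
  qed (use g in auto)
  have eq: "g ` U = {z \<in> V. g (f z) = z}"
    using g in_V_iff by (auto simp: image_iff) (metis)
  have fW: "f ` W \<subseteq> U" using in_components_subset[OF W] in_V_iff by auto
  have "z = g (f z)" if z: "z \<in> W" for z
  proof (rule lifts_agree[where F = f and g = "\<lambda>z. z" and h = "\<lambda>z. g (f z)" and S = W and a = z0])
    show "connected W" using W in_components_connected by blast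
    show "continuous_on W (\<lambda>z. g (f z))"
      by (rule continuous_on_compose2[OF g(1) cont_f fW])
    show "\<exists>r>0. inj_on f (ball x r)" if "x \<in> W" for x
      using has_complex_derivative_locally_injective[OF entire UNIV_I open_UNIV deriv_nz] that
        in_components_subset[OF W] by (metis subsetD)
    show "z0 \<in> W" using z0 by simp
  qed (use g fW z in \<open>auto intro: continuous_on_id\<close>)
  then show ?thesis
    using g(3) sub fW by (intro bij_betwI[where g = g]) auto
qed

end


section \<open>Deck transformations\<close>

context ray_map
begin

text \<open>Off the countable set of critical points, \<open>f\<close> has differentiable local inverses, and these map null
sets to null sets.\<close>

lemma negligible_vimage_f:
  assumes N: "negligible N"
  shows "negligible (f -` N)"
proof -
  define Z where "Z = {z \<in> UNIV. deriv f z = 0}"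
  have "countable Z"
    unfolding Z_def
  proof (rule holomorphic_countable_zeros)
    show "deriv f holomorphic_on UNIV" using entire by (intro holomorphic_deriv) auto
    show "\<not> deriv f constant_on UNIV"
    proof
      assume "deriv f constant_on UNIV"
      then obtain c where c: "\<And>z. deriv f z = c" by (auto simp: constant_on_def)
      have "((\<lambda>z. f z - c * z) has_field_derivative 0) (at z)" for z
      proof -
        have "(f has_field_derivative c) (at z)"
          using holomorphic_derivI[OF entire open_UNIV UNIV_I, of z] unfolding c .
        then have "((\<lambda>z. f z - c * z) has_field_derivative (c - c * 1)) (at z)"
          by (intro DERIV_diff DERIV_cmult DERIV_ident)
        then show ?thesis by simp
      qed
      then have "\<exists>d. \<forall>z\<in>UNIV. f z - c * z = d"
        by (intro has_field_derivative_zero_constant convex_UNIV) simp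
      then obtain d where "\<And>z. f z - c * z = d" by blast
      then have "f z = c * z + d" for z by (metis diff_eq_eq add.commute)
      then show False using nonlinear by blast
    qed
  qed auto
  then have Z: "negligible Z"
    by (simp add: negligible_iff_null_sets null_sets_completionI countable_imp_null_set_lborel)
  have "negligible (f -` N - Z)"
  proof (rule locally_negligible_alt[THEN iffD2], rule ballI)
    fix z assume z: "z \<in> f -` N - Z"
    then have "deriv f z \<noteq> 0" by (simp add: Z_def)
    then obtain r where r: "r > 0" "open (f ` ball z r)" "inj_on f (ball z r)"
      using has_complex_derivative_locally_invertible[OF entire UNIV_I open_UNIV] by metis
    obtain g where g: "g holomorphic_on f ` ball z r" "\<And>y. y \<in> ball z r \<Longrightarrow> g (f y) = y"
      using holomorphic_has_inverse[OF hol_f open_ball r(3)] by metis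
    have "negligible (g ` (f ` ball z r \<inter> N))"
    proof (rule negligible_differentiable_image_negligible[OF order_refl])
      show "negligible (f ` ball z r \<inter> N)" using N by (rule negligible_subset) auto
      show "g differentiable_on f ` ball z r \<inter> N"
        by (rule differentiable_on_subset[OF holomorphic_on_imp_differentiable_on[OF g(1)] inf_le1])
    qed
    then have "negligible ((f -` N - Z) \<inter> ball z r)"
    proof (rule negligible_subset)
      show "(f -` N - Z) \<inter> ball z r \<subseteq> g ` (f ` ball z r \<inter> N)"
      proof
        fix y assume y: "y \<in> (f -` N - Z) \<inter> ball z r"
        then have "y \<in> ball z r" "f y \<in> N" by blast+
        then have "y = g (f y)" "f y \<in> f ` ball z r \<inter> N" using g(2)[of y] by simp_all
        then show "y \<in> g ` (f ` ball z r \<inter> N)" by (rule image_eqI)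
      qed
    qed
    moreover have "openin (top_of_set (f -` N - Z)) ((f -` N - Z) \<inter> ball z r)"
      by (simp add: openin_open_Int)
    ultimately show "\<exists>T. openin (top_of_set (f -` N - Z)) T \<and> z \<in> T \<and> negligible T"
      using z r(1) by (intro exI[of _ "(f -` N - Z) \<inter> ball z r"] conjI) simp_all
  qed
  then have "negligible ((f -` N - Z) \<union> Z)" using Z by (rule negligible_Un)
  then show ?thesis by (rule negligible_subset) auto
qed

lemma negligible_compl_V: "negligible (- V)"
proof -
  have "- V = f -` R" by (auto simp: in_V_iff U_def)
  then show ?thesis using negligible_vimage_f[OF negligible_R] by simp
qed

lemma V_nonempty: "V \<noteq> {}"
proof
  assume "V = {}"
  then have "negligible (UNIV :: complex set)" using negligible_compl_V by simp
  then show False by simp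
qed

lemma f_surj_U: "U \<subseteq> range f"
proof -
  obtain z where "z \<in> V" using V_nonempty by blast
  then obtain g where "\<And>x. x \<in> U \<Longrightarrow> f (g x) = x" using section_exists by metis
  then show ?thesis by (intro subsetI) (metis rangeI)
qed

lemma f_measurable: "f \<in> lebesgue \<rightarrow>\<^sub>M lebesgue"
  by (rule measurable_lebesgue_nonsingular[OF borel_measurable_continuous_onI[OF cont_f] negligible_vimage_f])

text \<open>The properties shared by all elements of the group \<open>FD f R\<close>.  Such a map may jump across the
boundary of \<open>V\<close>, but it is a piecewise conformal bijection, and \<open>f \<circ> \<gamma> = f\<close> holds
everywhere, not only almost everywhere.\<close>

definition deck :: "(complex \<Rightarrow> complex) \<Rightarrow> bool" where
  "deck \<gamma> \<longleftrightarrow> bij \<gamma> \<and> (\<forall>z. f (\<gamma> z) = f z) \<and> (\<forall>z. z \<notin> V \<longrightarrow> \<gamma> z = z) \<and> \<gamma> holomorphic_on V"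

lemma deck_in_V: "deck \<gamma> \<Longrightarrow> \<gamma> z \<in> V \<longleftrightarrow> z \<in> V"
  by (simp add: deck_def in_V_iff)

lemma deck_image_V:
  assumes g: "deck \<gamma>"
  shows "\<gamma> ` V = V"
proof (intro subset_antisym subsetI)
  fix z assume z: "z \<in> V"
  have "\<gamma> (inv \<gamma> z) = z" using g by (simp add: deck_def bij_is_surj surj_f_inv_f)
  moreover from this have "inv \<gamma> z \<in> V" using deck_in_V[OF g, of "inv \<gamma> z"] z by simp
  ultimately show "z \<in> \<gamma> ` V" by (metis image_eqI)
qed (use deck_in_V[OF g] in blast)

lemma deck_id: "deck id" by (simp add: deck_def)

lemma deck_comp:
  assumes g: "deck g" and h: "deck h"
  shows "deck (g \<circ> h)"
  unfolding deck_def
proof (intro conjI allI impI)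
  show "bij (g \<circ> h)" using g h by (simp add: deck_def bij_comp)
  show "f ((g \<circ> h) z) = f z" for z using g h by (simp add: deck_def)
  show "(g \<circ> h) z = z" if "z \<notin> V" for z using g h that by (simp add: deck_def)
  show "(g \<circ> h) holomorphic_on V"
    by (rule holomorphic_on_compose_gen[where t = V]) (use g h deck_image_V[OF h] in \<open>simp_all add: deck_def\<close>)
qed

lemma deck_inv:
  assumes g: "deck g"
  shows "deck (inv g)"
proof -
  have b: "bij g" using g by (simp add: deck_def)
  have gi: "g (inv g z) = z" "inv g (g z) = z" for z
    using b by (simp_all add: bij_is_surj surj_f_inv_f bij_is_inj)
  have "inv g holomorphic_on V"
  proof -
    obtain k where k: "k holomorphic_on g ` V" "\<And>z. z \<in> V \<Longrightarrow> k (g z) = z"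
      using holomorphic_has_inverse[of g V] g open_V b
      by (metis bij_is_inj deck_def inj_on_subset subset_UNIV)
    have "k z = inv g z" if "z \<in> V" for z
      using k(2)[of "inv g z"] gi deck_in_V[OF g, of "inv g z"] that by simp
    then show ?thesis using k(1) unfolding deck_image_V[OF g] by (simp cong: holomorphic_cong)
  qed
  moreover have "f (inv g z) = f z" for z using g gi by (metis deck_def)
  moreover have "inv g z = z" if "z \<notin> V" for z using g gi that by (metis deck_def)
  ultimately show ?thesis using b by (simp add: deck_def bij_imp_bij_inv)
qed

text \<open>On a component \<open>W\<close> the map is \<open>f\<close> followed by the inverse of \<open>f\<close> on the component \<open>b W\<close>, both being
conformal bijections onto \<open>U\<close>.\<close>

lemma deck_deck_map:
  assumes b: "bij_betw b (components V) (components V)"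
  shows "deck (deck_map f R b)"
proof -
  let ?\<gamma> = "deck_map f R b" and ?C = "connected_component_set V"
  have comp: "?C z \<in> components V" if "z \<in> V" for z using that by (auto simp: components_def)
  have bcomp: "b (?C z) \<in> components V" if "z \<in> V" for z
    using comp[OF that] b by (auto simp: bij_betw_def)
  have bb: "bij_betw f W U" if "W \<in> components V" for W using bij_betw_component[OF that] .
  have on: "?\<gamma> z = inv_into (b (?C z)) f (f z)" if "z \<in> V" for z
    using that by (simp add: deck_map_def V_def)
  have off: "?\<gamma> z = z" if "z \<notin> V" for z
    using that by (simp add: deck_map_def V_def)
  have \<gamma>: "?\<gamma> z \<in> b (?C z)" "f (?\<gamma> z) = f z" if "z \<in> V" for z
  proof -
    have "f z \<in> f ` b (?C z)" using bb[OF bcomp[OF that]] that by (simp add: bij_betw_def in_V_iff)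
    then show "?\<gamma> z \<in> b (?C z)" "f (?\<gamma> z) = f z"
      unfolding on[OF that] by (rule inv_into_into, rule f_inv_into_f)
  qed
  have f\<gamma>: "f (?\<gamma> z) = f z" for z using \<gamma>(2) off by (cases "z \<in> V") auto
  have inV: "?\<gamma> z \<in> V \<longleftrightarrow> z \<in> V" for z by (simp add: in_V_iff f\<gamma>)
  have "inj ?\<gamma>"
  proof (rule injI)
    fix z z' assume eq: "?\<gamma> z = ?\<gamma> z'"
    show "z = z'"
    proof (cases "z \<in> V")
      case True
      then have V': "z' \<in> V" using eq inV by metis
      have "b (?C z) = b (?C z')"
        using \<gamma>(1)[OF True] \<gamma>(1)[OF V'] eq bcomp[OF True] bcomp[OF V'] components_nonoverlap by (metis disjoint_iff)
      then have "?C z = ?C z'"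
        using b comp[OF True] comp[OF V'] by (metis bij_betw_inv_into_left)
      moreover have "z \<in> ?C z" "z' \<in> ?C z'" using True V' by auto
      moreover have "f z = f z'" using eq f\<gamma> by metis
      ultimately show ?thesis using bb[OF comp[OF True]] by (metis bij_betw_def inj_onD)
    next
      case False
      then show ?thesis using eq inV off by metis
    qed
  qed
  moreover have "surj ?\<gamma>"
    unfolding surj_def
  proof
    fix y
    show "\<exists>z. y = ?\<gamma> z"
    proof (cases "y \<in> V")
      case True
      obtain W where W: "W \<in> components V" "b W = ?C y"
        using b comp[OF True] by (metis bij_betw_def imageE)
      have "f y \<in> f ` W" using bb[OF W(1)] True by (simp add: bij_betw_def in_V_iff)
      then obtain z where z: "z \<in> W" "f z = f y" by auto
      have zV: "z \<in> V" using z(1) in_components_subset[OF W(1)] by auto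
      have "?C z = W" using W(1) z(1) by (metis components_iff connected_component_eq)
      then have "?\<gamma> z = inv_into (?C y) f (f y)" using on[OF zV] W(2) z(2) by simp
      also have "\<dots> = y"
        using bb[OF comp[OF True]] True by (intro inv_into_f_f) (auto simp: bij_betw_def)
      finally show ?thesis by (intro exI[of _ z]) simp
    next
      case False
      then show ?thesis by (intro exI[of _ y]) (simp add: off)
    qed
  qed
  moreover have "?\<gamma> holomorphic_on V"
  proof -
    have "?\<gamma> holomorphic_on (\<Union>W\<in>components V. W)"
    proof (rule holomorphic_on_UN_open)
      fix W assume W: "W \<in> components V"
      show opW: "open W" using open_components[OF open_V W] .
      have bW: "b W \<in> components V" using b W by (auto simp: bij_betw_def)
      have injbW: "inj_on f (b W)" "f ` b W = U" "f ` W = U"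
        using bb[OF bW] bb[OF W] by (auto simp: bij_betw_def)
      obtain k where k: "k holomorphic_on f ` b W" "\<And>y. y \<in> b W \<Longrightarrow> k (f y) = y"
        using holomorphic_has_inverse[OF hol_f open_components[OF open_V bW] injbW(1)] by metis
      have "k (f z) = ?\<gamma> z" if z: "z \<in> W" for z
      proof -
        have zV: "z \<in> V" using z in_components_subset[OF W] by auto
        have "?C z = W" using W z by (metis components_iff connected_component_eq)
        then show ?thesis using k(2)[of "?\<gamma> z"] \<gamma>[OF zV] by simp
      qed
      moreover have "(k \<circ> f) holomorphic_on W"
        using injbW by (intro holomorphic_on_compose hol_f) (simp add: k(1)[unfolded injbW(2)])
      ultimately show "?\<gamma> holomorphic_on W" by (simp add: o_def cong: holomorphic_cong)
    qed
    then show ?thesis by (simp add: Union_components[symmetric])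
  qed
  ultimately show ?thesis using f\<gamma> off by (simp add: deck_def bij_def)
qed

lemma FD_deck: "\<gamma> \<in> FD f R \<Longrightarrow> deck \<gamma>"
proof (induction rule: FD.induct)
  case (generator b)
  then show ?case using deck_deck_map by (simp add: V_def)
next
  case identity
  show ?case by (rule deck_id)
next
  case (compose g h)
  then show ?case by (intro deck_comp)
next
  case (inverse g)
  then show ?case by (intro deck_inv)
qed

lemma negligible_vimage_deck:
  assumes g: "deck \<gamma>" and N: "negligible N"
  shows "negligible (\<gamma> -` N)"
proof -
  have inv: "deck (inv \<gamma>)" by (rule deck_inv[OF g])
  have "negligible (inv \<gamma> ` (N \<inter> V))"
  proof (rule negligible_differentiable_image_negligible[OF order_refl])
    show "negligible (N \<inter> V)" using N by (rule negligible_subset) auto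
    show "inv \<gamma> differentiable_on N \<inter> V"
      using inv unfolding deck_def
      by (intro differentiable_on_subset[OF holomorphic_on_imp_differentiable_on inf_le2]) simp
  qed
  moreover have "\<gamma> -` N \<subseteq> inv \<gamma> ` (N \<inter> V) \<union> - V"
  proof
    fix z assume z: "z \<in> \<gamma> -` N"
    have "inv \<gamma> (\<gamma> z) = z" using g by (simp add: deck_def bij_is_inj)
    then show "z \<in> inv \<gamma> ` (N \<inter> V) \<union> - V"
      using z deck_in_V[OF g, of z] by (metis Compl_iff IntI UnCI image_eqI vimageD)
  qed
  ultimately show ?thesis
    using negligible_compl_V by (meson negligible_Un negligible_subset)
qed

lemma deck_measurable: "deck \<gamma> \<Longrightarrow> \<gamma> \<in> lebesgue \<rightarrow>\<^sub>M lebesgue"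
proof (rule measurable_lebesgue_nonsingular)
  assume g: "deck \<gamma>"
  have "(\<lambda>z. if z \<in> V then \<gamma> z else z) \<in> borel_measurable borel"
  proof (rule borel_measurable_continuous_on_if)
    show "continuous_on V \<gamma>" using g unfolding deck_def by (blast intro: holomorphic_on_imp_continuous_on)
    show "V \<in> sets borel" using open_V by (rule borel_open)
  qed (rule continuous_on_id)
  moreover have "(\<lambda>z. if z \<in> V then \<gamma> z else z) = \<gamma>"
  proof
    fix z show "(if z \<in> V then \<gamma> z else z) = \<gamma> z" using g by (cases "z \<in> V") (simp_all add: deck_def)
  qed
  ultimately show "\<gamma> \<in> borel_measurable borel" by (simp only:)
qed (rule negligible_vimage_deck)

end


section \<open>Duality of the Ruelle operator\<close>

lemma borel_measurable_cnj [measurable (raw)]: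
  "f \<in> borel_measurable M \<Longrightarrow> (\<lambda>x. cnj (f x)) \<in> borel_measurable M"
  by (rule measurable_compose[OF _ borel_measurable_continuous_onI[OF continuous_on_cnj[OF continuous_on_id]]])

text \<open>Multiplication by this function of modulus at most 1 turns \<open>z\<close> into its absolute value.  Integrating
against it reduces statements on \<open>L\<^sub>1\<close> norms to the duality of operators.\<close>

lemma unimodular_mult: "cnj z / complex_of_real (norm z) * z = complex_of_real (norm z)"
proof (cases "z = 0")
  case False
  have "cnj z / complex_of_real (norm z) * z = (z * cnj z) / complex_of_real (norm z)"
    by (simp add: mult.commute)
  also have "z * cnj z = (complex_of_real (norm z))\<^sup>2" using complex_norm_square[of z] by simp
  finally show ?thesis using False by (simp add: power2_eq_square)
qed simp

lemma norm_unimodular: "norm (cnj z / complex_of_real (norm z)) \<le> 1"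
  by (simp add: norm_divide)

context ray_map
begin

lemma countable_components_V: "countable (components V)"
  using countable_disjoint_open_subsets[of "components V"] open_components[OF open_V] components_nonoverlap
  by (metis disjnt_def pairwise_def)

lemma AE_in_V: "AE z in lebesgue. z \<in> V"
  using negligible_compl_V by (intro AE_I'[of "- V"]) (auto simp: negligible_iff_null_sets)

lemma AE_in_U: "AE z in lebesgue. z \<in> U"
  using negligible_R by (intro AE_I'[of R]) (auto simp: negligible_iff_null_sets U_def)

text \<open>The derivative of \<open>k\<close> is under control on \<open>V\<close> only; this suffices as the complement of \<open>V\<close> is a
null set.\<close>

lemma measurable_conformal_factor:
  assumes k: "k holomorphic_on V"
  shows "(\<lambda>y. cnj (deriv k y) / deriv k y) \<in> borel_measurable lebesgue"
proof (rule borel_measurable_AE)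
  define d where "d y = indicator V y *\<^sub>R deriv k y" for y
  have "d \<in> borel_measurable borel"
    using open_V holomorphic_on_imp_continuous_on[OF holomorphic_deriv[OF k open_V]]
    unfolding d_def by (intro borel_measurable_continuous_on_indicator) auto
  then have [measurable]: "d \<in> borel_measurable lebesgue"
    by (intro measurable_completion) simp
  show "(\<lambda>y. cnj (d y) / d y) \<in> borel_measurable lebesgue"
    by measurable
  show "AE y in lebesgue. cnj (d y) / d y = cnj (deriv k y) / deriv k y"
    using AE_in_V by eventually_elim (simp add: d_def)
qed

lemma norm_conformal_factor: "norm (cnj (deriv k y) / deriv k y) \<le> 1"
  by (simp add: norm_divide)

lemma integrable_pullback:
  assumes \<psi>: "\<psi> \<in> borel_measurable lebesgue" "\<And>x. norm (\<psi> x) \<le> B"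
    and k: "k \<in> lebesgue \<rightarrow>\<^sub>M lebesgue" "k holomorphic_on V" and \<Phi>: "integrable lebesgue \<Phi>"
  shows "integrable lebesgue (\<lambda>y. \<psi> (k y) * (cnj (deriv k y) / deriv k y) * \<Phi> y)"
proof (rule Bochner_Integration.integrable_bound)
  show "integrable lebesgue (\<lambda>y. B * norm (\<Phi> y))" using \<Phi> by (intro integrable_mult_right integrable_norm)
  have [measurable]: "(\<lambda>y. \<psi> (k y)) \<in> borel_measurable lebesgue" using measurable_compose[OF k(1) \<psi>(1)] .
  have [measurable]: "(\<lambda>y. cnj (deriv k y) / deriv k y) \<in> borel_measurable lebesgue"
    by (rule measurable_conformal_factor[OF k(2)])
  have [measurable]: "\<Phi> \<in> borel_measurable lebesgue" using \<Phi> by (rule borel_measurable_integrable)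
  show "(\<lambda>y. \<psi> (k y) * (cnj (deriv k y) / deriv k y) * \<Phi> y) \<in> borel_measurable lebesgue" by measurable
  show "AE y in lebesgue. norm (\<psi> (k y) * (cnj (deriv k y) / deriv k y) * \<Phi> y) \<le> norm (B * norm (\<Phi> y))"
  proof (rule AE_I2)
    fix y
    have "norm (\<psi> (k y) * (cnj (deriv k y) / deriv k y) * \<Phi> y)
        = norm (\<psi> (k y)) * norm (cnj (deriv k y) / deriv k y) * norm (\<Phi> y)"
      by (simp only: norm_mult)
    also have "\<dots> \<le> B * 1 * norm (\<Phi> y)"
      using \<psi>(2)[of "k y"] norm_conformal_factor[of k y]
      by (intro mult_right_mono mult_mono) (auto intro: order_trans[OF norm_ge_zero])
    also have "\<dots> \<le> norm (B * norm (\<Phi> y))" by simp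
    finally show "norm (\<psi> (k y) * (cnj (deriv k y) / deriv k y) * \<Phi> y) \<le> norm (B * norm (\<Phi> y))" .
  qed
qed

text \<open>The Ruelle operator is the sum, over the countably many components \<open>W\<close> of \<open>V\<close>, of the
push-forwards under \<open>f\<close> restricted to \<open>W\<close>.  Each push-forward has at most the norm of \<open>\<Phi>\<close> on \<open>W\<close>, so
the sum converges absolutely in \<open>L\<^sub>1\<close> and almost everywhere, and the duality on the pieces adds up.\<close>

lemma ruelle_operator_dual:
  assumes \<Phi>: "integrable lebesgue \<Phi>"
  shows "integrable lebesgue (ruelle_operator f \<Phi>)"
    and "\<psi> \<in> borel_measurable lebesgue \<Longrightarrow> (\<And>x. norm (\<psi> x) \<le> B) \<Longrightarrow>
      (\<integral>x. \<psi> x * ruelle_operator f \<Phi> x \<partial>lebesgue)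
        = (\<integral>y. \<psi> (f y) * (cnj (deriv f y) / deriv f y) * \<Phi> y \<partial>lebesgue)"
proof -
  define C where "C = components V"
  define N where "N = to_nat_on C ` C"
  \<comment> \<open>The components are enumerated by natural numbers; unused indices stand for the empty set and
    contribute zero terms.\<close>
  define W where "W n = (if n \<in> N then from_nat_into C n else {})" for n
  define h where "h n = inv_into (W n) f" for n
  define t where "t n x = indicator (f ` W n) x *\<^sub>R (\<Phi> (h n x) / (deriv f (h n x))\<^sup>2)" for n x
  have cC: "countable C" using countable_components_V by (simp add: C_def)
  have W_on: "W (to_nat_on C X) = X" if "X \<in> C" for X
    using that cC by (simp add: W_def N_def)
  have W_comp: "W n \<in> C" if n: "n \<in> N" for n
  proof -
    obtain X where "X \<in> C" "n = to_nat_on C X" using n by (auto simp: N_def)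
    then show ?thesis using W_on[of X] by simp
  qed
  have W_off: "W n = {}" if "n \<notin> N" for n using that by (simp add: W_def)
  have opW: "open (W n)" for n
    using W_comp[of n] W_off[of n] open_components[OF open_V] by (cases "n \<in> N") (auto simp: C_def)
  have bW: "bij_betw f (W n) U" if "n \<in> N" for n
    using bij_betw_component W_comp[OF that] by (simp add: C_def)
  have injW: "inj_on f (W n)" for n
    using bW[of n] W_off[of n] by (cases "n \<in> N") (auto simp: bij_betw_def)
  have hW: "h n (f y) = y" if "y \<in> W n" for n y
    unfolding h_def using injW that by (rule inv_into_f_f)
  have disj: "W m \<inter> W n = {}" if "m \<noteq> n" for m n
  proof (cases "m \<in> N \<and> n \<in> N")
    case True
    then obtain X Y where X: "X \<in> C" "m = to_nat_on C X" and Y: "Y \<in> C" "n = to_nat_on C Y"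
      by (auto simp: N_def)
    then have "X \<noteq> Y" using that by auto
    then show ?thesis using components_nonoverlap[of X V Y] X Y W_on by (simp add: C_def)
  next
    case False
    then show ?thesis using W_off by auto
  qed
  have UnW: "(\<Union>n. W n) = V"
  proof -
    have "(\<Union>n. W n) = \<Union>C"
    proof (intro subset_antisym subsetI)
      fix y assume "y \<in> (\<Union>n. W n)"
      then obtain n where "y \<in> W n" by blast
      then show "y \<in> \<Union>C" using W_comp[of n] W_off[of n] by (cases "n \<in> N") auto
    next
      fix y assume "y \<in> \<Union>C"
      then obtain X where "X \<in> C" "y \<in> X" by blast
      then have "y \<in> W (to_nat_on C X)" using W_on by simp
      then show "y \<in> (\<Union>n. W n)" by blast
    qed
    then show ?thesis by (simp add: C_def)
  qed
  have W_sets: "W n \<in> sets lebesgue" for n using opW[of n] by (simp add: borel_open)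
  have \<Phi>W: "set_integrable lebesgue (W n) \<Phi>" for n
    unfolding set_integrable_def by (rule integrable_mult_indicator[OF W_sets \<Phi>])
  have "set_integrable lebesgue (f ` W n) (\<lambda>x. \<Phi> (h n x) / (deriv f (h n x))\<^sup>2)" for n
    by (rule conformal_transfer(1)[OF opW hol_f injW _ \<Phi>W]) (rule hW)
  then have tint: "integrable lebesgue (t n)" for n
    unfolding set_integrable_def t_def .
  have tdual: "(\<integral>x. \<psi> x * t n x \<partial>lebesgue)
      = (LINT y:W n|lebesgue. \<psi> (f y) * (cnj (deriv f y) / deriv f y) * \<Phi> y)"
    if "\<psi> \<in> borel_measurable lebesgue" "\<And>x. norm (\<psi> x) \<le> B" for \<psi> B n
  proof -
    have "(\<integral>x. \<psi> x * t n x \<partial>lebesgue) = (LINT x:f ` W n|lebesgue. \<psi> x * (\<Phi> (h n x) / (deriv f (h n x))\<^sup>2))"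
      unfolding set_lebesgue_integral_def t_def by (simp add: mult_scaleR_right)
    also have "\<dots> = (LINT y:W n|lebesgue. \<psi> (f y) * (cnj (deriv f y) / deriv f y) * \<Phi> y)"
      by (rule conformal_transfer(2)[OF opW hol_f injW _ \<Phi>W that]) (rule hW)
    finally show ?thesis .
  qed
  have tnorm: "(\<integral>x. norm (t n x) \<partial>lebesgue) \<le> (\<integral>y. indicator (W n) y * norm (\<Phi> y) \<partial>lebesgue)" for n
  proof -
    define \<psi> where "\<psi> x = cnj (t n x) / complex_of_real (norm (t n x))" for x
    have [measurable]: "t n \<in> borel_measurable lebesgue" using tint by (rule borel_measurable_integrable)
    have \<psi>: "\<psi> \<in> borel_measurable lebesgue" unfolding \<psi>_def by measurable
    have \<psi>1: "norm (\<psi> x) \<le> 1" for x unfolding \<psi>_def by (rule norm_unimodular)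
    have "\<psi> x * t n x = complex_of_real (norm (t n x))" for x
      unfolding \<psi>_def by (rule unimodular_mult)
    then have "complex_of_real (\<integral>x. norm (t n x) \<partial>lebesgue) = (\<integral>x. \<psi> x * t n x \<partial>lebesgue)"
      by simp
    also have "\<dots> = (LINT y:W n|lebesgue. \<psi> (f y) * (cnj (deriv f y) / deriv f y) * \<Phi> y)"
      by (rule tdual[OF \<psi> \<psi>1])
    finally have "norm (complex_of_real (\<integral>x. norm (t n x) \<partial>lebesgue)) \<le>
        (\<integral>y. norm (indicator (W n) y *\<^sub>R (\<psi> (f y) * (cnj (deriv f y) / deriv f y) * \<Phi> y)) \<partial>lebesgue)"
      unfolding set_lebesgue_integral_def by (simp only: integral_norm_bound)
    also have "\<dots> \<le> (\<integral>y. indicator (W n) y * norm (\<Phi> y) \<partial>lebesgue)"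
    proof (rule integral_mono')
      show "integrable lebesgue (\<lambda>y. indicator (W n) y * norm (\<Phi> y))"
        using integrable_mult_indicator[OF W_sets integrable_norm[OF \<Phi>]] by simp
      fix y
      have "norm (\<psi> (f y)) * norm (cnj (deriv f y) / deriv f y) * norm (\<Phi> y) \<le> 1 * 1 * norm (\<Phi> y)"
        using \<psi>1[of "f y"] norm_conformal_factor[of f y] by (intro mult_right_mono mult_mono) auto
      then show "norm (indicator (W n) y *\<^sub>R (\<psi> (f y) * (cnj (deriv f y) / deriv f y) * \<Phi> y))
          \<le> indicator (W n) y * norm (\<Phi> y)"
        unfolding norm_scaleR norm_mult[symmetric] by (simp add: indicator_def del: norm_mult)
    qed simp
    finally show ?thesis by simp
  qed
  have tsum: "summable (\<lambda>n. \<integral>x. norm (t n x) \<partial>lebesgue)"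
  proof (rule summableI_nonneg_bounded)
    fix m :: nat
    have int: "integrable lebesgue (\<lambda>y. indicator (W n) y * norm (\<Phi> y))" for n
      using integrable_mult_indicator[OF W_sets integrable_norm[OF \<Phi>]] by simp
    have "(\<Sum>n<m. \<integral>x. norm (t n x) \<partial>lebesgue) \<le> (\<Sum>n<m. \<integral>y. indicator (W n) y * norm (\<Phi> y) \<partial>lebesgue)"
      by (intro sum_mono tnorm)
    also have "\<dots> = (\<integral>y. (\<Sum>n<m. indicator (W n) y * norm (\<Phi> y)) \<partial>lebesgue)"
      by (rule Bochner_Integration.integral_sum[symmetric]) (rule int)
    also have "\<dots> \<le> (\<integral>y. norm (\<Phi> y) \<partial>lebesgue)"
    proof (rule integral_mono'[OF integrable_norm[OF \<Phi>]])
      fix y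
      have "(\<Sum>n<m. indicator (W n) y) = (indicator (\<Union>n<m. W n) y :: real)"
        by (rule indicator_UN_disjoint[symmetric]) (auto simp: disjoint_family_on_def disj)
      also have "\<dots> \<le> 1" by (simp add: indicator_def)
      finally show "(\<Sum>n<m. indicator (W n) y * norm (\<Phi> y)) \<le> norm (\<Phi> y)"
        by (simp add: sum_distrib_right[symmetric] mult_left_le_one_le sum_nonneg)
    qed simp
    finally show "(\<Sum>n<m. \<integral>x. norm (t n x) \<partial>lebesgue) \<le> (\<integral>y. norm (\<Phi> y) \<partial>lebesgue)" .
  qed simp
  have AEs: "AE x in lebesgue. summable (\<lambda>n. norm (t n x))"
    by (rule AE_summable_norm[OF tint tsum])
  define S where "S x = (\<Sum>n. t n x)" for x
  have Sint: "integrable lebesgue S"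
    unfolding S_def by (rule integrable_suminf[OF tint AEs tsum])
  have eqS: "AE x in lebesgue. S x = ruelle_operator f \<Phi> x"
    using AE_in_U AEs
  proof eventually_elim
    case (elim x)
    have hx: "h n x \<in> W n" "f (h n x) = x" if "n \<in> N" for n
    proof -
      have "x \<in> f ` W n" using bW[OF that] elim(1) by (simp add: bij_betw_def)
      then show "h n x \<in> W n" "f (h n x) = x" by (auto simp: h_def inv_into_into f_inv_into_f)
    qed
    have bij: "bij_betw (\<lambda>n. h n x) N (f -` {x})"
    proof (rule bij_betw_imageI)
      show "inj_on (\<lambda>n. h n x) N"
      proof (rule inj_onI)
        fix m n assume mn: "m \<in> N" "n \<in> N" "h m x = h n x"
        then have "h m x \<in> W m \<inter> W n" using hx(1)[OF mn(1)] hx(1)[OF mn(2)] by simp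
        then show "m = n" using disj[of m n] by auto
      qed
      show "(\<lambda>n. h n x) ` N = f -` {x}"
      proof (intro subset_antisym subsetI)
        fix y assume "y \<in> (\<lambda>n. h n x) ` N"
        then show "y \<in> f -` {x}" using hx(2) by auto
      next
        fix y assume y: "y \<in> f -` {x}"
        then have "y \<in> (\<Union>n. W n)" using elim(1) unfolding UnW in_V_iff by simp
        then obtain n where n: "y \<in> W n" by blast
        then have "n \<in> N" using W_off[of n] by auto
        moreover have "y = h n x" using hW[OF n] y by simp
        ultimately show "y \<in> (\<lambda>n. h n x) ` N" by blast
      qed
    qed
    have tx: "t n x = \<Phi> (h n x) / (deriv f (h n x))\<^sup>2" if "n \<in> N" for n
    proof -
      have "x \<in> f ` W n" using bW[OF that] elim(1) by (simp add: bij_betw_def)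
      then show ?thesis by (simp add: t_def)
    qed
    have t0: "t n x = 0" if "n \<notin> N" for n using W_off[OF that] by (simp add: t_def)
    have "ruelle_operator f \<Phi> x = (\<Sum>\<^sub>\<infinity>n\<in>N. \<Phi> (h n x) / (deriv f (h n x))\<^sup>2)"
      unfolding ruelle_operator_def by (rule infsum_reindex_bij_betw[OF bij, symmetric])
    also have "\<dots> = (\<Sum>\<^sub>\<infinity>n\<in>UNIV. t n x)"
      by (rule infsum_cong_neutral) (use tx t0 in auto)
    also have "\<dots> = (\<Sum>n. t n x)"
    proof (rule infsumI)
      have "summable (\<lambda>n. t n x)" using elim(2) by (rule summable_norm_cancel)
      then show "((\<lambda>n. t n x) has_sum (\<Sum>n. t n x)) UNIV"
        by (intro norm_summable_imp_has_sum[OF elim(2)] summable_sums)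
    qed
    finally show ?case by (simp add: S_def)
  qed
  have Rmeas: "ruelle_operator f \<Phi> \<in> borel_measurable lebesgue"
    by (rule borel_measurable_AE[OF borel_measurable_integrable[OF Sint] eqS])
  show "integrable lebesgue (ruelle_operator f \<Phi>)"
    by (rule integrable_cong_AE_imp[OF Sint Rmeas eqS])
  assume \<psi>: "\<psi> \<in> borel_measurable lebesgue" "\<And>x. norm (\<psi> x) \<le> B"
  note [measurable] = \<psi>(1) Rmeas
  have B0: "0 \<le> B" using order_trans[OF norm_ge_zero \<psi>(2)] .
  have [measurable]: "t n \<in> borel_measurable lebesgue" for n using tint by (rule borel_measurable_integrable)
  have [measurable]: "S \<in> borel_measurable lebesgue" using Sint by (rule borel_measurable_integrable)
  have norm_\<psi>t: "norm (\<psi> x * t n x) \<le> B * norm (t n x)" for n x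
    unfolding norm_mult using \<psi>(2) by (intro mult_right_mono) auto
  have \<psi>tint: "integrable lebesgue (\<lambda>x. \<psi> x * t n x)" for n
  proof (rule Bochner_Integration.integrable_bound)
    show "integrable lebesgue (\<lambda>x. B * norm (t n x))" by (intro integrable_mult_right integrable_norm tint)
    show "AE x in lebesgue. norm (\<psi> x * t n x) \<le> norm (B * norm (t n x))"
      using norm_\<psi>t by (auto intro!: order_trans[OF norm_\<psi>t])
  qed measurable
  have \<psi>tsum: "summable (\<lambda>n. \<integral>x. norm (\<psi> x * t n x) \<partial>lebesgue)"
  proof (rule summable_comparison_test'[OF summable_mult[OF tsum, of B]])
    fix n
    have "(\<integral>x. norm (\<psi> x * t n x) \<partial>lebesgue) \<le> (\<integral>x. B * norm (t n x) \<partial>lebesgue)"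
      using norm_\<psi>t B0 by (intro integral_mono' integrable_mult_right integrable_norm tint) auto
    then show "norm (\<integral>x. norm (\<psi> x * t n x) \<partial>lebesgue) \<le> B * (\<integral>x. norm (t n x) \<partial>lebesgue)"
      by simp
  qed
  let ?g = "\<lambda>y. \<psi> (f y) * (cnj (deriv f y) / deriv f y) * \<Phi> y"
  have gint: "integrable lebesgue ?g"
    by (rule integrable_pullback[OF \<psi> f_measurable hol_f \<Phi>])
  have "(\<integral>x. \<psi> x * ruelle_operator f \<Phi> x \<partial>lebesgue) = (\<integral>x. (\<Sum>n. \<psi> x * t n x) \<partial>lebesgue)"
  proof (rule integral_cong_AE)
    show "AE x in lebesgue. \<psi> x * ruelle_operator f \<Phi> x = (\<Sum>n. \<psi> x * t n x)"
      using eqS AEs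
    proof eventually_elim
      case (elim x)
      then show ?case
        by (simp add: S_def suminf_mult summable_norm_cancel flip: elim(1))
    qed
  qed measurable
  also have "\<dots> = (\<Sum>n. \<integral>x. \<psi> x * t n x \<partial>lebesgue)"
    by (rule integral_suminf[OF \<psi>tint AE_summable_norm[OF \<psi>tint \<psi>tsum] \<psi>tsum])
  also have "\<dots> = (\<Sum>n. (LINT y:W n|lebesgue. ?g y))"
    by (intro suminf_cong tdual[OF \<psi>])
  also have "\<dots> = (LINT y:(\<Union>n. W n)|lebesgue. ?g y)"
  proof (rule lebesgue_integral_countable_add[symmetric])
    show "set_integrable lebesgue (\<Union>n. W n) ?g"
      unfolding set_integrable_def using W_sets by (intro integrable_mult_indicator gint) auto
  qed (use W_sets disj in auto)
  also have "\<dots> = (\<integral>y. ?g y \<partial>lebesgue)"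
    unfolding UnW set_lebesgue_integral_def
  proof (rule integral_cong_AE)
    show "(\<lambda>y. indicator V y *\<^sub>R ?g y) \<in> borel_measurable lebesgue"
      using open_V by (intro borel_measurable_integrable integrable_mult_indicator gint) (simp add: borel_open)
    show "?g \<in> borel_measurable lebesgue" using gint by (rule borel_measurable_integrable)
    show "AE y in lebesgue. indicator V y *\<^sub>R ?g y = ?g y"
      using AE_in_V by eventually_elim simp
  qed
  finally show "(\<integral>x. \<psi> x * ruelle_operator f \<Phi> x \<partial>lebesgue) = (\<integral>y. ?g y \<partial>lebesgue)" .
qed

lemma deriv_inv_deck:
  assumes g: "deck \<gamma>" and x: "x \<in> V"
  shows "deriv (inv \<gamma>) x = inverse (deriv \<gamma> (inv \<gamma> x))"
proof -
  have inv: "deck (inv \<gamma>)" by (rule deck_inv[OF g])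
  have x': "inv \<gamma> x \<in> V" using deck_in_V[OF inv] x by simp
  have "\<gamma> \<circ> inv \<gamma> = (\<lambda>z. z)" using g by (auto simp: deck_def bij_is_surj surj_f_inv_f)
  then have "1 = deriv (\<gamma> \<circ> inv \<gamma>) x" by simp
  also have "\<dots> = deriv \<gamma> (inv \<gamma> x) * deriv (inv \<gamma>) x"
    using g inv x x' open_V
    by (intro deriv_chain holomorphic_on_imp_differentiable_at[of _ V]) (simp_all add: deck_def)
  finally show ?thesis by (metis inverse_unique)
qed

text \<open>The same duality with a single piece, as a deck transformation is injective on \<open>V\<close>.\<close>

lemma push_forward_dual:
  assumes g: "deck \<gamma>" and \<Phi>: "integrable lebesgue \<Phi>"
  shows "integrable lebesgue (push_forward \<gamma> \<Phi>)"
    and "\<psi> \<in> borel_measurable lebesgue \<Longrightarrow> (\<And>x. norm (\<psi> x) \<le> B) \<Longrightarrow>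
      (\<integral>x. \<psi> x * push_forward \<gamma> \<Phi> x \<partial>lebesgue)
        = (\<integral>y. \<psi> (\<gamma> y) * (cnj (deriv \<gamma> y) / deriv \<gamma> y) * \<Phi> y \<partial>lebesgue)"
proof -
  have b: "bij \<gamma>" and hol: "\<gamma> holomorphic_on V" using g by (simp_all add: deck_def)
  have V_sets: "V \<in> sets lebesgue" using open_V by (simp add: borel_open)
  have inj: "inj_on \<gamma> V" using b by (meson bij_is_inj inj_on_subset subset_UNIV)
  have \<Phi>V: "set_integrable lebesgue V \<Phi>"
    unfolding set_integrable_def by (rule integrable_mult_indicator[OF V_sets \<Phi>])
  have h: "inv \<gamma> (\<gamma> y) = y" if "y \<in> V" for y using b by (simp add: bij_is_inj)
  define t where "t x = indicator V x *\<^sub>R (\<Phi> (inv \<gamma> x) / (deriv \<gamma> (inv \<gamma> x))\<^sup>2)" for x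
  have "set_integrable lebesgue (\<gamma> ` V) (\<lambda>x. \<Phi> (inv \<gamma> x) / (deriv \<gamma> (inv \<gamma> x))\<^sup>2)"
    by (rule conformal_transfer(1)[OF open_V hol inj _ \<Phi>V]) (rule h)
  then have tint: "integrable lebesgue t"
    unfolding set_integrable_def t_def deck_image_V[OF g] .
  have eq: "AE x in lebesgue. t x = push_forward \<gamma> \<Phi> x"
    using AE_in_V
  proof eventually_elim
    case (elim x)
    then show ?case
      by (simp add: t_def push_forward_def deriv_inv_deck[OF g elim] divide_inverse power_inverse)
  qed
  have meas: "push_forward \<gamma> \<Phi> \<in> borel_measurable lebesgue"
    by (rule borel_measurable_AE[OF borel_measurable_integrable[OF tint] eq])
  show "integrable lebesgue (push_forward \<gamma> \<Phi>)"
    by (rule integrable_cong_AE_imp[OF tint meas eq])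
  assume \<psi>: "\<psi> \<in> borel_measurable lebesgue" "\<And>x. norm (\<psi> x) \<le> B"
  note [measurable] = \<psi>(1) meas borel_measurable_integrable[OF tint]
  let ?g = "\<lambda>y. \<psi> (\<gamma> y) * (cnj (deriv \<gamma> y) / deriv \<gamma> y) * \<Phi> y"
  have gint: "integrable lebesgue ?g"
    by (rule integrable_pullback[OF \<psi> deck_measurable[OF g] hol \<Phi>])
  have "(\<integral>x. \<psi> x * push_forward \<gamma> \<Phi> x \<partial>lebesgue) = (\<integral>x. \<psi> x * t x \<partial>lebesgue)"
  proof (rule integral_cong_AE)
    show "AE x in lebesgue. \<psi> x * push_forward \<gamma> \<Phi> x = \<psi> x * t x"
      using eq by eventually_elim simp
  qed measurable
  also have "\<dots> = (LINT x:\<gamma> ` V|lebesgue. \<psi> x * (\<Phi> (inv \<gamma> x) / (deriv \<gamma> (inv \<gamma> x))\<^sup>2))"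
    unfolding set_lebesgue_integral_def t_def deck_image_V[OF g] by (simp add: mult_scaleR_right)
  also have "\<dots> = (LINT y:V|lebesgue. ?g y)"
    by (rule conformal_transfer(2)[OF open_V hol inj _ \<Phi>V \<psi>]) (rule h)
  also have "\<dots> = (\<integral>y. ?g y \<partial>lebesgue)"
    unfolding set_lebesgue_integral_def
  proof (rule integral_cong_AE)
    show "(\<lambda>y. indicator V y *\<^sub>R ?g y) \<in> borel_measurable lebesgue"
      by (intro borel_measurable_integrable integrable_mult_indicator gint V_sets)
    show "?g \<in> borel_measurable lebesgue" using gint by (rule borel_measurable_integrable)
    show "AE y in lebesgue. indicator V y *\<^sub>R ?g y = ?g y"
      using AE_in_V by eventually_elim simp
  qed
  finally show "(\<integral>x. \<psi> x * push_forward \<gamma> \<Phi> x \<partial>lebesgue) = (\<integral>y. ?g y \<partial>lebesgue)" .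
qed

end


section \<open>Contractions of \<open>L\<^sub>1(A)\<close>\<close>

lemma sigma_finite_lebesgue_on:
  fixes A :: "'a::euclidean_space set"
  assumes A: "A \<in> sets lebesgue"
  shows "sigma_finite_measure (lebesgue_on A)"
proof (rule sigma_finite_measure_restrict_space[OF _ A])
  obtain C :: "'a set set" where C: "countable C" "C \<subseteq> sets lborel" "\<Union>C = space lborel"
    "\<forall>a\<in>C. emeasure lborel a \<noteq> \<infinity>"
    using lborel.sigma_finite_countable by blast
  show "sigma_finite_measure (lebesgue :: 'a measure)"
  proof
    show "\<exists>C. countable C \<and> C \<subseteq> sets lebesgue \<and> \<Union>C = space lebesgue \<and> (\<forall>a\<in>C. emeasure (lebesgue :: 'a measure) a \<noteq> \<infinity>)"
      using C by (intro exI[of _ C]) auto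
  qed
qed

lemma L1_combination: "\<phi> \<in> L1 A \<Longrightarrow> \<psi> \<in> L1 A \<Longrightarrow> (\<lambda>x. c * \<phi> x + d * \<psi> x) \<in> L1 A"
  by (simp add: L1_def)

lemma L1_diff: "\<phi> \<in> L1 A \<Longrightarrow> \<psi> \<in> L1 A \<Longrightarrow> (\<lambda>x. \<phi> x - \<psi> x) \<in> L1 A"
  by (simp add: L1_def)

lemma L1_norm_nonneg: "0 \<le> L1_norm A \<phi>"
  by (simp add: L1_norm_def)

lemma L1_norm_diff_eq_0_iff:
  assumes "\<phi> \<in> L1 A" "\<psi> \<in> L1 A"
  shows "L1_norm A (\<lambda>x. \<phi> x - \<psi> x) = 0 \<longleftrightarrow> (AE x in lebesgue_on A. \<phi> x = \<psi> x)"
proof -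
  have "integrable (lebesgue_on A) (\<lambda>x. \<phi> x - \<psi> x)"
    using L1_diff[OF assms] by (simp add: L1_def)
  from integral_nonneg_eq_0_iff_AE[OF integrable_norm[OF this]] show ?thesis by (simp add: L1_norm_def)
qed

lemma L1_norm_cong_AE:
  assumes "\<phi> \<in> L1 A" "\<psi> \<in> L1 A" "AE x in lebesgue_on A. \<phi> x = \<psi> x"
  shows "L1_norm A \<phi> = L1_norm A \<psi>"
  unfolding L1_norm_def
  using assms by (intro integral_cong_AE) (auto simp: L1_def intro: borel_measurable_integrable)

text \<open>Operators are only linear up to null sets, because an infinite sum may fail to converge on a null
set that depends on the function.\<close>

definition L1_contraction :: "complex set \<Rightarrow> ((complex \<Rightarrow> complex) \<Rightarrow> complex \<Rightarrow> complex) \<Rightarrow> bool" where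
  "L1_contraction A T \<longleftrightarrow>
    (\<forall>\<phi>\<in>L1 A. T \<phi> \<in> L1 A \<and> L1_norm A (T \<phi>) \<le> L1_norm A \<phi>)
    \<and> (\<forall>\<phi>\<in>L1 A. \<forall>\<psi>\<in>L1 A. \<forall>c d. AE x in lebesgue_on A.
          T (\<lambda>y. c * \<phi> y + d * \<psi> y) x = c * T \<phi> x + d * T \<psi> x)"

lemma L1_contractionD:
  assumes "L1_contraction A T" "\<phi> \<in> L1 A"
  shows "T \<phi> \<in> L1 A" "L1_norm A (T \<phi>) \<le> L1_norm A \<phi>"
  using assms by (auto simp: L1_contraction_def)

lemma L1_contraction_linear:
  assumes "L1_contraction A T" "\<phi> \<in> L1 A" "\<psi> \<in> L1 A"
  shows "AE x in lebesgue_on A. T (\<lambda>y. c * \<phi> y + d * \<psi> y) x = c * T \<phi> x + d * T \<psi> x"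
  using assms by (auto simp: L1_contraction_def)

text \<open>Operators are defined on functions, not on classes, so compatibility with equality almost
everywhere needs a proof: it follows from linearity and contractivity.\<close>

lemma L1_contraction_cong:
  assumes T: "L1_contraction A T" and \<phi>: "\<phi> \<in> L1 A" and \<psi>: "\<psi> \<in> L1 A"
    and eq: "AE x in lebesgue_on A. \<phi> x = \<psi> x"
  shows "AE x in lebesgue_on A. T \<phi> x = T \<psi> x"
proof -
  have T\<phi>: "T \<phi> \<in> L1 A" and T\<psi>: "T \<psi> \<in> L1 A" using L1_contractionD[OF T] \<phi> \<psi> by auto
  have D: "(\<lambda>x. \<phi> x - \<psi> x) \<in> L1 A" by (rule L1_diff[OF \<phi> \<psi>])
  have TD: "T (\<lambda>x. \<phi> x - \<psi> x) \<in> L1 A" by (rule L1_contractionD(1)[OF T D])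
  have "AE x in lebesgue_on A. T (\<lambda>x. \<phi> x - \<psi> x) x = T \<phi> x - T \<psi> x"
    using L1_contraction_linear[OF T \<phi> \<psi>, of 1 "-1"] by simp
  from L1_norm_cong_AE[OF TD L1_diff[OF T\<phi> T\<psi>] this]
  have "L1_norm A (\<lambda>x. T \<phi> x - T \<psi> x) \<le> L1_norm A (\<lambda>x. \<phi> x - \<psi> x)"
    using L1_contractionD(2)[OF T D] by simp
  then show ?thesis
    using L1_norm_diff_eq_0_iff[OF \<phi> \<psi>] L1_norm_diff_eq_0_iff[OF T\<phi> T\<psi>] eq L1_norm_nonneg
    by (metis order_antisym)
qed

lemma L1_contraction_comp:
  assumes S: "L1_contraction A S" and T: "L1_contraction A T"
  shows "L1_contraction A (\<lambda>\<phi>. S (T \<phi>))"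
  unfolding L1_contraction_def
proof (intro conjI ballI allI)
  fix \<phi> assume \<phi>: "\<phi> \<in> L1 A"
  have T\<phi>: "T \<phi> \<in> L1 A" by (rule L1_contractionD(1)[OF T \<phi>])
  show "S (T \<phi>) \<in> L1 A" by (rule L1_contractionD(1)[OF S T\<phi>])
  show "L1_norm A (S (T \<phi>)) \<le> L1_norm A \<phi>"
    by (rule order_trans[OF L1_contractionD(2)[OF S T\<phi>] L1_contractionD(2)[OF T \<phi>]])
  fix \<psi> c d assume \<psi>: "\<psi> \<in> L1 A"
  have T\<psi>: "T \<psi> \<in> L1 A" by (rule L1_contractionD(1)[OF T \<psi>])
  have "AE x in lebesgue_on A. S (T (\<lambda>y. c * \<phi> y + d * \<psi> y)) x = S (\<lambda>x. c * T \<phi> x + d * T \<psi> x) x"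
    by (rule L1_contraction_cong[OF S L1_contractionD(1)[OF T L1_combination[OF \<phi> \<psi>]]
          L1_combination[OF T\<phi> T\<psi>] L1_contraction_linear[OF T \<phi> \<psi>]])
  moreover have "AE x in lebesgue_on A. S (\<lambda>x. c * T \<phi> x + d * T \<psi> x) x = c * S (T \<phi>) x + d * S (T \<psi>) x"
    by (rule L1_contraction_linear[OF S T\<phi> T\<psi>])
  ultimately show "AE x in lebesgue_on A. S (T (\<lambda>y. c * \<phi> y + d * \<psi> y)) x = c * S (T \<phi>) x + d * S (T \<psi>) x"
    by eventually_elim simp
qed

lemma L1_contraction_funpow:
  assumes T: "L1_contraction A T"
  shows "L1_contraction A (T ^^ n)"
proof (induction n)
  case 0
  show ?case by (simp add: L1_contraction_def)
next
  case (Suc n)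
  then show ?case using L1_contraction_comp[OF T Suc.IH] by (simp add: o_def)
qed

lemma bounded_endomorphism_L1_contraction:
  assumes T: "L1_contraction A T"
  shows "bounded_endomorphism (L1 A) (L1_norm A) T"
  unfolding bounded_endomorphism_def
proof (intro conjI ballI allI exI[of _ 1])
  fix \<phi> assume \<phi>: "\<phi> \<in> L1 A"
  show "T \<phi> \<in> L1 A" "L1_norm A (T \<phi>) \<le> 1 * L1_norm A \<phi>" using L1_contractionD[OF T \<phi>] by auto
  fix \<psi> c d assume \<psi>: "\<psi> \<in> L1 A"
  show "L1_norm A (\<lambda>x. T (\<lambda>y. c * \<phi> y + d * \<psi> y) x - (c * T \<phi> x + d * T \<psi> x)) = 0"
    using L1_contraction_linear[OF T \<phi> \<psi>] L1_contractionD(1)[OF T] L1_combination \<phi> \<psi>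
    by (subst L1_norm_diff_eq_0_iff) auto
qed

lemma bounded_functional_cong:
  assumes l: "bounded_functional (L1 A) (L1_norm A) l" and \<phi>: "\<phi> \<in> L1 A" and \<psi>: "\<psi> \<in> L1 A"
    and eq: "AE x in lebesgue_on A. \<phi> x = \<psi> x"
  shows "l \<phi> = l \<psi>"
proof -
  obtain C where C: "\<And>u. u \<in> L1 A \<Longrightarrow> norm (l u) \<le> C * L1_norm A u"
    using l unfolding bounded_functional_def by blast
  have "l (\<lambda>x. 1 * \<phi> x + (-1) * \<psi> x) = 1 * l \<phi> + (-1) * l \<psi>"
    using l \<phi> \<psi> by (simp only: bounded_functional_def)
  moreover have "norm (l (\<lambda>x. \<phi> x - \<psi> x)) \<le> C * L1_norm A (\<lambda>x. \<phi> x - \<psi> x)"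
    by (rule C[OF L1_diff[OF \<phi> \<psi>]])
  ultimately show ?thesis using L1_norm_diff_eq_0_iff[OF \<phi> \<psi>] eq by simp
qed

lemma bounded_functional_comp:
  assumes l: "bounded_functional (L1 A) (L1_norm A) l"
    and T: "bounded_endomorphism (L1 A) (L1_norm A) T"
  shows "bounded_functional (L1 A) (L1_norm A) (\<lambda>\<phi>. l (T \<phi>))"
  unfolding bounded_functional_def
proof (intro conjI ballI allI)
  fix \<phi> \<psi> c d assume \<phi>: "\<phi> \<in> L1 A" and \<psi>: "\<psi> \<in> L1 A"
  have TL: "T u \<in> L1 A" if "u \<in> L1 A" for u using T that by (auto simp: bounded_endomorphism_def)
  have "l (T (\<lambda>y. c * \<phi> y + d * \<psi> y)) = l (\<lambda>x. c * T \<phi> x + d * T \<psi> x)"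
  proof (rule bounded_functional_cong[OF l TL[OF L1_combination[OF \<phi> \<psi>]] L1_combination[OF TL[OF \<phi>] TL[OF \<psi>]]])
    have "L1_norm A (\<lambda>x. T (\<lambda>y. c * \<phi> y + d * \<psi> y) x - (c * T \<phi> x + d * T \<psi> x)) = 0"
      using T \<phi> \<psi> by (auto simp: bounded_endomorphism_def)
    then show "AE x in lebesgue_on A. T (\<lambda>y. c * \<phi> y + d * \<psi> y) x = c * T \<phi> x + d * T \<psi> x"
      by (subst (asm) L1_norm_diff_eq_0_iff) (auto intro: TL L1_combination \<phi> \<psi>)
  qed
  also have "\<dots> = c * l (T \<phi>) + d * l (T \<psi>)"
    using l TL[OF \<phi>] TL[OF \<psi>] by (simp add: bounded_functional_def)
  finally show "l (T (\<lambda>y. c * \<phi> y + d * \<psi> y)) = c * l (T \<phi>) + d * l (T \<psi>)" .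
next
  obtain C where C: "\<And>u. u \<in> L1 A \<Longrightarrow> norm (l u) \<le> C * L1_norm A u"
    using l unfolding bounded_functional_def by blast
  obtain D where D: "\<And>u. u \<in> L1 A \<Longrightarrow> T u \<in> L1 A \<and> L1_norm A (T u) \<le> D * L1_norm A u"
    using T unfolding bounded_endomorphism_def by blast
  have "norm (l (T u)) \<le> (max C 0 * D) * L1_norm A u" if u: "u \<in> L1 A" for u
  proof -
    have "norm (l (T u)) \<le> C * L1_norm A (T u)" using C D[OF u] by blast
    also have "\<dots> \<le> max C 0 * L1_norm A (T u)" using L1_norm_nonneg by (intro mult_right_mono) auto
    also have "\<dots> \<le> max C 0 * (D * L1_norm A u)" using D[OF u] by (intro mult_left_mono) auto
    finally show ?thesis by (simp add: mult.assoc)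
  qed
  then show "\<exists>C. \<forall>\<phi>\<in>L1 A. norm (l (T \<phi>)) \<le> C * L1_norm A \<phi>" by blast
qed

locale ray_map_set = ray_map +
  fixes A :: "complex set"
  assumes A_meas: "A \<in> sets lebesgue" and A_inv: "f -` A = A"
begin

lemma f_in_A: "f z \<in> A \<longleftrightarrow> z \<in> A"
  using A_inv by auto

lemma deck_in_A: "deck \<gamma> \<Longrightarrow> \<gamma> z \<in> A \<longleftrightarrow> z \<in> A"
  using f_in_A unfolding deck_def by metis

text \<open>\<open>T\<close> is the predual of the Beltrami pullback along \<open>k\<close>.\<close>

definition dual_op :: "((complex \<Rightarrow> complex) \<Rightarrow> complex \<Rightarrow> complex) \<Rightarrow> (complex \<Rightarrow> complex) \<Rightarrow> bool" where
  "dual_op T k \<longleftrightarrow> (\<forall>\<phi>\<in>L1 A. T \<phi> \<in> L1 A) \<and>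
    (\<forall>\<psi> B. \<psi> \<in> borel_measurable (lebesgue_on A) \<longrightarrow> (\<forall>x. norm (\<psi> x) \<le> B) \<longrightarrow>
      (\<lambda>y. \<psi> (k y) * (cnj (deriv k y) / deriv k y)) \<in> borel_measurable (lebesgue_on A) \<and>
      (\<forall>\<phi>\<in>L1 A. (\<integral>x. \<psi> x * T \<phi> x \<partial>lebesgue_on A)
        = (\<integral>y. \<psi> (k y) * (cnj (deriv k y) / deriv k y) * \<phi> y \<partial>lebesgue_on A)))"

lemma dual_op_measurable:
  assumes "dual_op T k" "\<psi> \<in> borel_measurable (lebesgue_on A)" "\<And>x. norm (\<psi> x) \<le> B"
  shows "(\<lambda>y. \<psi> (k y) * (cnj (deriv k y) / deriv k y)) \<in> borel_measurable (lebesgue_on A)"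
  using assms unfolding dual_op_def by blast

lemma dual_op_integral:
  assumes "dual_op T k" "\<psi> \<in> borel_measurable (lebesgue_on A)" "\<And>x. norm (\<psi> x) \<le> B" "\<phi> \<in> L1 A"
  shows "(\<integral>x. \<psi> x * T \<phi> x \<partial>lebesgue_on A)
    = (\<integral>y. \<psi> (k y) * (cnj (deriv k y) / deriv k y) * \<phi> y \<partial>lebesgue_on A)"
  using assms unfolding dual_op_def by blast

lemma dual_opI:
  assumes k: "k \<in> lebesgue \<rightarrow>\<^sub>M lebesgue" "k holomorphic_on V" "\<And>z. k z \<in> A \<longleftrightarrow> z \<in> A"
    and T: "\<And>\<phi> x. T (\<lambda>y. indicator A y *\<^sub>R \<phi> y) x = indicator A x *\<^sub>R T \<phi> x"
    and int: "\<And>\<Phi>. integrable lebesgue \<Phi> \<Longrightarrow> integrable lebesgue (T \<Phi>)"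
    and dual: "\<And>\<Phi> \<psi> B. integrable lebesgue \<Phi> \<Longrightarrow> \<psi> \<in> borel_measurable lebesgue \<Longrightarrow> (\<And>x. norm (\<psi> x) \<le> B) \<Longrightarrow>
      (\<integral>x. \<psi> x * T \<Phi> x \<partial>lebesgue) = (\<integral>y. \<psi> (k y) * (cnj (deriv k y) / deriv k y) * \<Phi> y \<partial>lebesgue)"
  shows "dual_op T k"
proof -
  have \<Omega>: "A \<inter> space lebesgue \<in> sets lebesgue" using A_meas by simp
  have L1_iff: "\<phi> \<in> L1 A \<longleftrightarrow> integrable lebesgue (\<lambda>y. indicator A y *\<^sub>R \<phi> y)" for \<phi>
    unfolding L1_def by (simp add: integrable_restrict_space[OF \<Omega>])
  show ?thesis
    unfolding dual_op_def
  proof (intro conjI ballI allI impI)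
    fix \<phi> assume "\<phi> \<in> L1 A"
    then show "T \<phi> \<in> L1 A" using int unfolding L1_iff T[symmetric] by blast
  next
    fix \<psi> :: "complex \<Rightarrow> complex" and B :: real
    assume \<psi>: "\<psi> \<in> borel_measurable (lebesgue_on A)" "\<forall>x. norm (\<psi> x) \<le> B"
    define \<Psi> where "\<Psi> x = indicator A x *\<^sub>R \<psi> x" for x
    have \<Psi>: "\<Psi> \<in> borel_measurable lebesgue"
      using \<psi>(1) A_meas unfolding \<Psi>_def by (simp add: borel_measurable_restrict_space_iff)
    have \<Psi>B: "norm (\<Psi> x) \<le> B" for x
      using \<psi>(2) order_trans[OF norm_ge_zero spec[OF \<psi>(2)]] by (auto simp: \<Psi>_def indicator_def)
    let ?q = "\<lambda>y. cnj (deriv k y) / deriv k y"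
    have "(\<lambda>y. \<Psi> (k y) * ?q y) \<in> borel_measurable lebesgue"
      using measurable_compose[OF k(1) \<Psi>] measurable_conformal_factor[OF k(2)] by (rule borel_measurable_times)
    then have "(\<lambda>y. \<Psi> (k y) * ?q y) \<in> borel_measurable (lebesgue_on A)"
      by (rule measurable_restrict_space1)
    then show "(\<lambda>y. \<psi> (k y) * ?q y) \<in> borel_measurable (lebesgue_on A)"
      by (rule measurable_cong[THEN iffD1, rotated]) (simp add: \<Psi>_def k(3))
    fix \<phi> assume \<phi>: "\<phi> \<in> L1 A"
    let ?\<Phi> = "\<lambda>y. indicator A y *\<^sub>R \<phi> y"
    have \<Phi>: "integrable lebesgue ?\<Phi>" using \<phi> L1_iff by blast
    have "(\<integral>x. \<psi> x * T \<phi> x \<partial>lebesgue_on A) = (\<integral>x. indicator A x *\<^sub>R (\<psi> x * T \<phi> x) \<partial>lebesgue)"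
      by (rule integral_restrict_space[OF \<Omega>])
    also have "\<dots> = (\<integral>x. \<Psi> x * T ?\<Phi> x \<partial>lebesgue)"
      by (intro Bochner_Integration.integral_cong refl) (simp add: \<Psi>_def T split: split_indicator)
    also have "\<dots> = (\<integral>y. \<Psi> (k y) * ?q y * ?\<Phi> y \<partial>lebesgue)"
      by (rule dual[OF \<Phi> \<Psi> \<Psi>B])
    also have "\<dots> = (\<integral>y. indicator A y *\<^sub>R (\<psi> (k y) * ?q y * \<phi> y) \<partial>lebesgue)"
      by (intro Bochner_Integration.integral_cong refl) (simp add: \<Psi>_def k(3) indicator_def)
    also have "\<dots> = (\<integral>y. \<psi> (k y) * ?q y * \<phi> y \<partial>lebesgue_on A)"
      by (rule integral_restrict_space[OF \<Omega>, symmetric])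
    finally show "(\<integral>x. \<psi> x * T \<phi> x \<partial>lebesgue_on A) = (\<integral>y. \<psi> (k y) * ?q y * \<phi> y \<partial>lebesgue_on A)" .
  qed
qed

lemma dual_op_ruelle: "dual_op (ruelle_operator f) f"
proof (rule dual_opI[OF f_measurable hol_f f_in_A])
  fix \<phi> x
  show "ruelle_operator f (\<lambda>y. indicator A y *\<^sub>R \<phi> y) x = indicator A x *\<^sub>R ruelle_operator f \<phi> x"
  proof (cases "x \<in> A")
    case True
    then show ?thesis unfolding ruelle_operator_def
      by (simp, intro infsum_cong) (use f_in_A in \<open>auto simp: indicator_def\<close>)
  next
    case False
    then show ?thesis unfolding ruelle_operator_def
      by (simp, intro infsum_0) (use f_in_A in \<open>auto simp: indicator_def\<close>)
  qed
qed (rule ruelle_operator_dual; assumption)+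

lemma dual_op_push_forward:
  assumes g: "deck \<gamma>"
  shows "dual_op (push_forward \<gamma>) \<gamma>"
proof (rule dual_opI[OF deck_measurable[OF g] _ deck_in_A[OF g]])
  show "\<gamma> holomorphic_on V" using g by (simp add: deck_def)
  show "push_forward \<gamma> (\<lambda>y. indicator A y *\<^sub>R \<phi> y) x = indicator A x *\<^sub>R push_forward \<gamma> \<phi> x" for \<phi> x
    using deck_in_A[OF deck_inv[OF g], of x] by (simp add: push_forward_def indicator_def)
qed (rule push_forward_dual[OF g]; assumption)+

lemma pullback_bound:
  assumes "norm (\<psi> (k y)) \<le> (B::real)"
  shows "norm (\<psi> (k y) * (cnj (deriv k y) / deriv k y)) \<le> B"
proof -
  have "norm (\<psi> (k y)) * norm (cnj (deriv k y) / deriv k y) \<le> B * 1"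
    using assms norm_conformal_factor[of k y] order_trans[OF norm_ge_zero assms] by (intro mult_mono) auto
  then show ?thesis by (simp only: norm_mult mult_1_right)
qed

lemma integrable_bounded_mult:
  assumes m: "m \<in> borel_measurable (lebesgue_on A)" "\<And>x. norm (m x) \<le> B" and u: "u \<in> L1 A"
  shows "integrable (lebesgue_on A) (\<lambda>x. m x * u x :: complex)"
proof (rule Bochner_Integration.integrable_bound)
  have u': "integrable (lebesgue_on A) u" using u by (simp add: L1_def)
  show "integrable (lebesgue_on A) (\<lambda>x. B * norm (u x))" using u' by (intro integrable_mult_right integrable_norm)
  note [measurable] = m(1) borel_measurable_integrable[OF u']
  show "(\<lambda>x. m x * u x) \<in> borel_measurable (lebesgue_on A)" by measurable
  show "AE x in lebesgue_on A. norm (m x * u x) \<le> norm (B * norm (u x))"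
  proof (rule AE_I2)
    fix x
    have "norm (m x * u x) \<le> B * norm (u x)" unfolding norm_mult using m(2) by (intro mult_right_mono) auto
    then show "norm (m x * u x) \<le> norm (B * norm (u x))" by simp
  qed
qed

text \<open>The pullback does not increase the supremum norm, so its predual does not increase the \<open>L\<^sub>1\<close> norm.
Linearity is tested against bounded functions, which avoids all questions of convergence of the
defining sums.\<close>

lemma L1_contraction_dual_op:
  assumes T: "dual_op T k"
  shows "L1_contraction A T"
proof -
  have TL: "T \<phi> \<in> L1 A" if "\<phi> \<in> L1 A" for \<phi> using T that by (simp add: dual_op_def)
  note dual = dual_op_integral[OF T] and pull = dual_op_measurable[OF T]
  define sg where "sg u x = cnj (u x) / complex_of_real (norm (u x))" for u :: "complex \<Rightarrow> complex" and x
  have sg: "sg u \<in> borel_measurable (lebesgue_on A)" if "u \<in> L1 A" for u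
  proof -
    have [measurable]: "u \<in> borel_measurable (lebesgue_on A)" using that by (auto simp: L1_def)
    show ?thesis unfolding sg_def by measurable
  qed
  have sg1: "norm (sg u x) \<le> 1" for u x unfolding sg_def by (rule norm_unimodular)
  have norm_eq: "complex_of_real (L1_norm A u) = (\<integral>x. sg u x * u x \<partial>lebesgue_on A)" for u
    unfolding L1_norm_def sg_def unimodular_mult by simp
  show ?thesis
    unfolding L1_contraction_def
  proof (intro conjI ballI allI)
    fix \<phi> assume \<phi>: "\<phi> \<in> L1 A"
    show "T \<phi> \<in> L1 A" by (rule TL[OF \<phi>])
    have "complex_of_real (L1_norm A (T \<phi>)) = (\<integral>y. sg (T \<phi>) (k y) * (cnj (deriv k y) / deriv k y) * \<phi> y \<partial>lebesgue_on A)"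
      unfolding norm_eq by (rule dual[OF sg[OF TL[OF \<phi>]] sg1 \<phi>])
    then have "norm (complex_of_real (L1_norm A (T \<phi>))) \<le> (\<integral>y. norm (sg (T \<phi>) (k y) * (cnj (deriv k y) / deriv k y) * \<phi> y) \<partial>lebesgue_on A)"
      by (simp only: integral_norm_bound)
    also have "\<dots> \<le> (\<integral>y. norm (\<phi> y) \<partial>lebesgue_on A)"
    proof (rule integral_mono')
      show "integrable (lebesgue_on A) (\<lambda>y. norm (\<phi> y))" using \<phi> by (auto simp: L1_def)
      fix y
      have "norm (sg (T \<phi>) (k y) * (cnj (deriv k y) / deriv k y)) * norm (\<phi> y) \<le> 1 * norm (\<phi> y)"
        by (intro mult_right_mono norm_ge_zero pullback_bound[where \<psi> = "sg (T \<phi>)" and k = k, OF sg1])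
      then show "norm (sg (T \<phi>) (k y) * (cnj (deriv k y) / deriv k y) * \<phi> y) \<le> norm (\<phi> y)"
        by (simp only: norm_mult mult_1_left)
    qed simp
    finally show "L1_norm A (T \<phi>) \<le> L1_norm A \<phi>"
      using L1_norm_nonneg[of A "T \<phi>"] by (simp add: L1_norm_def)
    fix \<psi> c d assume \<psi>: "\<psi> \<in> L1 A"
    let ?u = "\<lambda>y. c * \<phi> y + d * \<psi> y"
    have u: "?u \<in> L1 A" by (rule L1_combination[OF \<phi> \<psi>])
    have v: "(\<lambda>x. c * T \<phi> x + d * T \<psi> x) \<in> L1 A" by (rule L1_combination[OF TL[OF \<phi>] TL[OF \<psi>]])
    define D where "D x = T ?u x - (c * T \<phi> x + d * T \<psi> x)" for x
    have D: "D \<in> L1 A" unfolding D_def by (rule L1_diff[OF TL[OF u] v])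
    let ?p = "\<lambda>y. sg D (k y) * (cnj (deriv k y) / deriv k y)"
    note im = integrable_bounded_mult[OF sg[OF D] sg1]
    note ip = integrable_bounded_mult[OF pull[OF sg[OF D] sg1] pullback_bound[where \<psi> = "sg D" and k = k, OF sg1]]
    have "(\<integral>x. sg D x * D x \<partial>lebesgue_on A)
        = (\<integral>x. sg D x * T ?u x - (c * (sg D x * T \<phi> x) + d * (sg D x * T \<psi> x)) \<partial>lebesgue_on A)"
      by (intro Bochner_Integration.integral_cong refl) (simp add: D_def algebra_simps)
    also have "\<dots> = (\<integral>x. sg D x * T ?u x \<partial>lebesgue_on A)
        - (c * (\<integral>x. sg D x * T \<phi> x \<partial>lebesgue_on A) + d * (\<integral>x. sg D x * T \<psi> x \<partial>lebesgue_on A))"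
      using im[OF TL[OF u]] im[OF TL[OF \<phi>]] im[OF TL[OF \<psi>]] by simp
    also have "\<dots> = (\<integral>y. ?p y * ?u y \<partial>lebesgue_on A)
        - (c * (\<integral>y. ?p y * \<phi> y \<partial>lebesgue_on A) + d * (\<integral>y. ?p y * \<psi> y \<partial>lebesgue_on A))"
      unfolding dual[OF sg[OF D] sg1 u] dual[OF sg[OF D] sg1 \<phi>] dual[OF sg[OF D] sg1 \<psi>] ..
    also have "(\<integral>y. ?p y * ?u y \<partial>lebesgue_on A) = (\<integral>y. c * (?p y * \<phi> y) + d * (?p y * \<psi> y) \<partial>lebesgue_on A)"
      by (intro Bochner_Integration.integral_cong refl) (simp only: distrib_left mult_ac)
    also have "\<dots> = c * (\<integral>y. ?p y * \<phi> y \<partial>lebesgue_on A) + d * (\<integral>y. ?p y * \<psi> y \<partial>lebesgue_on A)"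
      using ip[OF \<phi>] ip[OF \<psi>] by (simp del: times_divide_eq_right times_divide_eq_left)
    finally have "L1_norm A D = 0" using norm_eq[of D] by simp
    then show "AE x in lebesgue_on A. T ?u x = c * T \<phi> x + d * T \<psi> x"
      unfolding D_def by (subst (asm) L1_norm_diff_eq_0_iff[OF TL[OF u] v])
  qed
qed

lemma L1_contraction_ruelle: "L1_contraction A (ruelle_operator f)"
  by (rule L1_contraction_dual_op[OF dual_op_ruelle])

lemma L1_contraction_push_forward: "deck \<gamma> \<Longrightarrow> L1_contraction A (push_forward \<gamma>)"
  by (rule L1_contraction_dual_op[OF dual_op_push_forward])

end


section \<open>Iterates and the semigroup\<close>

context ray_map
begin

text \<open>The range of \<open>f\<close> contains \<open>U\<close>, the complement of a null set, so it meets every non-empty open set.\<close>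

lemma vimage_funpow_nonempty:
  assumes "open S" "S \<noteq> {}"
  shows "(f ^^ n) -` S \<noteq> {}"
  using assms
proof (induction n arbitrary: S)
  case (Suc n)
  have "\<not> S \<subseteq> R"
    using negligible_R Suc.prems by (meson negligible_subset open_not_negligible)
  then obtain x where x: "x \<in> S" "x \<in> U" by (auto simp: U_def)
  then obtain y where "f y = x" using f_surj_U by auto
  then have "f -` S \<noteq> {}" using x by auto
  moreover have "open (f -` S)"
    using cont_f[of UNIV] Suc.prems(1) by (simp add: continuous_on_open_vimage)
  ultimately have "(f ^^ n) -` (f -` S) \<noteq> {}" by (rule Suc.IH[rotated])
  then show ?case by (auto simp: vimage_def)
qed simp

lemma cont_funpow: "continuous_on S (f ^^ n)"
proof (induction n)
  case (Suc n)
  then show ?case using continuous_on_compose[OF Suc.IH cont_f] by simp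
qed (simp add: continuous_on_id)

lemma open_vimage_funpow: "open S \<Longrightarrow> open ((f ^^ n) -` S)"
  by (rule open_vimage[OF _ cont_funpow])

text \<open>An entire homeomorphism is proper, hence a polynomial.  Its derivative has no zero and is constant
by the fundamental theorem of algebra.\<close>

lemma no_continuous_inverse:
  assumes inj: "inj f" and g: "continuous_on UNIV g" "\<And>z. f (g z) = z"
  shows False
proof -
  have gf: "g (f z) = z" for z using inj g(2) by (auto dest: injD)
  have "compact {z. f z \<in> K}" if "compact K" for K
  proof -
    have "{z. f z \<in> K} = g ` K"
    proof (intro subset_antisym subsetI)
      fix z assume "z \<in> {z. f z \<in> K}"
      then have "f z \<in> K" by simp
      then have "g (f z) \<in> g ` K" by (rule imageI)
      then show "z \<in> g ` K" unfolding gf .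
    next
      fix z assume "z \<in> g ` K"
      then obtain y where "y \<in> K" "z = g y" by blast
      then show "z \<in> {z. f z \<in> K}" by (simp add: g(2))
    qed
    then show ?thesis using that g(1) by (simp add: compact_continuous_image continuous_on_subset)
  qed
  then obtain c n where c: "0 < n" "c n \<noteq> 0" "f = (\<lambda>z. \<Sum>i\<le>n. c i * z ^ i)"
    using proper_map_polyfun_eq[OF entire] by blast
  obtain m where m: "n = Suc m" using c(1) gr0_implies_Suc by blast
  define a where "a i = of_nat (Suc i) * c (Suc i)" for i
  have der: "deriv f z = (\<Sum>i\<le>m. a i * z ^ i)" for z
  proof (rule DERIV_imp_deriv)
    have pow: "((\<lambda>z. z ^ i) has_field_derivative (of_nat i * z ^ (i - Suc 0))) (at z)" for i
      by (rule DERIV_cong[OF DERIV_power[OF DERIV_ident]]) simp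
    have "((\<lambda>z. \<Sum>i\<le>n. c i * z ^ i) has_field_derivative (\<Sum>i\<le>n. c i * (of_nat i * z ^ (i - Suc 0)))) (at z)"
      by (intro DERIV_sum DERIV_cmult pow)
    also have "(\<Sum>i\<le>n. c i * (of_nat i * z ^ (i - Suc 0))) = (\<Sum>i\<le>m. a i * z ^ i)"
      unfolding m by (subst sum.atMost_Suc_shift) (simp add: a_def mult_ac)
    finally show "(f has_field_derivative (\<Sum>i\<le>m. a i * z ^ i)) (at z)" using c(3) by simp
  qed
  have nz: "deriv f z \<noteq> 0" for z
    by (rule holomorphic_injective_imp_regular[OF entire open_UNIV inj UNIV_I])
  have "m = 0"
  proof (rule ccontr)
    assume "m \<noteq> 0"
    then have "\<exists>i\<in>{1..m}. a i \<noteq> 0" using c(2) m by (intro bexI[of _ m]) (auto simp: a_def simp del: of_nat_Suc)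
    then obtain z where "(\<Sum>i\<le>m. a i * z ^ i) = 0"
      using Cauchy_Integral_Formula.fundamental_theorem_of_algebra[of a m] by blast
    then show False using der nz by metis
  qed
  then have "f z = c 1 * z + c 0" for z using c(3) m by simp
  then show False using nonlinear by blast
qed

lemma not_periodic:
  assumes per: "\<And>z. (f ^^ p) z = z" and p: "0 < p"
  shows False
proof -
  obtain q where q: "p = Suc q" using p gr0_implies_Suc by blast
  have "inj f"
    by (rule inj_on_inverseI[where g = "f ^^ q"]) (use per in \<open>simp add: q funpow_swap1\<close>)
  moreover have "f ((f ^^ q) z) = z" for z using per[of z] by (simp add: q)
  ultimately show False using no_continuous_inverse cont_funpow by blast
qed

lemma AE_not_in_open:
  assumes "open S" "AE z in lebesgue. z \<notin> S"
  shows "S = {}"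
proof (rule ccontr)
  assume "S \<noteq> {}"
  then have "\<not> negligible S" using assms(1) by (rule open_not_negligible[rotated])
  moreover have "negligible S"
    using assms by (simp add: negligible_iff_null_sets AE_iff_null_sets borel_open)
  ultimately show False by simp
qed

text \<open>Preimages of non-empty open sets under iterates are non-empty.  Hence an identity between iterates
that holds almost everywhere yields \<open>f ^^ p = id\<close>, which is excluded for \<open>p > 0\<close>.\<close>

lemma funpow_exponent_unique:
  assumes "AE z in lebesgue. (f ^^ m) z = (f ^^ n) z" and "m \<le> n"
  shows "m = n"
proof (rule ccontr)
  assume "m \<noteq> n"
  then obtain p where p: "n = p + m" "0 < p" using assms(2) by (metis le_neq_implies_less less_imp_add_positive add.commute)
  let ?D = "{w. (f ^^ p) w \<noteq> w}"
  have opD: "open ?D"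
    by (rule open_Collect_neq[OF cont_funpow continuous_on_id])
  have "(f ^^ m) -` ?D = {}"
  proof (rule AE_not_in_open)
    show "open ((f ^^ m) -` ?D)" by (rule open_vimage_funpow[OF opD])
    show "AE z in lebesgue. z \<notin> (f ^^ m) -` ?D"
      using assms(1) by eventually_elim (simp add: p(1) funpow_add)
  qed
  then have "?D = {}" using vimage_funpow_nonempty[OF opD] by blast
  then show False using not_periodic[OF _ p(2)] by blast
qed

lemma deck_funpow: "deck \<gamma> \<Longrightarrow> (f ^^ Suc n) (\<gamma> z) = (f ^^ Suc n) z"
  by (induction n) (simp_all add: deck_def)

text \<open>The class of \<open>\<gamma> \<circ> f\<^sup>n\<close> determines both \<open>\<gamma>\<close> and \<open>n\<close>.  This makes the Ruelle representation
well defined on the semigroup.\<close>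

lemma deck_funpow_unique:
  assumes \<gamma>: "deck \<gamma>" and \<delta>: "deck \<delta>"
    and eq: "AE z in lebesgue. \<gamma> ((f ^^ n) z) = \<delta> ((f ^^ m) z)"
  shows "n = m" "\<gamma> = \<delta>"
proof -
  have eq': "AE z in lebesgue. (f ^^ Suc n) z = (f ^^ Suc m) z"
    using eq
  proof eventually_elim
    case (elim z)
    then have "f (\<gamma> ((f ^^ n) z)) = f (\<delta> ((f ^^ m) z))" by simp
    then show ?case using \<gamma> \<delta> by (simp add: deck_def)
  qed
  then have "AE z in lebesgue. (f ^^ Suc m) z = (f ^^ Suc n) z" by eventually_elim simp
  then show nm: "n = m"
    using funpow_exponent_unique[of "Suc n" "Suc m"] funpow_exponent_unique[of "Suc m" "Suc n"] eq'
    by (metis Suc_inject nat_le_linear)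
  let ?D = "{w \<in> V. \<gamma> w - \<delta> w \<in> - {0}}"
  have opD: "open ?D"
  proof -
    have "continuous_on V (\<lambda>w. \<gamma> w - \<delta> w)"
      using \<gamma> \<delta> by (intro continuous_on_diff holomorphic_on_imp_continuous_on) (simp_all add: deck_def)
    from continuous_open_preimage[OF this open_V, of "- {0}"]
    have "open (V \<inter> (\<lambda>w. \<gamma> w - \<delta> w) -` (- {0}))" by (simp add: open_Compl)
    moreover have "?D = V \<inter> (\<lambda>w. \<gamma> w - \<delta> w) -` (- {0})" by auto
    ultimately show ?thesis by (simp only:)
  qed
  have "(f ^^ n) -` ?D = {}"
  proof (rule AE_not_in_open)
    show "open ((f ^^ n) -` ?D)" by (rule open_vimage_funpow[OF opD])
    show "AE z in lebesgue. z \<notin> (f ^^ n) -` ?D"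
      using eq by eventually_elim (simp add: nm)
  qed
  then have "?D = {}" using vimage_funpow_nonempty[OF opD] by blast
  then have "\<gamma> w = \<delta> w" if "w \<in> V" for w using that by auto
  moreover have "\<gamma> w = \<delta> w" if "w \<notin> V" for w using \<gamma> \<delta> that by (simp add: deck_def)
  ultimately show "\<gamma> = \<delta>" by blast
qed

lemma conj_map_deck:
  assumes "deck \<gamma>"
  shows "conj_map f \<gamma> = \<gamma> \<circ> (f ^^ Suc 0)"
  using deck_inv[OF assms] by (auto simp: conj_map_def deck_def)

lemma AE_vimage:
  assumes null: "\<And>N. negligible N \<Longrightarrow> negligible (g -` N)" and P: "AE z in lebesgue. P z"
  shows "AE z in lebesgue. P (g z)"
proof -
  obtain N where N: "{z. \<not> P z} \<subseteq> N" "N \<in> null_sets lebesgue"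
    using P by (auto elim!: AE_E simp: null_sets_def)
  then have "negligible (g -` N)" by (intro null) (simp add: negligible_iff_null_sets)
  then show ?thesis
    using N(1) by (intro AE_I'[of "g -` N"]) (auto simp: negligible_iff_null_sets)
qed

lemma negligible_vimage_funpow: "negligible N \<Longrightarrow> negligible ((f ^^ n) -` N)"
proof (induction n arbitrary: N)
  case (Suc n)
  have "(f ^^ Suc n) -` N = (f ^^ n) -` (f -` N)" by (auto simp: vimage_def)
  then show ?case using Suc.IH[OF negligible_vimage_f[OF Suc.prems]] by (simp only:)
qed simp

text \<open>Words multiply in this way because \<open>f \<circ> \<delta> = f\<close>: the inner deck transformation is absorbed.\<close>

lemma ae_comp_deck:
  assumes \<gamma>: "deck \<gamma>" and \<delta>: "deck \<delta>"
  shows "ae_comp (ae_class (\<gamma> \<circ> (f ^^ Suc n))) (ae_class (\<delta> \<circ> (f ^^ Suc m)))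
    = ae_class (\<gamma> \<circ> (f ^^ Suc (Suc n + m)))"
proof -
  have pow: "\<gamma> ((f ^^ Suc n) (\<delta> ((f ^^ Suc m) z))) = \<gamma> ((f ^^ Suc (Suc n + m)) z)" for z
  proof -
    have "(f ^^ Suc n) (\<delta> ((f ^^ Suc m) z)) = (f ^^ Suc n) ((f ^^ Suc m) z)"
      by (rule deck_funpow[OF \<delta>])
    also have "\<dots> = (f ^^ (Suc n + Suc m)) z" by (simp only: funpow_add o_apply)
    finally show ?thesis by (simp only: add_Suc_right)
  qed
  show ?thesis
  proof (intro subset_antisym subsetI)
    fix k assume "k \<in> ae_comp (ae_class (\<gamma> \<circ> (f ^^ Suc n))) (ae_class (\<delta> \<circ> (f ^^ Suc m)))"
    then obtain g h where g: "AE z in lebesgue. g z = \<gamma> ((f ^^ Suc n) z)"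
      and h: "AE z in lebesgue. h z = \<delta> ((f ^^ Suc m) z)" and k: "AE z in lebesgue. k z = g (h z)"
      unfolding ae_comp_def ae_class_def by (auto simp del: funpow.simps)
    have "AE z in lebesgue. g (\<delta> ((f ^^ Suc m) z)) = \<gamma> ((f ^^ Suc n) (\<delta> ((f ^^ Suc m) z)))"
    proof (rule AE_vimage[where g = "\<lambda>z. \<delta> ((f ^^ Suc m) z)", OF _ g])
      fix N :: "complex set" assume "negligible N"
      then have "negligible ((f ^^ Suc m) -` (\<delta> -` N))"
        by (intro negligible_vimage_funpow negligible_vimage_deck[OF \<delta>])
      then show "negligible ((\<lambda>z. \<delta> ((f ^^ Suc m) z)) -` N)" by (simp add: vimage_def del: funpow.simps)
    qed
    then have "AE z in lebesgue. k z = \<gamma> ((f ^^ Suc (Suc n + m)) z)"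
      using h k by eventually_elim (simp only: pow)
    then show "k \<in> ae_class (\<gamma> \<circ> (f ^^ Suc (Suc n + m)))"
      by (simp add: ae_class_def del: funpow.simps)
  next
    fix k assume "k \<in> ae_class (\<gamma> \<circ> (f ^^ Suc (Suc n + m)))"
    then have "AE z in lebesgue. k z = (\<gamma> \<circ> (f ^^ Suc n)) ((\<delta> \<circ> (f ^^ Suc m)) z)"
      by (simp add: ae_class_def pow del: funpow.simps)
    then show "k \<in> ae_comp (ae_class (\<gamma> \<circ> (f ^^ Suc n))) (ae_class (\<delta> \<circ> (f ^^ Suc m)))"
      unfolding ae_comp_def ae_class_def
      by (intro CollectI bexI[of _ "\<gamma> \<circ> (f ^^ Suc n)"] bexI[of _ "\<delta> \<circ> (f ^^ Suc m)"])
         (simp_all del: funpow.simps)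
  qed
qed

lemma ae_class_eq_iff: "ae_class g = ae_class h \<longleftrightarrow> (AE z in lebesgue. g z = h z)"
proof
  assume "ae_class g = ae_class h"
  moreover have "g \<in> ae_class g" by (simp add: ae_class_def)
  ultimately show "AE z in lebesgue. g z = h z" by (auto simp: ae_class_def)
next
  assume eq: "AE z in lebesgue. g z = h z"
  have "(AE z in lebesgue. k z = g z) \<longleftrightarrow> (AE z in lebesgue. k z = h z)" for k
  proof
    assume "AE z in lebesgue. k z = g z"
    then show "AE z in lebesgue. k z = h z" using eq by eventually_elim simp
  next
    assume "AE z in lebesgue. k z = h z"
    then show "AE z in lebesgue. k z = g z" using eq by eventually_elim simp
  qed
  then show "ae_class g = ae_class h" by (simp add: ae_class_def)
qed

text \<open>The counterpart of \<open>f \<circ> \<gamma> = f\<close> for operators: \<open>\<gamma>\<close> permutes the preimages of \<open>x\<close> and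
\<open>f' = (f' \<circ> \<gamma>\<^sup>-\<^sup>1) * (\<gamma>\<^sup>-\<^sup>1)'\<close>, so the terms of the sum are only rearranged.\<close>

lemma ruelle_push_forward:
  assumes \<gamma>: "deck \<gamma>" and x: "x \<in> U"
  shows "ruelle_operator f (push_forward \<gamma> \<phi>) x = ruelle_operator f \<phi> x"
proof -
  have inv: "deck (inv \<gamma>)" by (rule deck_inv[OF \<gamma>])
  have finv: "f (inv \<gamma> y) = f y" for y using inv by (simp add: deck_def)
  have summand: "push_forward \<gamma> \<phi> y / (deriv f y)\<^sup>2 = \<phi> (inv \<gamma> y) / (deriv f (inv \<gamma> y))\<^sup>2"
    if y: "y \<in> f -` {x}" for y
  proof -
    have yV: "y \<in> V" using y x by (simp add: in_V_iff)
    have y'V: "inv \<gamma> y \<in> V" using deck_in_V[OF inv] yV by simp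
    have "f = f \<circ> inv \<gamma>" using finv by (simp add: fun_eq_iff)
    then have "deriv f y = deriv (f \<circ> inv \<gamma>) y" by simp
    also have "\<dots> = deriv f (inv \<gamma> y) * deriv (inv \<gamma>) y"
      using inv yV open_V
      by (intro deriv_chain holomorphic_on_imp_differentiable_at[of _ V] holomorphic_on_imp_differentiable_at[OF entire open_UNIV UNIV_I])
        (simp_all add: deck_def)
    finally have "deriv f y = deriv f (inv \<gamma> y) * deriv (inv \<gamma>) y" .
    moreover have "deriv (inv \<gamma>) y \<noteq> 0" using calculation deriv_nz[OF yV] by auto
    ultimately show ?thesis by (simp add: push_forward_def power_mult_distrib)
  qed
  have bij: "bij_betw (inv \<gamma>) (f -` {x}) (f -` {x})"
  proof (rule bij_betwI[where g = \<gamma>])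
    show "inv \<gamma> \<in> f -` {x} \<rightarrow> f -` {x}" using finv by auto
    show "\<gamma> \<in> f -` {x} \<rightarrow> f -` {x}" using \<gamma> by (auto simp: deck_def)
  qed (use \<gamma> in \<open>simp_all add: deck_def bij_is_inj bij_is_surj surj_f_inv_f\<close>)
  have "ruelle_operator f (push_forward \<gamma> \<phi>) x = (\<Sum>\<^sub>\<infinity>y\<in>f -` {x}. \<phi> (inv \<gamma> y) / (deriv f (inv \<gamma> y))\<^sup>2)"
    unfolding ruelle_operator_def by (rule infsum_cong) (rule summand)
  also have "\<dots> = ruelle_operator f \<phi> x"
    unfolding ruelle_operator_def by (rule infsum_reindex_bij_betw[OF bij])
  finally show ?thesis .
qed

end


section \<open>The Ruelle representation and the mean\<close>

context ray_map_set
begin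

lemma AE_on_A: "AE z in lebesgue. P z \<Longrightarrow> AE z in lebesgue_on A. P z"
  using A_meas by (subst AE_restrict_space_iff) (simp, erule eventually_mono, simp)

text \<open>A functional is integration against some bounded \<open>\<mu>\<close>.  Invariance under the Ruelle operator means,
by duality, that \<open>\<mu>\<close> is invariant under the Beltrami pullback along \<open>f\<close>, so that \<open>\<mu>\<close> is an
invariant Beltrami differential and vanishes.\<close>

lemma invariant_functional_eq_0:
  assumes \<Lambda>: "bounded_functional (L1 A) (L1_norm A) \<Lambda>"
    and inv: "\<And>\<phi>. \<phi> \<in> L1 A \<Longrightarrow> \<Lambda> (ruelle_operator f \<phi>) = \<Lambda> \<phi>"
    and no: "\<not> (\<exists>\<mu>. invariant_beltrami f A \<mu> \<and> \<not> (AE z in lebesgue_on A. \<mu> z = 0))"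
    and \<phi>: "\<phi> \<in> L1 A"
  shows "\<Lambda> \<phi> = 0"
proof -
  interpret sigma_finite_measure "lebesgue_on A" by (rule sigma_finite_lebesgue_on[OF A_meas])
  obtain C where C: "\<And>u. u \<in> L1 A \<Longrightarrow> norm (\<Lambda> u) \<le> C * L1_norm A u"
    using \<Lambda> unfolding bounded_functional_def by blast
  have lin: "\<Lambda> (\<lambda>x. c * u x + d * v x) = c * \<Lambda> u + d * \<Lambda> v"
    if "integrable (lebesgue_on A) u" "integrable (lebesgue_on A) v" for u v c d
  proof -
    have "u \<in> L1 A" "v \<in> L1 A" using that by (simp_all add: L1_def)
    then show ?thesis using \<Lambda> by (simp add: bounded_functional_def)
  qed
  have bd: "norm (\<Lambda> u) \<le> C * (\<integral>x. norm (u x) \<partial>lebesgue_on A)" if "integrable (lebesgue_on A) u" for u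
    using C[of u] that by (simp add: L1_def L1_norm_def)
  obtain \<mu> B where \<mu>: "\<mu> \<in> borel_measurable (lebesgue_on A)" "\<And>x. norm (\<mu> x) \<le> B"
    and rep: "\<And>u. integrable (lebesgue_on A) u \<Longrightarrow> \<Lambda> u = (\<integral>x. \<mu> x * u x \<partial>lebesgue_on A)"
  proof (rule L1_functional_eq_integral[of \<Lambda> C])
    fix m B
    assume "m \<in> borel_measurable (lebesgue_on A)" "\<And>x. norm (m x) \<le> B"
      "\<And>u. integrable (lebesgue_on A) u \<Longrightarrow> \<Lambda> u = (\<integral>x. m x * u x \<partial>lebesgue_on A)"
    then show thesis by (rule that)
  qed (erule (1) lin, erule bd)
  let ?p = "\<lambda>y. \<mu> (f y) * (cnj (deriv f y) / deriv f y)"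
  have p: "?p \<in> borel_measurable (lebesgue_on A)"
    and dual: "\<And>u. u \<in> L1 A \<Longrightarrow> (\<integral>x. \<mu> x * ruelle_operator f u x \<partial>lebesgue_on A) = (\<integral>y. ?p y * u y \<partial>lebesgue_on A)"
    by (rule dual_op_measurable[OF dual_op_ruelle \<mu>], rule dual_op_integral[OF dual_op_ruelle \<mu>])
  have pB: "norm (?p y) \<le> B" for y by (rule pullback_bound[where \<psi> = \<mu> and k = f, OF \<mu>(2)])
  have eq: "(\<integral>y. ?p y * u y \<partial>lebesgue_on A) = (\<integral>y. \<mu> y * u y \<partial>lebesgue_on A)" if u: "u \<in> L1 A" for u
  proof -
    have "ruelle_operator f u \<in> L1 A" by (rule L1_contractionD(1)[OF L1_contraction_ruelle u])
    then have "\<Lambda> (ruelle_operator f u) = (\<integral>y. ?p y * u y \<partial>lebesgue_on A)"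
      using rep dual[OF u] by (simp add: L1_def)
    then show ?thesis using inv[OF u] rep[of u] u by (simp add: L1_def)
  qed
  obtain w :: "complex \<Rightarrow> real" where w: "w \<in> borel_measurable (lebesgue_on A)" "\<And>x. w x > 0"
    "integrable (lebesgue_on A) w"
    using obtain_positive_integrable_function by metis
  define D where "D y = ?p y - \<mu> y" for y
  have D[measurable]: "D \<in> borel_measurable (lebesgue_on A)"
    unfolding D_def using p \<mu>(1) by (rule borel_measurable_diff)
  define sg where "sg y = cnj (D y) / complex_of_real (norm (D y))" for y
  have sg: "sg \<in> borel_measurable (lebesgue_on A)" unfolding sg_def by measurable
  have sg1: "norm (sg y) \<le> 1" for y unfolding sg_def by (rule norm_unimodular)
  \<comment> \<open>Tested against \<open>u\<close>, the difference of \<open>\<mu>\<close> and its pullback gives the weighted \<open>L\<^sub>1\<close> norm of this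
    difference.\<close>
  define u where "u y = sg y * complex_of_real (w y)" for y
  have u: "u \<in> L1 A"
  proof -
    have "(\<lambda>y. complex_of_real (w y)) \<in> L1 A" using w(3) by (simp add: L1_def)
    from integrable_bounded_mult[OF sg sg1 this] show ?thesis by (simp add: L1_def u_def[abs_def])
  qed
  have DB: "norm (D y) \<le> B + B" for y
    unfolding D_def by (rule order_trans[OF norm_triangle_ineq4 add_mono[OF pB \<mu>(2)]])
  have wD: "D y * u y = complex_of_real (w y * norm (D y))" for y
  proof -
    have "D y * u y = sg y * D y * complex_of_real (w y)" by (simp add: u_def mult_ac)
    also have "sg y * D y = complex_of_real (norm (D y))" unfolding sg_def by (rule unimodular_mult)
    finally show ?thesis by (simp add: mult.commute)
  qed
  have intD: "integrable (lebesgue_on A) (\<lambda>y. D y * u y)"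
    by (rule integrable_bounded_mult[OF D DB u])
  have "(\<integral>y. D y * u y \<partial>lebesgue_on A) = (\<integral>y. ?p y * u y - \<mu> y * u y \<partial>lebesgue_on A)"
    by (intro Bochner_Integration.integral_cong refl) (simp only: D_def left_diff_distrib)
  also have "\<dots> = (\<integral>y. ?p y * u y \<partial>lebesgue_on A) - (\<integral>y. \<mu> y * u y \<partial>lebesgue_on A)"
    by (rule Bochner_Integration.integral_diff[OF integrable_bounded_mult[OF p pB u] integrable_bounded_mult[OF \<mu> u]])
  also have "\<dots> = 0" using eq[OF u] by simp
  finally have "(\<integral>y. w y * norm (D y) \<partial>lebesgue_on A) = 0"
    unfolding wD integral_complex_of_real of_real_eq_0_iff .
  moreover have "integrable (lebesgue_on A) (\<lambda>y. w y * norm (D y))"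
    using integrable_norm[OF intD] w(2) by (simp add: wD norm_mult abs_of_pos)
  ultimately have "AE y in lebesgue_on A. w y * norm (D y) = 0"
    using integral_nonneg_eq_0_iff_AE[of "lebesgue_on A" "\<lambda>y. w y * norm (D y)"] w(2)
    by (simp add: less_imp_le)
  then have "AE y in lebesgue_on A. ?p y = \<mu> y"
  proof eventually_elim
    case (elim y)
    then have "D y = 0" using w(2)[of y] by simp
    then show ?case by (simp only: D_def right_minus_eq)
  qed
  then have "invariant_beltrami f A \<mu>"
    unfolding invariant_beltrami_def using \<mu> by auto
  then have z: "AE y in lebesgue_on A. \<mu> y = 0" using no by blast
  have "\<Lambda> \<phi> = (\<integral>x. \<mu> x * \<phi> x \<partial>lebesgue_on A)" using rep \<phi> by (simp add: L1_def)
  also have "\<dots> = 0"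
    by (rule integral_eq_zero_AE) (use z in \<open>eventually_elim, simp\<close>)
  finally show ?thesis .
qed

text \<open>The operator that represents the class of \<open>\<gamma> \<circ> f\<^sup>n\<close>.\<close>

definition transfer_word :: "(complex \<Rightarrow> complex) \<Rightarrow> nat \<Rightarrow> (complex \<Rightarrow> complex) \<Rightarrow> complex \<Rightarrow> complex" where
  "transfer_word \<gamma> n \<phi> = push_forward \<gamma> ((ruelle_operator f ^^ n) \<phi>)"

lemma L1_contraction_transfer_word: "deck \<gamma> \<Longrightarrow> L1_contraction A (transfer_word \<gamma> n)"
  unfolding transfer_word_def
  by (rule L1_contraction_comp[OF L1_contraction_push_forward L1_contraction_funpow[OF L1_contraction_ruelle]])

lemma transfer_word_comp:
  assumes \<gamma>: "deck \<gamma>" and \<delta>: "deck \<delta>" and \<phi>: "\<phi> \<in> L1 A"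
  shows "AE x in lebesgue_on A. transfer_word \<gamma> (Suc n) (transfer_word \<delta> m \<phi>) x = transfer_word \<gamma> (Suc (n + m)) \<phi> x"
proof -
  let ?F = "ruelle_operator f"
  define \<eta> where "\<eta> = (?F ^^ m) \<phi>"
  have \<eta>: "\<eta> \<in> L1 A" unfolding \<eta>_def by (rule L1_contractionD(1)[OF L1_contraction_funpow[OF L1_contraction_ruelle] \<phi>])
  have p\<eta>: "push_forward \<delta> \<eta> \<in> L1 A" by (rule L1_contractionD(1)[OF L1_contraction_push_forward[OF \<delta>] \<eta>])
  have "AE x in lebesgue_on A. ?F (push_forward \<delta> \<eta>) x = ?F \<eta> x"
    using AE_on_A[OF AE_in_U] by eventually_elim (rule ruelle_push_forward[OF \<delta>])
  then have "AE x in lebesgue_on A. transfer_word \<gamma> n (?F (push_forward \<delta> \<eta>)) x = transfer_word \<gamma> n (?F \<eta>) x"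
    by (intro L1_contraction_cong[OF L1_contraction_transfer_word[OF \<gamma>]]
        L1_contractionD(1)[OF L1_contraction_ruelle] \<eta> p\<eta>)
  moreover have "transfer_word \<gamma> n (?F (push_forward \<delta> \<eta>)) = transfer_word \<gamma> (Suc n) (transfer_word \<delta> m \<phi>)"
    unfolding transfer_word_def \<eta>_def by (simp only: funpow_Suc_right o_apply)
  moreover have "transfer_word \<gamma> n (?F \<eta>) = transfer_word \<gamma> (Suc (n + m)) \<phi>"
  proof -
    have "(?F ^^ n) (?F \<eta>) = (?F ^^ Suc n) ((?F ^^ m) \<phi>)" unfolding \<eta>_def by (simp only: funpow_Suc_right o_apply)
    also have "\<dots> = (?F ^^ (Suc n + m)) \<phi>" by (simp only: funpow_add o_apply)
    finally show ?thesis unfolding transfer_word_def by (simp only: add_Suc)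
  qed
  ultimately show ?thesis by (simp only:)
qed

lemma ruelle_semigroup_word:
  assumes \<Gamma>: "\<Gamma> \<subseteq> FD f R" and s: "s \<in> ruelle_semigroup f \<Gamma>"
  shows "\<exists>\<gamma>\<in>\<Gamma>. \<exists>n. s = ae_class (\<gamma> \<circ> (f ^^ Suc n))"
  using s
proof (induction rule: ruelle_semigroup.induct)
  case (generator \<gamma>)
  then have "deck \<gamma>" using \<Gamma> FD_deck by blast
  then show ?case using generator conj_map_deck by metis
next
  case (compose s t)
  then obtain \<gamma> n \<delta> m where w: "\<gamma> \<in> \<Gamma>" "s = ae_class (\<gamma> \<circ> (f ^^ Suc n))" "\<delta> \<in> \<Gamma>" "t = ae_class (\<delta> \<circ> (f ^^ Suc m))"
    by metis
  then have "deck \<gamma>" "deck \<delta>" using \<Gamma> FD_deck by blast+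
  then show ?case unfolding w(2,4) using ae_comp_deck w(1) by metis
qed

text \<open>Each element of the semigroup is the class of \<open>\<gamma> \<circ> f\<^sup>n\<close> for unique \<open>\<gamma>\<close> in \<open>\<Gamma>\<close> and \<open>n > 0\<close>, so
\<open>\<gamma>\<^sub>* \<circ> f\<^sub>*\<^sup>n\<close> can serve as its image.\<close>

lemma is_ruelle_representation_exists:
  assumes \<Gamma>: "\<Gamma> \<subseteq> FD f R"
  shows "\<exists>\<rho>. is_ruelle_representation f A \<Gamma> \<rho>"
proof -
  have dk: "deck \<gamma>" if "\<gamma> \<in> \<Gamma>" for \<gamma> using that \<Gamma> FD_deck by blast
  define dec where "dec s = (SOME (\<gamma>, n). \<gamma> \<in> \<Gamma> \<and> s = ae_class (\<gamma> \<circ> (f ^^ Suc n)))" for s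
  define \<rho> where "\<rho> s = transfer_word (fst (dec s)) (Suc (snd (dec s)))" for s
  have \<rho>: "\<rho> (ae_class (\<gamma> \<circ> (f ^^ Suc n))) = transfer_word \<gamma> (Suc n)" if \<gamma>: "\<gamma> \<in> \<Gamma>" for \<gamma> n
  proof -
    let ?s = "ae_class (\<gamma> \<circ> (f ^^ Suc n))"
    obtain \<delta> m where d: "dec ?s = (\<delta>, m)" by (cases "dec ?s")
    have "\<exists>q. case q of (\<delta>, m) \<Rightarrow> \<delta> \<in> \<Gamma> \<and> ?s = ae_class (\<delta> \<circ> (f ^^ Suc m))"
      by (rule exI[of _ "(\<gamma>, n)"]) (simp only: prod.case \<gamma> simp_thms)
    from someI_ex[OF this] have "case dec ?s of (\<delta>, m) \<Rightarrow> \<delta> \<in> \<Gamma> \<and> ?s = ae_class (\<delta> \<circ> (f ^^ Suc m))"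
      unfolding dec_def .
    then have \<delta>: "\<delta> \<in> \<Gamma>" "?s = ae_class (\<delta> \<circ> (f ^^ Suc m))" unfolding d by simp_all
    then have "AE z in lebesgue. \<gamma> ((f ^^ Suc n) z) = \<delta> ((f ^^ Suc m) z)"
      unfolding ae_class_eq_iff o_apply by blast
    from deck_funpow_unique[OF dk[OF \<gamma>] dk[OF \<delta>(1)] this] show ?thesis
      unfolding \<rho>_def d by simp
  qed
  have contr: "L1_contraction A (\<rho> s)" if s: "s \<in> ruelle_semigroup f \<Gamma>" for s
  proof -
    obtain \<gamma> n where \<gamma>: "\<gamma> \<in> \<Gamma>" "s = ae_class (\<gamma> \<circ> (f ^^ Suc n))" using ruelle_semigroup_word[OF \<Gamma> s] by blast
    show ?thesis unfolding \<gamma>(2) \<rho>[OF \<gamma>(1)] by (rule L1_contraction_transfer_word[OF dk[OF \<gamma>(1)]])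
  qed
  have "is_ruelle_representation f A \<Gamma> \<rho>"
    unfolding is_ruelle_representation_def bounded_representation_def
  proof (intro conjI ballI exI[of _ 1])
    fix s assume s: "s \<in> ruelle_semigroup f \<Gamma>"
    show "bounded_endomorphism (L1 A) (L1_norm A) (\<rho> s)"
      by (rule bounded_endomorphism_L1_contraction[OF contr[OF s]])
    show "L1_norm A (\<rho> s \<phi>) \<le> 1 * L1_norm A \<phi>" if "\<phi> \<in> L1 A" for \<phi>
      using L1_contractionD(2)[OF contr[OF s] that] by simp
    fix t \<phi> assume t: "t \<in> ruelle_semigroup f \<Gamma>" and \<phi>: "\<phi> \<in> L1 A"
    obtain \<gamma> n where \<gamma>: "\<gamma> \<in> \<Gamma>" "s = ae_class (\<gamma> \<circ> (f ^^ Suc n))" using ruelle_semigroup_word[OF \<Gamma> s] by blast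
    obtain \<delta> m where \<delta>: "\<delta> \<in> \<Gamma>" "t = ae_class (\<delta> \<circ> (f ^^ Suc m))" using ruelle_semigroup_word[OF \<Gamma> t] by blast
    have st: "\<rho> (ae_comp s t) = transfer_word \<gamma> (Suc (n + Suc m))"
      unfolding \<gamma>(2) \<delta>(2) ae_comp_deck[OF dk[OF \<gamma>(1)] dk[OF \<delta>(1)]] \<rho>[OF \<gamma>(1)] by (simp only: add_Suc add_Suc_right)
    have L: "\<rho> (ae_comp s t) \<phi> \<in> L1 A" "\<rho> s (\<rho> t \<phi>) \<in> L1 A"
      using L1_contractionD(1)[OF contr[OF ruelle_semigroup.compose[OF s t]] \<phi>]
        L1_contractionD(1)[OF contr[OF s] L1_contractionD(1)[OF contr[OF t] \<phi>]] by simp_all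
    have "AE x in lebesgue_on A. \<rho> (ae_comp s t) \<phi> x = \<rho> s (\<rho> t \<phi>) x"
      using transfer_word_comp[OF dk[OF \<gamma>(1)] dk[OF \<delta>(1)] \<phi>, of n "Suc m"]
      unfolding st unfolding \<gamma>(2) \<delta>(2) \<rho>[OF \<gamma>(1)] \<rho>[OF \<delta>(1)] by eventually_elim simp
    then show "L1_norm A (\<lambda>x. \<rho> (ae_comp s t) \<phi> x - \<rho> s (\<rho> t \<phi>) x) = 0"
      using L1_norm_diff_eq_0_iff[OF L] by blast
  next
    fix \<gamma> \<phi> assume \<gamma>: "\<gamma> \<in> \<Gamma>" and "\<phi> \<in> L1 A"
    show "AE x in lebesgue_on A. \<rho> (ae_class (conj_map f \<gamma>)) \<phi> x = push_forward \<gamma> (ruelle_operator f \<phi>) x"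
      unfolding conj_map_deck[OF dk[OF \<gamma>]] \<rho>[OF \<gamma>] transfer_word_def by simp
  qed
  then show ?thesis by blast
qed

end

text \<open>The functional \<open>F \<mapsto> L (F \<circ> q)\<close> is linear and bounded for the supremum norm on \<open>S\<close>, so it vanishes
on the closed span of \<open>E\<close> once it vanishes on \<open>E\<close>.\<close>

lemma coefficient_space_vanish:
  fixes L :: "(nat \<Rightarrow> complex) \<Rightarrow> complex"
  assumes lin: "\<And>x y c d. Bseq x \<Longrightarrow> Bseq y \<Longrightarrow> L (\<lambda>n. c * x n + d * y n) = c * L x + d * L y"
    and bnd: "\<And>x C. (\<And>n. norm (x n) \<le> C) \<Longrightarrow> norm (L x) \<le> C"
    and q: "\<And>k. q k \<in> S"
    and E: "\<And>F. F \<in> E \<Longrightarrow> F \<in> bounded_functions S" "\<And>F. F \<in> E \<Longrightarrow> L (\<lambda>k. F (q k)) = 0"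
    and F: "F \<in> uniform_closure S (complex_span E)"
  shows "L (\<lambda>k. F (q k)) = 0"
proof -
  have Bq: "Bseq (\<lambda>k. F (q k))" if F': "F \<in> bounded_functions S" for F
  proof -
    obtain B where "\<And>s. s \<in> S \<Longrightarrow> norm (F s) \<le> B"
      using F' by (auto simp: bounded_functions_def bounded_iff)
    then show ?thesis using q by (intro BseqI'[of _ B]) blast
  qed
  have L0: "L (\<lambda>k. 0) = 0" using bnd[of "\<lambda>k. 0" 0] by simp
  have span: "Bseq (\<lambda>k. G (q k)) \<and> L (\<lambda>k. G (q k)) = 0" if G': "G \<in> complex_span E" for G
  proof -
    obtain n c g where G: "G = (\<lambda>s. \<Sum>i<n. c i * g i s)" and g: "\<And>i. i < (n::nat) \<Longrightarrow> g i \<in> E"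
      using G' unfolding complex_span_def by blast
    have "m \<le> n \<Longrightarrow> Bseq (\<lambda>k. \<Sum>i<m. c i * g i (q k)) \<and> L (\<lambda>k. \<Sum>i<m. c i * g i (q k)) = 0" for m
    proof (induction m)
      case 0
      show ?case using L0 by simp
    next
      case (Suc m)
      then have IH: "Bseq (\<lambda>k. \<Sum>i<m. c i * g i (q k))" "L (\<lambda>k. \<Sum>i<m. c i * g i (q k)) = 0" by simp_all
      have gm: "g m \<in> E" using g Suc.prems by simp
      note B = Bq[OF E(1)[OF gm]]
      have "(\<lambda>k. \<Sum>i<Suc m. c i * g i (q k)) = (\<lambda>k. 1 * (\<Sum>i<m. c i * g i (q k)) + c m * g m (q k))" by simp
      then show ?case
        using Bseq_linear_combination[OF IH(1) B, of 1 "c m"] lin[OF IH(1) B, of 1 "c m"] IH(2) E(2)[OF gm]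
        by (simp only: mult_zero_right add_0_right simp_thms)
    qed
    then show ?thesis unfolding G by blast
  qed
  have "norm (L (\<lambda>k. F (q k))) \<le> e" if e: "e > 0" for e
  proof -
    have Fb: "F \<in> bounded_functions S" using F by (simp add: uniform_closure_def)
    obtain G where G: "G \<in> complex_span E" "\<And>s. s \<in> S \<Longrightarrow> norm (F s - G s) \<le> e"
      using F e unfolding uniform_closure_def by blast
    have "L (\<lambda>k. 1 * F (q k) + (-1) * G (q k)) = 1 * L (\<lambda>k. F (q k)) + (-1) * L (\<lambda>k. G (q k))"
      by (rule lin[OF Bq[OF Fb]]) (use span[OF G(1)] in blast)
    also have "\<dots> = L (\<lambda>k. F (q k))" using span[OF G(1)] by simp
    finally show ?thesis using bnd[of "\<lambda>k. 1 * F (q k) + (-1) * G (q k)" e] G(2)[OF q] by simp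
  qed
  then show ?thesis by (metis dense_ge norm_le_zero_iff)
qed

theorem proposition39:
  fixes f :: "complex \<Rightarrow> complex" and R A :: "complex set"
    and \<Gamma> :: "(complex \<Rightarrow> complex) set"
  assumes entire: "f holomorphic_on UNIV"
    and nonconstant: "\<not> f constant_on UNIV"
    and nonlinear: "\<not> (\<exists>a b. \<forall>z. f z = a * z + b)"
    and ray: "rectifiable_ray R"
    and class_R: "singular_set f \<subseteq> R"
    and A_measurable: "A \<in> sets lebesgue"
    and A_positive: "emeasure lebesgue A > 0"
    and A_invariant: "f -` A = A"
    and \<Gamma>_FD: "\<Gamma> \<subseteq> FD f R"
    and \<Gamma>_nonempty: "\<Gamma> \<noteq> {}"
    and no_beltrami: "\<not> (\<exists>\<mu>. invariant_beltrami f A \<mu> \<and> \<not> (AE z in lebesgue_on A. \<mu> z = 0))"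
  shows "left_amenable_wrt (ruelle_semigroup f \<Gamma>) ae_comp (L1 A) (L1_norm A)
           (ruelle_representation f A \<Gamma>)"
proof -
  interpret ray_map_set f R A
    by unfold_locales (fact entire nonlinear ray class_R A_measurable A_invariant)+
  let ?S = "ruelle_semigroup f \<Gamma>" and ?F = "ruelle_operator f"
  define \<rho> where "\<rho> = ruelle_representation f A \<Gamma>"
  have "is_ruelle_representation f A \<Gamma> \<rho>"
    unfolding \<rho>_def ruelle_representation_def
    by (rule someI_ex[OF is_ruelle_representation_exists[OF \<Gamma>_FD]])
  then have end\<rho>: "\<And>s. s \<in> ?S \<Longrightarrow> bounded_endomorphism (L1 A) (L1_norm A) (\<rho> s)"
    and mult: "\<And>s t \<phi>. s \<in> ?S \<Longrightarrow> t \<in> ?S \<Longrightarrow> \<phi> \<in> L1 A \<Longrightarrow>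
        L1_norm A (\<lambda>x. \<rho> (ae_comp s t) \<phi> x - \<rho> s (\<rho> t \<phi>) x) = 0"
    and bdd: "\<exists>C. \<forall>s\<in>?S. \<forall>\<phi>\<in>L1 A. L1_norm A (\<rho> s \<phi>) \<le> C * L1_norm A \<phi>"
    and gen: "\<And>\<gamma> \<phi>. \<gamma> \<in> \<Gamma> \<Longrightarrow> \<phi> \<in> L1 A \<Longrightarrow>
        AE x in lebesgue_on A. \<rho> (ae_class (conj_map f \<gamma>)) \<phi> x = push_forward \<gamma> (?F \<phi>) x"
    unfolding is_ruelle_representation_def bounded_representation_def by blast+
  have \<rho>L: "\<rho> s \<phi> \<in> L1 A" if "s \<in> ?S" "\<phi> \<in> L1 A" for s \<phi>
    using end\<rho>[OF that(1)] that(2) unfolding bounded_endomorphism_def by blast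
  have mult_AE: "AE x in lebesgue_on A. \<rho> (ae_comp s t) \<phi> x = \<rho> s (\<rho> t \<phi>) x"
    if "s \<in> ?S" "t \<in> ?S" "\<phi> \<in> L1 A" for s t \<phi>
    using mult[OF that] that by (subst (asm) L1_norm_diff_eq_0_iff) (auto intro: \<rho>L ruelle_semigroup.compose)
  obtain \<gamma> where \<gamma>: "\<gamma> \<in> \<Gamma>" using \<Gamma>_nonempty by blast
  have dk: "deck \<gamma>" using \<gamma> \<Gamma>_FD FD_deck by blast
  define g where "g = ae_class (conj_map f \<gamma>)"
  have gS: "g \<in> ?S" unfolding g_def by (rule ruelle_semigroup.generator[OF \<gamma>])
  define p where "p k = (ae_comp g ^^ k) g" for k
  have pS: "p k \<in> ?S" for k
    by (induction k) (simp_all add: p_def gS ruelle_semigroup.compose)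
  have \<rho>p: "AE x in lebesgue_on A. \<rho> (p k) \<phi> x = transfer_word \<gamma> (Suc k) \<phi> x" if \<phi>: "\<phi> \<in> L1 A" for k \<phi>
  proof (induction k)
    case 0
    show ?case using gen[OF \<gamma> \<phi>] by (simp add: p_def g_def transfer_word_def)
  next
    case (Suc k)
    have w: "transfer_word \<gamma> n \<phi> \<in> L1 A" for n by (rule L1_contractionD(1)[OF L1_contraction_transfer_word[OF dk] \<phi>])
    have p\<phi>: "\<rho> (p k) \<phi> \<in> L1 A" by (rule \<rho>L[OF pS \<phi>])
    have 1: "AE x in lebesgue_on A. \<rho> (p (Suc k)) \<phi> x = \<rho> g (\<rho> (p k) \<phi>) x"
      using mult_AE[OF gS pS \<phi>, of k] by (simp add: p_def)
    have 2: "AE x in lebesgue_on A. \<rho> g (\<rho> (p k) \<phi>) x = transfer_word \<gamma> (Suc 0) (\<rho> (p k) \<phi>) x"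
      using gen[OF \<gamma> p\<phi>] by (simp add: g_def transfer_word_def)
    have 3: "AE x in lebesgue_on A. transfer_word \<gamma> (Suc 0) (\<rho> (p k) \<phi>) x = transfer_word \<gamma> (Suc 0) (transfer_word \<gamma> (Suc k) \<phi>) x"
      by (rule L1_contraction_cong[OF L1_contraction_transfer_word[OF dk] p\<phi> w Suc.IH])
    have 4: "AE x in lebesgue_on A. transfer_word \<gamma> (Suc 0) (transfer_word \<gamma> (Suc k) \<phi>) x = transfer_word \<gamma> (Suc (Suc k)) \<phi> x"
      using transfer_word_comp[OF dk dk \<phi>, of 0 "Suc k"] by (simp only: add_0)
    show ?case using 1 2 3 4 by eventually_elim simp
  qed
  obtain L :: "(nat \<Rightarrow> complex) \<Rightarrow> complex" where
    L_lin: "\<And>x y c d. Bseq x \<Longrightarrow> Bseq y \<Longrightarrow> L (\<lambda>n. c * x n + d * y n) = c * L x + d * L y"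
    and L_pos: "\<And>x. (\<And>n. x n \<in> \<real>\<^sub>\<ge>\<^sub>0) \<Longrightarrow> Bseq x \<Longrightarrow> L x \<in> \<real>\<^sub>\<ge>\<^sub>0"
    and L_const: "\<And>c. L (\<lambda>n. c) = c"
    and L_shift: "\<And>x. Bseq x \<Longrightarrow> L (\<lambda>n. x (Suc n)) = L x"
    and L_bnd: "\<And>x C. (\<And>n. norm (x n) \<le> C) \<Longrightarrow> norm (L x) \<le> C"
    using ex_Banach_limit by blast
  \<comment> \<open>The averages of a coefficient along the powers of \<open>g\<close> define an \<open>f\<^sub>*\<close>-invariant functional of
    the vector, which vanishes as there is no invariant Beltrami differential.\<close>
  have key: "L (\<lambda>k. l (\<rho> (p k) \<phi>)) = 0"
    if l: "bounded_functional (L1 A) (L1_norm A) l" and \<phi>: "\<phi> \<in> L1 A" for l \<phi>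
  proof -
    let ?W = "\<lambda>k. transfer_word \<gamma> (Suc k)"
    have W: "L1_contraction A (?W k)" for k by (rule L1_contraction_transfer_word[OF dk])
    have lW: "bounded_functional (L1 A) (L1_norm A) (\<lambda>u. l (?W k u))" for k
      by (rule bounded_functional_comp[OF l bounded_endomorphism_L1_contraction[OF W]])
    obtain C0 where C0: "\<And>u. u \<in> L1 A \<Longrightarrow> norm (l u) \<le> C0 * L1_norm A u"
      using l unfolding bounded_functional_def by blast
    define C where "C = max C0 0"
    have C: "norm (l (?W k u)) \<le> C * L1_norm A u" if u: "u \<in> L1 A" for k u
    proof -
      have "norm (l (?W k u)) \<le> C0 * L1_norm A (?W k u)" by (rule C0[OF L1_contractionD(1)[OF W u]])
      also have "\<dots> \<le> C * L1_norm A (?W k u)" unfolding C_def using L1_norm_nonneg by (intro mult_right_mono) auto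
      also have "\<dots> \<le> C * L1_norm A u" using L1_contractionD(2)[OF W u] by (intro mult_left_mono) (auto simp: C_def)
      finally show ?thesis .
    qed
    have Bs: "Bseq (\<lambda>k. l (?W k u))" if "u \<in> L1 A" for u
      using C[OF that] by (rule BseqI')
    define \<Lambda> where "\<Lambda> u = L (\<lambda>k. l (?W k u))" for u
    have "bounded_functional (L1 A) (L1_norm A) \<Lambda>"
      unfolding bounded_functional_def
    proof (intro conjI ballI allI exI[of _ C])
      fix u v c d assume u: "u \<in> L1 A" and v: "v \<in> L1 A"
      have "l (?W k (\<lambda>y. c * u y + d * v y)) = c * l (?W k u) + d * l (?W k v)" for k
        using lW[of k] u v unfolding bounded_functional_def by blast
      then show "\<Lambda> (\<lambda>y. c * u y + d * v y) = c * \<Lambda> u + d * \<Lambda> v"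
        unfolding \<Lambda>_def using L_lin[OF Bs[OF u] Bs[OF v]] by simp
    next
      fix u assume u: "u \<in> L1 A"
      show "norm (\<Lambda> u) \<le> C * L1_norm A u"
        unfolding \<Lambda>_def by (rule L_bnd) (rule C[OF u])
    qed
    moreover have "\<Lambda> (?F u) = \<Lambda> u" if u: "u \<in> L1 A" for u
    proof -
      have "?W k (?F u) = ?W (Suc k) u" for k
        unfolding transfer_word_def funpow_Suc_right[of "Suc k"] o_apply ..
      then show ?thesis unfolding \<Lambda>_def using L_shift[OF Bs[OF u]] by simp
    qed
    ultimately have "\<Lambda> \<phi> = 0"
      by (rule invariant_functional_eq_0[OF _ _ no_beltrami \<phi>])
    moreover have "l (\<rho> (p k) \<phi>) = l (?W k \<phi>)" for k
      by (rule bounded_functional_cong[OF l \<rho>L[OF pS \<phi>] L1_contractionD(1)[OF W \<phi>] \<rho>p[OF \<phi>]])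
    ultimately show ?thesis by (simp add: \<Lambda>_def)
  qed
  let ?E = "matrix_coefficients (L1 A) (L1_norm A) \<rho>"
  have E_bdd: "F \<in> bounded_functions ?S" if "F \<in> ?E" for F
  proof -
    obtain \<phi> l where F: "F = (\<lambda>s. l (\<rho> s \<phi>))" and \<phi>: "\<phi> \<in> L1 A" and l: "bounded_functional (L1 A) (L1_norm A) l"
      using \<open>F \<in> ?E\<close> unfolding matrix_coefficients_def by blast
    obtain C where C: "\<And>u. u \<in> L1 A \<Longrightarrow> norm (l u) \<le> C * L1_norm A u"
      using l unfolding bounded_functional_def by blast
    obtain D where D: "\<And>s. s \<in> ?S \<Longrightarrow> L1_norm A (\<rho> s \<phi>) \<le> D * L1_norm A \<phi>" using bdd \<phi> by blast
    have "norm (F s) \<le> max C 0 * (D * L1_norm A \<phi>)" if s: "s \<in> ?S" for s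
    proof -
      have "norm (F s) \<le> C * L1_norm A (\<rho> s \<phi>)" unfolding F by (rule C[OF \<rho>L[OF s \<phi>]])
      also have "\<dots> \<le> max C 0 * L1_norm A (\<rho> s \<phi>)" using L1_norm_nonneg by (intro mult_right_mono) auto
      also have "\<dots> \<le> max C 0 * (D * L1_norm A \<phi>)" using D[OF s] by (intro mult_left_mono) auto
      finally show ?thesis .
    qed
    then show ?thesis unfolding bounded_functions_def bounded_iff by blast
  qed
  have E_p: "L (\<lambda>k. F (p k)) = 0" if "F \<in> ?E" for F
    using that key unfolding matrix_coefficients_def by blast
  have E_sp: "L (\<lambda>k. F (ae_comp s (p k))) = 0" if s: "s \<in> ?S" and "F \<in> ?E" for s F
  proof -
    obtain \<phi> l where F: "F = (\<lambda>s. l (\<rho> s \<phi>))" and \<phi>: "\<phi> \<in> L1 A" and l: "bounded_functional (L1 A) (L1_norm A) l"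
      using \<open>F \<in> ?E\<close> unfolding matrix_coefficients_def by blast
    have "F (ae_comp s (p k)) = l (\<rho> s (\<rho> (p k) \<phi>))" for k
      unfolding F
      by (rule bounded_functional_cong[OF l \<rho>L[OF ruelle_semigroup.compose[OF s pS] \<phi>] \<rho>L[OF s \<rho>L[OF pS \<phi>]] mult_AE[OF s pS \<phi>]])
    then show ?thesis using key[OF bounded_functional_comp[OF l end\<rho>[OF s]] \<phi>] by simp
  qed
  have spS: "ae_comp s (p k) \<in> ?S" if "s \<in> ?S" for s k by (rule ruelle_semigroup.compose[OF that pS])
  have Bp: "Bseq (\<lambda>k. F (q k))" if Fb: "F \<in> bounded_functions ?S" and q: "\<And>k. q k \<in> ?S" for F q
  proof -
    obtain B where "\<And>s. s \<in> ?S \<Longrightarrow> norm (F s) \<le> B"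
      using Fb by (auto simp: bounded_functions_def bounded_iff)
    then show ?thesis using q by (intro BseqI'[of _ B]) blast
  qed
  define M where "M F = L (\<lambda>k. F (p k))" for F
  have "is_mean ?S M"
    unfolding is_mean_def M_def
  proof (intro conjI ballI allI impI)
    show "L (\<lambda>k. c * F (p k) + d * G (p k)) = c * L (\<lambda>k. F (p k)) + d * L (\<lambda>k. G (p k))"
      if "F \<in> bounded_functions ?S" "G \<in> bounded_functions ?S" for F G c d
      by (rule L_lin[OF Bp[OF that(1) pS] Bp[OF that(2) pS]])
    show "L (\<lambda>k. F (p k)) \<in> \<real>\<^sub>\<ge>\<^sub>0" if "F \<in> bounded_functions ?S" "\<forall>s\<in>?S. F s \<in> \<real>\<^sub>\<ge>\<^sub>0" for F
      by (rule L_pos[OF _ Bp[OF that(1) pS]]) (use that(2) pS in blast)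
    show "L (\<lambda>k. 1) = 1" by (rule L_const)
  qed
  moreover have "M (\<lambda>t. F (ae_comp s t)) = M F"
    if s: "s \<in> ?S" and F: "F \<in> coefficient_space_with_constants ?S (L1 A) (L1_norm A) \<rho>" for s F
  proof -
    obtain G c where G: "F = (\<lambda>s. G s + c)" "G \<in> uniform_closure ?S (complex_span ?E)"
      using F unfolding coefficient_space_with_constants_def coefficient_space_def by blast
    have Gb: "G \<in> bounded_functions ?S" using G(2) by (simp add: uniform_closure_def)
    have coeff_mean: "L (\<lambda>k. F (q k)) = c" if q: "\<And>k. q k \<in> ?S" and E0: "\<And>F. F \<in> ?E \<Longrightarrow> L (\<lambda>k. F (q k)) = 0" for q
    proof -
      have "Bseq (\<lambda>k::nat. c)" by (rule BseqI'[of _ "norm c"]) simp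
      from L_lin[OF Bp[where q = q, OF Gb q] this, where c = 1 and d = 1]
      have "L (\<lambda>k. G (q k) + c) = L (\<lambda>k. G (q k)) + c" by (simp add: L_const)
      also have "L (\<lambda>k. G (q k)) = 0"
      proof (rule coefficient_space_vanish[where S = ?S and E = ?E and L = L and q = q and F = G])
        show "L (\<lambda>n. c * x n + d * y n) = c * L x + d * L y" if "Bseq x" "Bseq y" for x y c d
          by (rule L_lin[OF that])
        show "norm (L x) \<le> C" if "\<And>n. norm (x n) \<le> C" for x C
          by (rule L_bnd[OF that])
      qed (rule q, erule E_bdd, erule E0, rule G(2))
      finally show ?thesis by (simp add: G(1))
    qed
    have "L (\<lambda>k. F (ae_comp s (p k))) = c"
      by (rule coeff_mean[where q = "\<lambda>k. ae_comp s (p k)", OF spS[OF s] E_sp[OF s]])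
    moreover have "L (\<lambda>k. F (p k)) = c"
      by (rule coeff_mean[where q = p, OF pS E_p])
    ultimately show ?thesis by (simp only: M_def)
  qed
  ultimately show ?thesis
    unfolding left_amenable_wrt_def \<rho>_def[symmetric] by (intro exI[of _ M] conjI ballI)
qed

end
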